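(* Let $\Bbbk$ be an algebraically closed field of characteristic $2$. Let $V$ be one of the following braided vector spaces (defined in the context): (1) $\mathfrak{L}_{\wp}(1,1)$, with $\wp\in\Bbbk^{\times}$; (2) $\mathfrak{L}_{\wp}(1,a)$, with $\wp\in\Bbbk^{\times}$ and $a\in\Bbbk$, $a\neq 1$; (3) $\mathfrak{P}(\mathbf{q},\mathbf{a})$, with $t\geq 2$, $\theta=t+1$, $\mathbf{a}=(a_1,\dots,a_t)\in(\Bbbk^{\times})^t$ and $\mathbf{q}=(q_{ij})_{1\le i,j\le\theta}$ a matrix with entries in $\Bbbk^\times$ satisfying $q_{ii}=1$ for all $i$ and $q_{ij}q_{ji}=1$ for all $i\neq j$; (4) $\mathfrak{E}_{\wp}(1)$, with $\wp\in\Bbbk^{\times}$; (5) $\mathfrak{E}_{\wp}(\omega)$, with $\wp\in\Bbbk^{\times}$ and $\omega\in\Bbbk$ a primitive cubic root of unity. Then the Nichols algebra $\mathscr{B}(V)$ is finite-dimensional.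
   Context: A braided vector space is a pair $(V,c)$ with $c\in GL(V\otimes V)$ satisfying the braid equation $(c\otimes \mathrm{id})(\mathrm{id}\otimes c)(c\otimes \mathrm{id})=(\mathrm{id}\otimes c)(c\otimes \mathrm{id})(\mathrm{id}\otimes c)$. The Nichols algebra $\mathscr{B}(V)$ is the unique graded connected braided Hopf algebra quotient $\bigoplus_{n\ge0}\mathscr{B}^n(V)$ of the tensor algebra $T(V)$ whose degree-one part is $V$ and coincides with the space of primitive elements; as an algebra it depends only on the braiding $c$. If $V$ is a Yetter-Drinfeld module, its braiding is $c(v\otimes w)=v_{(-1)}\cdot w\otimes v_{(0)}$. For $\wp, q_{22}\in\Bbbk^\times$, $a\in\Bbbk$, put $q_{12}=\wp$, $q_{21}=\wp^{-1}$. The braided vector space $\mathfrak{L}_{\wp}(q_{22},a)$ has basis $x_1,x_2,x_3$ and braiding, for $i\in\{1,2\}$: $c(x_i\otimes x_1)=x_1\otimes x_i$, $c(x_i\otimes x_2)=(x_2+x_1)\otimes x_i$, $c(x_i\otimes x_3)=q_{12}\,x_3\otimes x_i$, and $c(x_3\otimes x_1)=q_{21}\,x_1\otimes x_3$, $c(x_3\otimes x_2)=q_{21}(x_2+a x_1)\otimes x_3$, $c(x_3\otimes x_3)=q_{22}\,x_3\otimes x_3$. The braided vector space $\mathfrak{E}_{\wp}(q_{22})$ has basis $x_1,x_2,x_3$ and braiding, for $i\in\{1,2\}$: $c(x_i\otimes x_1)=x_1\otimes x_i$, $c(x_i\otimes x_2)=x_2\otimes x_i$, $c(x_i\otimes x_3)=q_{12}\,x_3\otimes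 x_i$, and $c(x_3\otimes x_1)=q_{21}\,x_1\otimes x_3$, $c(x_3\otimes x_2)=q_{21}(x_2+x_1)\otimes x_3$, $c(x_3\otimes x_3)=q_{22}\,x_3\otimes x_3$, again with $q_{12}=\wp$, $q_{21}=\wp^{-1}$. For $t\ge2$, $\theta=t+1$, let $\mathbb I^{\ddagger}=\{k,k+\tfrac12: 1\le k\le t\}\cup\{\theta\}$, and let $\lfloor\cdot\rfloor$ denote the integral part. The braided vector space $\mathfrak{P}(\mathbf{q},\mathbf{a})$ has basis $(x_i)_{i\in\mathbb I^{\ddagger}}$ and braiding: $c(x_i\otimes x_j)=q_{\lfloor i\rfloor\lfloor j\rfloor}\,x_j\otimes x_i$ if $\lfloor i\rfloor\le t$ and $\lfloor i\rfloor\neq\lfloor j\rfloor$; $c(x_i\otimes x_j)=x_j\otimes x_i$ if $\lfloor i\rfloor=j\le t$; $c(x_i\otimes x_j)=(x_j+x_{\lfloor j\rfloor})\otimes x_i$ if $\lfloor i\rfloor\le t$ and $j=\lfloor i\rfloor+\tfrac12$; $c(x_\theta\otimes x_j)=q_{\theta j}\,x_j\otimes x_\theta$ if $j\in\{1,\dots,\theta\}$; $c(x_\theta\otimes x_j)=q_{\theta\lfloor j\rfloor}(x_j+a_{\lfloor j\rfloor}x_{\lfloor j\rfloor})\otimes x_\theta$ if $j\in\mathbb I^\ddagger\setminus\{1,\dots,\theta\}$. *)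

theory Defs
  imports
    "HOL-Library.Poly_Mapping"
    "HOL-Library.Cardinality"
    "HOL-Computational_Algebra.Computational_Algebra"
begin

section \<open>Vector spaces with a given basis\<close>

text \<open>
  \<^typ>\<open>'b \<Rightarrow>\<^sub>0 'k\<close> is the vector space with basis \<^typ>\<open>'b\<close>. For a vector space \<open>V\<close> with
  basis \<^typ>\<open>'i\<close>, the tensor algebra \<open>T(V)\<close> has the basis of words \<^typ>\<open>'i list\<close>, the word
  \<open>[i, j, k]\<close> being \<open>x\<^sub>i \<otimes> x\<^sub>j \<otimes> x\<^sub>k\<close>, and \<open>T(V) \<otimes> T(V)\<close> has the basis of pairs of words.
\<close>

definition scale :: "'k::field \<Rightarrow> ('b \<Rightarrow>\<^sub>0 'k) \<Rightarrow> ('b \<Rightarrow>\<^sub>0 'k)"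
  where "scale r p = Poly_Mapping.map ((*) r) p"

lemma lookup_scale: "Poly_Mapping.lookup (scale r p) b = r * Poly_Mapping.lookup p b"
  by (simp add: scale_def Poly_Mapping.map.rep_eq when_def)

interpretation fsupp: vector_space "scale :: 'k::field \<Rightarrow> ('b \<Rightarrow>\<^sub>0 'k) \<Rightarrow> ('b \<Rightarrow>\<^sub>0 'k)"
  by unfold_locales (auto intro!: poly_mapping_eqI simp: lookup_scale lookup_add algebra_simps)

abbreviation basis_vec :: "'b \<Rightarrow> ('b \<Rightarrow>\<^sub>0 'k::field)"
  where "basis_vec b \<equiv> Poly_Mapping.single b 1"

definition lin_ext :: "('b \<Rightarrow> ('d \<Rightarrow>\<^sub>0 'k::field)) \<Rightarrow> ('b \<Rightarrow>\<^sub>0 'k) \<Rightarrow> ('d \<Rightarrow>\<^sub>0 'k)"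
  where "lin_ext f p = (\<Sum>b\<in>Poly_Mapping.keys p. scale (Poly_Mapping.lookup p b) (f b))"

type_synonym ('i, 'k) tensor_alg = "'i list \<Rightarrow>\<^sub>0 'k"
type_synonym ('i, 'k) tensor_alg2 = "'i list \<times> 'i list \<Rightarrow>\<^sub>0 'k"

definition tens :: "('b \<Rightarrow>\<^sub>0 'k::field) \<Rightarrow> ('d \<Rightarrow>\<^sub>0 'k) \<Rightarrow> ('b \<times> 'd \<Rightarrow>\<^sub>0 'k)"
  where "tens p q = lin_ext (\<lambda>b. lin_ext (\<lambda>d. basis_vec (b, d)) q) p"

definition tens_map ::
    "(('b \<Rightarrow>\<^sub>0 'k::field) \<Rightarrow> ('b' \<Rightarrow>\<^sub>0 'k)) \<Rightarrow> (('d \<Rightarrow>\<^sub>0 'k) \<Rightarrow> ('d' \<Rightarrow>\<^sub>0 'k)) \<Rightarrow>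
     ('b \<times> 'd \<Rightarrow>\<^sub>0 'k) \<Rightarrow> ('b' \<times> 'd' \<Rightarrow>\<^sub>0 'k)"
  where "tens_map f g = lin_ext (\<lambda>(b, d). tens (f (basis_vec b)) (g (basis_vec d)))"

section \<open>The tensor algebra as a braided Hopf algebra\<close>

text \<open>
  A linear endomorphism \<open>c\<close> of \<open>V \<otimes> V\<close> is given by its values \<open>c i j = c(x\<^sub>i \<otimes> x\<^sub>j)\<close> on the
  basis. The notions below only have their usual meaning if \<open>c\<close> is bijective and satisfies the
  braid equation.
\<close>

type_synonym ('i, 'k) braiding = "'i \<Rightarrow> 'i \<Rightarrow> ('i \<times> 'i \<Rightarrow>\<^sub>0 'k)"

text \<open>
  The extension of \<open>c\<close> to \<open>T(V) \<otimes> T(V)\<close>, determined by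
  \<open>c (id \<otimes> m) = (m \<otimes> id) (id \<otimes> c) (c \<otimes> id)\<close> (used for \<open>braid_letter\<close>) and
  \<open>c (m \<otimes> id) = (id \<otimes> m) (c \<otimes> id) (id \<otimes> c)\<close> (used for \<open>braid_word\<close>), where \<open>m\<close> is the
  multiplication. The second components occurring in \<open>braid_letter c i v\<close>, which represents
  \<open>c(x\<^sub>i \<otimes> v)\<close>, are single letters.
\<close>

fun braid_letter :: "('i, 'k::field) braiding \<Rightarrow> 'i \<Rightarrow> 'i list \<Rightarrow> ('i list \<times> 'i \<Rightarrow>\<^sub>0 'k)"
  where
    "braid_letter c i [] = basis_vec ([], i)"
  | "braid_letter c i (j # v) =
       lin_ext (\<lambda>(k, l). lin_ext (\<lambda>(u, m). basis_vec (k # u, m)) (braid_letter c l v)) (c i j)"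

fun braid_word :: "('i, 'k::field) braiding \<Rightarrow> 'i list \<Rightarrow> 'i list \<Rightarrow> ('i, 'k) tensor_alg2"
  where
    "braid_word c [] v = basis_vec (v, [])"
  | "braid_word c (i # u) v =
       lin_ext (\<lambda>(v', u'). lin_ext (\<lambda>(v'', m). basis_vec (v'', m # u')) (braid_letter c i v'))
         (braid_word c u v)"

definition braid :: "('i, 'k::field) braiding \<Rightarrow> ('i, 'k) tensor_alg2 \<Rightarrow> ('i, 'k) tensor_alg2"
  where "braid c = lin_ext (\<lambda>(u, v). braid_word c u v)"

definition mult :: "('i, 'k::field) tensor_alg2 \<Rightarrow> ('i, 'k) tensor_alg"
  where "mult = lin_ext (\<lambda>(u, v). basis_vec (u @ v))"

definition unit :: "('i, 'k::field) tensor_alg"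
  where "unit = basis_vec []"

text \<open>The product \<open>(m \<otimes> m) (id \<otimes> c \<otimes> id)\<close> of the algebra \<open>T(V) \<otimes> T(V)\<close>.\<close>

definition braided_mult ::
    "('i, 'k::field) braiding \<Rightarrow> ('i, 'k) tensor_alg2 \<Rightarrow> ('i, 'k) tensor_alg2 \<Rightarrow> ('i, 'k) tensor_alg2"
  where "braided_mult c X Y =
    lin_ext (\<lambda>(u, v). lin_ext (\<lambda>(u', v').
      lin_ext (\<lambda>(a, b). basis_vec (u @ a, b @ v')) (braid_word c v u')) Y) X"

text \<open>
  The comultiplication is the algebra map \<open>T(V) \<rightarrow> T(V) \<otimes> T(V)\<close> with
  \<open>x\<^sub>i \<mapsto> x\<^sub>i \<otimes> 1 + 1 \<otimes> x\<^sub>i\<close>, the target carrying the braided product.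
\<close>

fun comult_word :: "('i, 'k::field) braiding \<Rightarrow> 'i list \<Rightarrow> ('i, 'k) tensor_alg2"
  where
    "comult_word c [] = basis_vec ([], [])"
  | "comult_word c (i # w) =
       braided_mult c (basis_vec ([i], []) + basis_vec ([], [i])) (comult_word c w)"

definition comult :: "('i, 'k::field) braiding \<Rightarrow> ('i, 'k) tensor_alg \<Rightarrow> ('i, 'k) tensor_alg2"
  where "comult c = lin_ext (comult_word c)"

definition counit :: "('i, 'k::field) tensor_alg \<Rightarrow> 'k"
  where "counit p = Poly_Mapping.lookup p []"

definition homog_part :: "nat \<Rightarrow> ('i, 'k::field) tensor_alg \<Rightarrow> ('i, 'k) tensor_alg"
  where "homog_part n = lin_ext (\<lambda>w. if length w = n then basis_vec w else 0)"

section \<open>Nichols algebras\<close>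

text \<open>
  Quotients of \<open>T(V)\<close> are described by their kernels \<open>J\<close>. The kernel of
  \<open>T(V) \<otimes> T(V) \<rightarrow> T(V)/J \<otimes> T(V)/J\<close> is \<open>J \<otimes> T(V) + T(V) \<otimes> J\<close>.
\<close>

definition tens_kernel :: "('i, 'k::field) tensor_alg set \<Rightarrow> ('i, 'k) tensor_alg2 set"
  where "tens_kernel J = fsupp.span ({tens p q |p q. p \<in> J} \<union> {tens p q |p q. q \<in> J})"

definition graded_ideal :: "('i, 'k::field) tensor_alg set \<Rightarrow> bool"
  where "graded_ideal J \<longleftrightarrow>
    fsupp.subspace J \<and>
    (\<forall>p\<in>J. \<forall>q. mult (tens p q) \<in> J \<and> mult (tens q p) \<in> J) \<and>
    (\<forall>p\<in>J. \<forall>n. homog_part n p \<in> J)"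

text \<open>
  \<open>T(V)/J\<close> is a graded braided Hopf algebra quotient of \<open>T(V)\<close>. The braiding of \<open>T(V)\<close> induces
  a bijection of \<open>T(V)/J \<otimes> T(V)/J\<close> iff it maps \<open>tens_kernel J\<close> onto itself. An antipode of
  \<open>T(V)/J\<close> is expressed by a lift \<open>S\<close> to \<open>T(V)\<close> preserving \<open>J\<close>.
\<close>

definition graded_hopf_ideal ::
    "('i, 'k::field) braiding \<Rightarrow> ('i, 'k) tensor_alg set \<Rightarrow> bool"
  where "graded_hopf_ideal c J \<longleftrightarrow>
    graded_ideal J \<and>
    braid c ` tens_kernel J = tens_kernel J \<and>
    comult c ` J \<subseteq> tens_kernel J \<and>
    (\<forall>p\<in>J. counit p = 0) \<and>
    (\<exists>S. Vector_Spaces.linear scale scale S \<and> S ` J \<subseteq> J \<and>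
      (\<forall>p. mult (tens_map S id (comult c p)) - scale (counit p) unit \<in> J \<and>
           mult (tens_map id S (comult c p)) - scale (counit p) unit \<in> J))"

text \<open>The elements of \<open>T(V)\<close> whose class in \<open>T(V)/J\<close> is primitive.\<close>

definition primitive_mod ::
    "('i, 'k::field) braiding \<Rightarrow> ('i, 'k) tensor_alg set \<Rightarrow> ('i, 'k) tensor_alg set"
  where "primitive_mod c J = {p. comult c p - (tens p unit + tens unit p) \<in> tens_kernel J}"

text \<open>
  \<open>T(V)/J\<close> is connected, its degree-one part is \<open>V\<close> (the condition on the homogeneous parts of
  degrees 0 and 1), and its primitive elements are exactly the elements of degree one.
\<close>

definition is_nichols_ideal ::
    "('i, 'k::field) braiding \<Rightarrow> ('i, 'k) tensor_alg set \<Rightarrow> bool"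
  where "is_nichols_ideal c J \<longleftrightarrow>
    graded_hopf_ideal c J \<and>
    (\<forall>p\<in>J. homog_part 0 p = 0 \<and> homog_part 1 p = 0) \<and>
    primitive_mod c J = {v + p |v p. homog_part 1 v = v \<and> p \<in> J}"

definition nichols_ideal :: "('i, 'k::field) braiding \<Rightarrow> ('i, 'k) tensor_alg set"
  where "nichols_ideal c = (THE J. is_nichols_ideal c J)"

text \<open>\<open>T(V)/J\<close> is spanned by the classes of finitely many elements.\<close>

definition finite_dim_quotient :: "('i, 'k::field) tensor_alg set \<Rightarrow> bool"
  where "finite_dim_quotient J \<longleftrightarrow> (\<exists>B. finite B \<and> fsupp.span (B \<union> J) = UNIV)"

definition finite_dim_nichols_algebra :: "('i, 'k::field) braiding \<Rightarrow> bool"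
  where "finite_dim_nichols_algebra c \<longleftrightarrow> finite_dim_quotient (nichols_ideal c)"

section \<open>The braided vector spaces\<close>

abbreviation x_tens :: "'i \<Rightarrow> 'i \<Rightarrow> ('i \<times> 'i \<Rightarrow>\<^sub>0 'k::field)" (infix "\<otimes>\<^sub>x" 75)
  where "i \<otimes>\<^sub>x j \<equiv> basis_vec (i, j)"

datatype index3 = X1 | X2 | X3

text \<open>\<open>L\<^sub>p(q\<^sub>2\<^sub>2, a)\<close>, with \<open>q\<^sub>1\<^sub>2 = p\<close> and \<open>q\<^sub>2\<^sub>1 = p\<^sup>-\<^sup>1\<close>.\<close>

fun braiding_L :: "'k::field \<Rightarrow> 'k \<Rightarrow> 'k \<Rightarrow> (index3, 'k) braiding"
  where
    "braiding_L p q22 a X3 X1 = scale (inverse p) (X1 \<otimes>\<^sub>x X3)"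
  | "braiding_L p q22 a X3 X2 = scale (inverse p) (X2 \<otimes>\<^sub>x X3 + scale a (X1 \<otimes>\<^sub>x X3))"
  | "braiding_L p q22 a X3 X3 = scale q22 (X3 \<otimes>\<^sub>x X3)"
  | "braiding_L p q22 a i X1 = X1 \<otimes>\<^sub>x i"
  | "braiding_L p q22 a i X2 = X2 \<otimes>\<^sub>x i + X1 \<otimes>\<^sub>x i"
  | "braiding_L p q22 a i X3 = scale p (X3 \<otimes>\<^sub>x i)"

fun braiding_E :: "'k::field \<Rightarrow> 'k \<Rightarrow> (index3, 'k) braiding"
  where
    "braiding_E p q22 X3 X1 = scale (inverse p) (X1 \<otimes>\<^sub>x X3)"
  | "braiding_E p q22 X3 X2 = scale (inverse p) (X2 \<otimes>\<^sub>x X3 + X1 \<otimes>\<^sub>x X3)"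
  | "braiding_E p q22 X3 X3 = scale q22 (X3 \<otimes>\<^sub>x X3)"
  | "braiding_E p q22 i X1 = X1 \<otimes>\<^sub>x i"
  | "braiding_E p q22 i X2 = X2 \<otimes>\<^sub>x i"
  | "braiding_E p q22 i X3 = scale p (X3 \<otimes>\<^sub>x i)"

text \<open>
  The indices \<open>1, \<dots>, t\<close> are the elements of a finite type \<^typ>\<open>'t\<close>; \<open>Whole k\<close> stands for the
  index \<open>k\<close> and \<open>Half k\<close> for \<open>k + 1/2\<close>. The entries of \<open>\<q>\<close> are indexed by \<^typ>\<open>'t option\<close>,
  with \<^term>\<open>None\<close> for \<open>\<theta> = t + 1\<close>.
\<close>

datatype 't indexP = Whole 't | Half 't | Theta

fun integral_part :: "'t indexP \<Rightarrow> 't option"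
  where
    "integral_part (Whole k) = Some k"
  | "integral_part (Half k) = Some k"
  | "integral_part Theta = None"

fun braiding_P ::
    "('t option \<Rightarrow> 't option \<Rightarrow> 'k::field) \<Rightarrow> ('t \<Rightarrow> 'k) \<Rightarrow> ('t indexP, 'k) braiding"
  where
    "braiding_P q a Theta (Half k) =
       scale (q None (Some k)) (Half k \<otimes>\<^sub>x Theta + scale (a k) (Whole k \<otimes>\<^sub>x Theta))"
  | "braiding_P q a Theta j = scale (q None (integral_part j)) (j \<otimes>\<^sub>x Theta)"
  | "braiding_P q a i (Half k) =
       (if integral_part i = Some k then Half k \<otimes>\<^sub>x i + Whole k \<otimes>\<^sub>x i
        else scale (q (integral_part i) (Some k)) (Half k \<otimes>\<^sub>x i))"
  | "braiding_P q a i j =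
       (if integral_part i = integral_part j then j \<otimes>\<^sub>x i
        else scale (q (integral_part i) (integral_part j)) (j \<otimes>\<^sub>x i))"

definition primitive_root_of_unity :: "nat \<Rightarrow> 'k::field \<Rightarrow> bool"
  where "primitive_root_of_unity n z \<longleftrightarrow> 0 < n \<and> z ^ n = 1 \<and> (\<forall>m. 0 < m \<and> m < n \<longrightarrow> z ^ m \<noteq> 1)"

end

theory Submission
  imports Defs
begin

text \<open>
  All braidings in question are of the form \<open>c(x\<^sub>i \<otimes> x\<^sub>j) = g\<^sub>i x\<^sub>j \<otimes> x\<^sub>i\<close> for commuting automorphisms
  \<open>g\<^sub>i\<close>. For such a braiding the components of the comultiplication in \<open>T(V) \<otimes> V\<close> are given by skew
  derivations \<open>D\<^sub>k\<close> of \<open>T(V)\<close>, and the kernel of the Nichols algebra consists of the \<open>p\<close> such that every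
  iterated derivative of \<open>p\<close> has constant term zero. Hence a relation holds in the Nichols algebra as soon
  as its constant term vanishes and all its derivatives are relations.

  In this way one gets a PBW-type spanning set: for every block with basis \<open>x, h\<close> there are the relations
  \<open>x\<^sup>2 = y\<^sup>2 = h\<^sup>4 = 0\<close> with \<open>y = hx - xh\<close>, different blocks q-commute, and the point \<open>u\<close> contributes its
  images under iterated adjoint actions of the letters \<open>h\<close>. The derivatives of these images with respect to
  \<open>u\<close> lie in the finite-dimensional algebra generated by the \<open>x\<close> and \<open>y\<close>, so only finitely many of them
  are nonzero. If \<open>q\<^sub>2\<^sub>2 = 1\<close>, they q-commute and have square zero; for \<open>q\<^sub>2\<^sub>2 = \<omega>\<close> (and one block with
  trivial braiding) there are two of them, which satisfy the relations of a quantum plane of Cartan type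
  \<open>A\<^sub>2\<close> at a cubic root of unity.
\<close>

section \<open>Linear maps between spaces with a basis\<close>

text \<open>Since the Nichols ideal is defined by a description, \<open>J\<close> must be shown to
  satisfy \<open>is_nichols_ideal\<close> and to be the only such ideal. The obstacle is membership
  in \<open>tens_kernel J\<close>. It is removed by writing \<open>J\<close> as the kernel of one
  linear map \<open>Q\<close>: then \<open>tens_kernel J\<close> is the kernel of \<open>Q\<close>
  \<otimes> \<open>Q\<close>, and every condition on it becomes a family of equations between the
  scalars \<open>phi w p\<close>. Invariance under the braiding needs one idea more: T(V) is graded
  by the group generated by the automorphisms, and a nonzero \<open>phi w p\<close> forces
  \<open>w\<close> and \<open>p\<close> to have the same degree.

  Finite dimension asks only for an upper bound, so it suffices to collect relations and adjoin
  nilpotent elements one at a time to an algebra already known to be finite-dimensional modulo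
  \<open>J\<close>. Characteristic 2 enters twice: signs disappear, and a scalar \<open>r\<close>
  with \<open>r * r = 1\<close> must be 1. The latter makes the squares of the images of the point
  vanish when its self-braiding is trivial.\<close>

abbreviation lin :: "(('b \<Rightarrow>\<^sub>0 'k::field) \<Rightarrow> ('d \<Rightarrow>\<^sub>0 'k)) \<Rightarrow> bool"
  where "lin \<equiv> Vector_Spaces.linear scale scale"

lemma lin_iff: "lin f \<longleftrightarrow> (\<forall>p q. f (p + q) = f p + f q) \<and> (\<forall>r p. f (scale r p) = scale r (f p))"
  by (simp add: Vector_Spaces.linear_iff fsupp.vector_space_axioms)

lemma linI: "(\<And>p q. f (p + q) = f p + f q) \<Longrightarrow> (\<And>r p. f (scale r p) = scale r (f p)) \<Longrightarrow> lin f"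
  by (simp add: lin_iff)

lemma lin_add: "lin f \<Longrightarrow> f (p + q) = f p + f q"
  and lin_scale: "lin f \<Longrightarrow> f (scale r p) = scale r (f p)"
  by (simp_all add: lin_iff)

lemma lin_0: "lin f \<Longrightarrow> f 0 = 0"
  using lin_scale[of f 0 0] by simp

lemma lin_minus: "lin f \<Longrightarrow> f (- p) = - f p"
  using lin_scale[of f "-1" p] by simp

lemma lin_diff: "lin f \<Longrightarrow> f (p - q) = f p - f q"
  using lin_add[of f p "- q"] by (simp add: lin_minus)

lemma lin_sum: "lin f \<Longrightarrow> f (sum g A) = (\<Sum>a\<in>A. f (g a))"
  by (induction A rule: infinite_finite_induct) (simp_all add: lin_0[of f] lin_add[of f])

lemma lin_comp: "lin f \<Longrightarrow> lin g \<Longrightarrow> lin (\<lambda>p. f (g p))"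
  by (simp add: lin_iff)

lemma lin_plus: "lin f \<Longrightarrow> lin g \<Longrightarrow> lin (\<lambda>p. f p + g p)"
  by (simp add: lin_iff fsupp.scale_right_distrib add_ac)

lemma lin_minus': "lin f \<Longrightarrow> lin g \<Longrightarrow> lin (\<lambda>p. f p - g p)"
  by (simp add: lin_iff fsupp.scale_right_diff_distrib)

lemma lin_id: "lin (\<lambda>p. p)" "lin id"
  by (simp_all add: lin_iff)

lemma lin_ext_superset:
  "finite A \<Longrightarrow> Poly_Mapping.keys p \<subseteq> A \<Longrightarrow>
    lin_ext f p = (\<Sum>b\<in>A. scale (Poly_Mapping.lookup p b) (f b))"
  unfolding lin_ext_def
  by (rule sum.mono_neutral_left) (auto simp: in_keys_iff)

lemma lin_lin_ext:
  fixes f :: "'b \<Rightarrow> ('d \<Rightarrow>\<^sub>0 'k::field)"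
  shows "lin (lin_ext f)"
proof (rule linI)
  fix p q :: "'b \<Rightarrow>\<^sub>0 'k" and r :: 'k
  let ?A = "Poly_Mapping.keys p \<union> Poly_Mapping.keys q"
  have "lin_ext f (p + q) = (\<Sum>b\<in>?A. scale (Poly_Mapping.lookup (p + q) b) (f b))"
    by (rule lin_ext_superset) (use keys_add[of p q] in auto)
  moreover have "lin_ext f p = (\<Sum>b\<in>?A. scale (Poly_Mapping.lookup p b) (f b))"
    by (rule lin_ext_superset) auto
  moreover have "lin_ext f q = (\<Sum>b\<in>?A. scale (Poly_Mapping.lookup q b) (f b))"
    by (rule lin_ext_superset) auto
  ultimately show "lin_ext f (p + q) = lin_ext f p + lin_ext f q"
    by (simp add: lookup_add fsupp.scale_left_distrib sum.distrib)
  have "lin_ext f (scale r p) =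
      (\<Sum>b\<in>Poly_Mapping.keys p. scale (Poly_Mapping.lookup (scale r p) b) (f b))"
    by (rule lin_ext_superset) (auto simp: in_keys_iff lookup_scale)
  then show "lin_ext f (scale r p) = scale r (lin_ext f p)"
    by (simp add: lin_ext_def lookup_scale fsupp.scale_sum_right)
qed

lemma lin_ext_basis [simp]: "lin_ext f (basis_vec b) = f b"
  by (simp add: lin_ext_def)

lemma lin_ext_basis_vec: "lin_ext basis_vec p = p"
proof (rule poly_mapping_eqI)
  fix b
  have "Poly_Mapping.lookup (lin_ext basis_vec p) b
      = (\<Sum>a\<in>Poly_Mapping.keys p. Poly_Mapping.lookup p a * (1 when a = b))"
    by (simp add: lin_ext_def lookup_sum lookup_scale lookup_single)
  also have "\<dots> = (\<Sum>a\<in>Poly_Mapping.keys p. if a = b then Poly_Mapping.lookup p a else 0)"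
    by (rule sum.cong) (auto simp: when_def)
  also have "\<dots> = Poly_Mapping.lookup p b"
    by (auto simp: in_keys_iff)
  finally show "Poly_Mapping.lookup (lin_ext basis_vec p) b = Poly_Mapping.lookup p b" .
qed

lemma basis_span: "fsupp.span (range (basis_vec :: 'b \<Rightarrow> _)) = (UNIV :: ('b \<Rightarrow>\<^sub>0 'k::field) set)"
proof -
  have "p \<in> fsupp.span (range basis_vec)" for p :: "'b \<Rightarrow>\<^sub>0 'k"
    using lin_ext_basis_vec[of p] unfolding lin_ext_def
    by (metis (no_types, lifting) fsupp.span_base fsupp.span_scale fsupp.span_sum rangeI)
  then show ?thesis by blast
qed

lemma basis_induct [case_names add scale basis]:
  assumes "\<And>p q. P p \<Longrightarrow> P q \<Longrightarrow> P (p + q)" "\<And>r p. P p \<Longrightarrow> P (scale r p)"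
    and "\<And>b. P (basis_vec b)"
  shows "P (p :: 'b \<Rightarrow>\<^sub>0 'k::field)"
proof -
  have "P 0" using assms(2)[of "basis_vec undefined" 0] assms(3) by simp
  then have "fsupp.subspace (Collect P)" using assms by (simp add: fsupp.subspace_def)
  moreover have "p \<in> fsupp.span (range basis_vec)" by (simp add: basis_span)
  ultimately show ?thesis using assms(3) by (auto intro: fsupp.span_induct)
qed

lemma lin_eqI:
  assumes "lin f" "lin g" "\<And>b. f (basis_vec b) = g (basis_vec b)"
  shows "f p = g p"
  by (induction p rule: basis_induct)
    (simp_all add: assms lin_add[OF assms(1)] lin_scale[OF assms(1)] lin_add[OF assms(2)] lin_scale[OF assms(2)])

lemma lin_lookup_eqI:
  assumes "lin f" "\<And>b. Poly_Mapping.lookup (f (basis_vec b)) w = G (basis_vec b)"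
    and "\<And>p q. G (p + q) = G p + G q" "\<And>r p. G (scale r p) = r * (G p :: 'k::field)"
  shows "Poly_Mapping.lookup (f p) w = G p"
  by (induction p rule: basis_induct) (simp_all add: assms lin_add[OF assms(1)] lin_scale[OF assms(1)] lookup_add lookup_scale)

lemma lin_compose_ext: "lin f \<Longrightarrow> f (lin_ext g p) = lin_ext (\<lambda>b. f (g b)) p"
  by (rule lin_eqI[of "\<lambda>p. f (lin_ext g p)"]) (simp_all add: lin_comp[OF _ lin_lin_ext] lin_lin_ext)

subsection \<open>Tensor products\<close>

lemma lookup_tens:
  "Poly_Mapping.lookup (tens p q) (b, d) = Poly_Mapping.lookup p b * Poly_Mapping.lookup q d"
proof -
  have 1: "Poly_Mapping.lookup (lin_ext (\<lambda>d. basis_vec (b', d)) q) (b, d)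
      = (if b' = b then Poly_Mapping.lookup q d else 0)" for b'
    by (rule lin_lookup_eqI)
      (auto simp: lin_lin_ext lookup_single when_def lookup_add lookup_scale)
  show ?thesis unfolding tens_def
    by (rule lin_lookup_eqI)
      (auto simp: 1 lin_lin_ext lookup_single when_def lookup_add lookup_scale algebra_simps)
qed

lemma tens_basis: "tens (basis_vec b) (basis_vec d) = basis_vec (b, d)"
  by (simp add: tens_def)

lemma tens_add: "tens (p + p') q = tens p q + tens p' q" "tens p (q + q') = tens p q + tens p q'"
  and tens_diff: "tens (p - p') q = tens p q - tens p' q" "tens p (q - q') = tens p q - tens p q'"
  and tens_scale: "tens (scale r p) q = scale r (tens p q)" "tens p (scale r q) = scale r (tens p q)"
  and tens_0: "tens 0 q = 0" "tens p 0 = 0"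
  by (rule poly_mapping_eqI; case_tac k;
      simp add: lookup_tens lookup_add lookup_minus lookup_scale algebra_simps)+

lemma lin_tens1: "lin (\<lambda>p. tens p q)" and lin_tens2: "lin (\<lambda>q. tens p q)"
  by (auto intro!: linI simp: tens_add tens_scale)

lemma lin_tens1': "lin f \<Longrightarrow> lin (\<lambda>x. tens (f x) q)" and lin_tens2': "lin f \<Longrightarrow> lin (\<lambda>x. tens p (f x))"
  by (simp_all add: lin_iff tens_add tens_scale)

lemma tens_induct [case_names add scale tens]:
  assumes "\<And>p q. P p \<Longrightarrow> P q \<Longrightarrow> P (p + q)" "\<And>r p. P p \<Longrightarrow> P (scale r p)"
    and "\<And>b d. P (tens (basis_vec b) (basis_vec d))"
  shows "P (p :: 'b \<times> 'd \<Rightarrow>\<^sub>0 'k::field)"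
  by (induction p rule: basis_induct) (use assms in \<open>auto simp: tens_basis\<close>)

lemma lin_tens_eqI:
  assumes "lin f" "lin g"
    "\<And>b d. f (tens (basis_vec b) (basis_vec d)) = g (tens (basis_vec b) (basis_vec d))"
  shows "f p = g p"
  by (induction p rule: tens_induct)
    (simp_all add: assms lin_add[OF assms(1)] lin_scale[OF assms(1)] lin_add[OF assms(2)] lin_scale[OF assms(2)])

lemma lin_tens_map: "lin (tens_map f g)"
  unfolding tens_map_def by (rule lin_lin_ext)

lemma bilin_eqI:
  assumes "\<And>q. lin (\<lambda>p. F p q)" "\<And>p. lin (\<lambda>q. F p q)" "\<And>q. lin (\<lambda>p. G p q)" "\<And>p. lin (\<lambda>q. G p q)"
    "\<And>b d. F (basis_vec b) (basis_vec d) = G (basis_vec b) (basis_vec d)"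
  shows "F p q = G p q"
proof -
  have "F (basis_vec b) q = G (basis_vec b) q" for b
    by (rule lin_eqI[OF assms(2,4,5)])
  then show ?thesis by (rule lin_eqI[OF assms(1,3)])
qed

lemma tens_map_tens:
  assumes "lin f" "lin g"
  shows "tens_map f g (tens p q) = tens (f p) (g q)"
proof -
  have "tens_map f g (basis_vec (b, d)) = tens (f (basis_vec b)) (g (basis_vec d))" for b d
    by (simp add: tens_map_def)
  note base = this
  show ?thesis
    by (rule bilin_eqI[of "\<lambda>p q. tens_map f g (tens p q)" "\<lambda>p q. tens (f p) (g q)"])
      (simp_all add: tens_basis base lin_comp[OF lin_tens_map] lin_tens1 lin_tens2
        lin_tens1'[OF assms(1)] lin_tens2'[OF assms(2)])
qed

lemma tens_map_comp:
  assumes "lin f" "lin g" "lin f'" "lin g'"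
  shows "tens_map f g (tens_map f' g' X) = tens_map (\<lambda>x. f (f' x)) (\<lambda>x. g (g' x)) X"
  by (rule lin_tens_eqI[of "\<lambda>X. tens_map f g (tens_map f' g' X)"])
     (simp_all add: lin_comp[OF lin_tens_map] lin_tens_map tens_map_tens assms
       lin_comp[OF assms(1,3)] lin_comp[OF assms(2,4)])

lemma lin_ext_tens1: "lin_ext F (tens p (basis_vec d)) = lin_ext (\<lambda>b. F (b, d)) p"
  by (rule lin_eqI[where f="\<lambda>p. lin_ext F (tens p (basis_vec d))"])
     (simp_all add: lin_comp[OF lin_lin_ext] lin_tens1 lin_lin_ext tens_basis)

lemma tens_kernel_subspace: "fsupp.subspace (tens_kernel J)"
  by (simp add: tens_kernel_def)

lemma tens_kernel_left: "p \<in> J \<Longrightarrow> tens p q \<in> tens_kernel J"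
  and tens_kernel_right: "q \<in> J \<Longrightarrow> tens p q \<in> tens_kernel J"
  unfolding tens_kernel_def by (auto intro!: fsupp.span_base)

lemma tens_kernel_lin_image:
  assumes "lin F" "fsupp.subspace W" "X \<in> tens_kernel J"
    and "\<And>p q. p \<in> J \<Longrightarrow> F (tens p q) \<in> W" "\<And>p q. q \<in> J \<Longrightarrow> F (tens p q) \<in> W"
  shows "F X \<in> W"
  using assms(3) unfolding tens_kernel_def
proof (induction rule: fsupp.span_induct)
  case base
  show ?case using assms(2)
    by (simp add: fsupp.subspace_def lin_0[OF assms(1)] lin_add[OF assms(1)] lin_scale[OF assms(1)])
next
  case (step X)
  then show ?case using assms(4,5) by auto
qed

lemma tens_kernel_map:
  assumes "lin f" "\<And>p. p \<in> K \<Longrightarrow> f p \<in> J" "X \<in> tens_kernel K"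
  shows "tens_map f f X \<in> tens_kernel J"
  by (rule tens_kernel_lin_image[OF lin_tens_map tens_kernel_subspace assms(3)])
     (auto simp: tens_map_tens assms tens_kernel_left tens_kernel_right)

text \<open>A linear right inverse of \<open>f\<close> on its image, extended to the whole space.
  The composite g f is then a projection with the same kernel as \<open>f\<close>.\<close>

lemma lin_generalized_inverse:
  assumes "lin f"
  obtains g where "lin g" "\<And>p. f (g (f p)) = f p"
proof -
  have "vector_space_pair scale scale"
    by (simp add: vector_space_pair_def fsupp.vector_space_axioms)
  from vector_space_pair.linear_exists_right_inverse_on[OF this assms fsupp.subspace_UNIV]
  show thesis using that by blast
qed

text \<open>For the projection P = g f, the identity of the tensor square is (1 - P) \<otimes> 1 + P
  \<otimes> (1 - P) + P \<otimes> P. The first two summands take values in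
  \<open>tens_kernel\<close>, while P \<otimes> P factors through f \<otimes> f.\<close>

lemma tens_kernel_ker:
  assumes f: "lin f"
  shows "tens_kernel {p. f p = 0} = {X. tens_map f f X = 0}"
proof (intro equalityI subsetI CollectI)
  fix X
  assume X: "X \<in> tens_kernel {p. f p = 0}"
  have "tens_map f f X \<in> {0}"
    by (rule tens_kernel_lin_image[OF lin_tens_map _ X]) (simp_all add: tens_map_tens f tens_0)
  then show "tens_map f f X = 0" by simp
next
  fix X
  assume "X \<in> {X. tens_map f f X = 0}"
  then have X: "tens_map f f X = 0" by simp
  obtain g where g: "lin g" "\<And>p. f (g (f p)) = f p"
    using lin_generalized_inverse[OF f] by blast
  define P where "P = (\<lambda>p. g (f p))"
  have lP: "lin P" unfolding P_def by (rule lin_comp[OF g(1) f])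
  then have lI: "lin (\<lambda>p. p - P p)" by (rule lin_minus'[OF lin_id(1)])
  have fP: "f (p - P p) = 0" for p by (simp add: P_def lin_diff[OF f] g)
  have "tens_map P P X = tens_map g g (tens_map f f X)"
    unfolding P_def by (rule tens_map_comp[OF g(1) g(1) f f, symmetric])
  then have PP: "tens_map P P X = 0" by (simp add: X lin_0[OF lin_tens_map])
  have decomp: "tens_map (\<lambda>p. p - P p) (\<lambda>p. p) X + tens_map P (\<lambda>p. p - P p) X + tens_map P P X = X"
    by (rule lin_tens_eqI[where g="\<lambda>X. X" and f="\<lambda>X. tens_map (\<lambda>p. p - P p) (\<lambda>p. p) X + tens_map P (\<lambda>p. p - P p) X + tens_map P P X"])
       (simp_all add: lin_plus lin_tens_map lin_id tens_map_tens lI lP tens_diff)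
  have mem: "tens_map (\<lambda>p. p - P p) (\<lambda>p. p) Y \<in> tens_kernel {p. f p = 0}"
      "tens_map P (\<lambda>p. p - P p) Y \<in> tens_kernel {p. f p = 0}" for Y
    by (induction Y rule: tens_induct)
       (simp_all add: lin_add[OF lin_tens_map] lin_scale[OF lin_tens_map] tens_map_tens lI lP lin_id fP
         fsupp.subspace_add fsupp.subspace_scale tens_kernel_subspace tens_kernel_left tens_kernel_right)
  show "X \<in> tens_kernel {p. f p = 0}"
    using fsupp.subspace_add[OF tens_kernel_subspace mem(1)[of X] mem(2)[of X]] decomp PP
    by simp
qed

section \<open>The tensor algebra as a ring\<close>

text \<open>With words as a monoid, the convolution product of \<^typ>\<open>'i list \<Rightarrow>\<^sub>0 'k\<close> is that of the tensor algebra.\<close>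

instantiation list :: (type) monoid_add
begin
definition zero_list_def: "0 = []"
definition plus_list_def: "xs + ys = xs @ ys"
instance by standard (simp_all add: zero_list_def plus_list_def)
end

abbreviation gen :: "'i \<Rightarrow> ('i, 'k::field) tensor_alg"
  where "gen i \<equiv> basis_vec [i]"

lemma basis_vec_mult: "basis_vec u * basis_vec v = (basis_vec (u @ v) :: ('i, 'k::field) tensor_alg)"
  by (simp add: mult_single plus_list_def)

lemma one_tensor_alg: "(1 :: ('i, 'k::field) tensor_alg) = basis_vec []"
  by (metis single_one zero_list_def)

lemma scale_mult_left: "scale r p * q = scale r (p * q :: ('i, 'k::field) tensor_alg)"
  by (simp add: scale_def mult_map_scale_conv_mult mult.assoc)

lemma scale_mult_right: "p * scale r q = scale r (p * q :: ('i, 'k::field) tensor_alg)"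
proof -
  have "basis_vec u * (Poly_Mapping.single 0 r * q) = Poly_Mapping.single 0 r * (basis_vec u * q)" for u
    by (simp add: mult.assoc[symmetric] mult_single)
  then have "basis_vec u * scale r q = scale r (basis_vec u * q)" for u
    by (simp add: scale_def mult_map_scale_conv_mult)
  then show ?thesis
    by (induction p rule: basis_induct)
       (simp_all add: scale_mult_left distrib_right fsupp.scale_right_distrib mult.commute)
qed

lemmas scale_mult = scale_mult_left scale_mult_right

lemma lin_mult1: "lin (\<lambda>p. p * q :: ('i, 'k::field) tensor_alg)"
  and lin_mult2: "lin (\<lambda>q. p * q :: ('i, 'k::field) tensor_alg)"
  by (simp_all add: lin_iff scale_mult distrib_left distrib_right)

lemma mult_tens: "mult (tens p q) = p * q"
proof (rule bilin_eqI[where F="\<lambda>p q. mult (tens p q)" and G="\<lambda>p q. p * q"])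
  show "lin (\<lambda>p. mult (tens p q))" "lin (\<lambda>q. mult (tens p q))"
    for p q :: "('a, 'b) tensor_alg"
    by (simp_all add: mult_def lin_iff tens_add tens_scale lin_add[OF lin_lin_ext] lin_scale[OF lin_lin_ext])
qed (simp_all add: lin_mult1 lin_mult2 tens_basis mult_def basis_vec_mult)

lemma lin_mult: "lin mult"
  unfolding mult_def by (rule lin_lin_ext)

lemma unit_eq_1: "unit = 1"
  by (simp add: unit_def one_tensor_alg)

lemma tensor_alg_induct [case_names add scale one gen]:
  assumes "\<And>p q. P p \<Longrightarrow> P q \<Longrightarrow> P (p + q)" "\<And>r p. P p \<Longrightarrow> P (scale r p)"
    and "P 1" "\<And>i p. P p \<Longrightarrow> P (gen i * p)"
  shows "P (p :: ('i, 'k::field) tensor_alg)"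
proof (induction p rule: basis_induct)
  case (basis w)
  show ?case
  proof (induction w)
    case Nil
    show ?case using assms(3) by (simp add: one_tensor_alg)
  next
    case (Cons i w)
    from assms(4)[OF this, of i] show ?case by (simp add: basis_vec_mult)
  qed
qed (fact assms)+

lemma counit_simps [simp]:
  "counit (p + q) = counit p + counit q" "counit (p - q) = counit p - counit q"
  "counit (scale r p) = r * counit p" "counit 0 = 0" "counit (- p) = - counit p"
  by (simp_all add: counit_def lookup_add lookup_minus lookup_scale)

lemma counit_1 [simp]: "counit 1 = 1"
  by (simp add: counit_def one_tensor_alg)

lemma lookup_gen_mult:
  "Poly_Mapping.lookup (gen i * p :: ('i, 'k::field) tensor_alg) w =
    (case w of [] \<Rightarrow> 0 | j # v \<Rightarrow> if j = i then Poly_Mapping.lookup p v else 0)"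
  by (induction p rule: basis_induct)
     (auto simp: distrib_left scale_mult lookup_add lookup_scale basis_vec_mult lookup_single when_def
       split: list.splits)

lemma counit_gen [simp]: "counit (gen i) = 0"
  by (simp add: counit_def lookup_single)

lemma counit_gen_mult: "counit (gen i * p :: ('i, 'k::field) tensor_alg) = 0"
  by (simp add: counit_def lookup_gen_mult)

lemma counit_mult [simp]: "counit (p * q) = counit p * counit (q :: ('i, 'k::field) tensor_alg)"
  by (induction p rule: tensor_alg_induct)
     (simp_all add: distrib_right scale_mult mult.assoc counit_gen_mult)

definition filt :: "('b \<Rightarrow> bool) \<Rightarrow> ('b \<Rightarrow>\<^sub>0 'k::field) \<Rightarrow> ('b \<Rightarrow>\<^sub>0 'k)"
  where "filt P = lin_ext (\<lambda>w. if P w then basis_vec w else 0)"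

lemma lin_filt: "lin (filt P)"
  unfolding filt_def by (rule lin_lin_ext)

lemma lookup_filt: "Poly_Mapping.lookup (filt P p) w = (if P w then Poly_Mapping.lookup p w else 0)"
  unfolding filt_def
  by (rule lin_lookup_eqI) (auto simp: lin_lin_ext lookup_single when_def lookup_add lookup_scale)

lemma lookup_tens_map_filt:
  "Poly_Mapping.lookup (tens_map (filt P) (filt P') X) (u, v) =
     (if P u \<and> P' v then Poly_Mapping.lookup X (u, v) else 0)"
  by (induction X rule: tens_induct)
     (simp_all add: lin_add[OF lin_tens_map] lin_scale[OF lin_tens_map] lookup_add lookup_scale
       tens_map_tens lin_filt lookup_tens lookup_filt)

lemma homog_part_filt: "homog_part n = filt (\<lambda>w. length w = n)"
  by (simp add: homog_part_def filt_def)

lemma lin_homog_part: "lin (homog_part n)"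
  by (simp add: homog_part_filt lin_filt)

lemma lookup_homog_part:
  "Poly_Mapping.lookup (homog_part n p) w = (if length w = n then Poly_Mapping.lookup p w else 0)"
  by (simp add: homog_part_filt lookup_filt)

lemmas homog_part_simps = lin_add[OF lin_homog_part] lin_scale[OF lin_homog_part] lin_0[OF lin_homog_part]
  lin_diff[OF lin_homog_part] lin_minus[OF lin_homog_part]

lemma homog_part_1: "homog_part n (1 :: ('i, 'k::field) tensor_alg) = (if n = 0 then 1 else 0)"
  by (rule poly_mapping_eqI) (auto simp: lookup_homog_part one_tensor_alg lookup_single when_def)

lemma homog_part_gen_mult:
  "homog_part (Suc n) (gen i * p) = gen i * homog_part n (p :: ('i, 'k::field) tensor_alg)"
  "homog_part 0 (gen i * p :: ('i, 'k::field) tensor_alg) = 0"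
  by (rule poly_mapping_eqI; auto simp: lookup_homog_part lookup_gen_mult split: list.splits)+

lemma homog_part_homog_part:
  "homog_part m (homog_part n p) = (if m = n then homog_part n p else 0)"
  by (rule poly_mapping_eqI) (auto simp: lookup_homog_part)

lemma filt_eq_sum_homog_part:
  "filt (\<lambda>w. P (length w)) p = (\<Sum>n | n \<in> length ` Poly_Mapping.keys p \<and> P n. homog_part n p)"
proof (rule poly_mapping_eqI)
  fix w
  have "(\<Sum>n | n \<in> length ` Poly_Mapping.keys p \<and> P n. if length w = n then Poly_Mapping.lookup p w else 0)
      = (if length w \<in> length ` Poly_Mapping.keys p \<and> P (length w) then Poly_Mapping.lookup p w else 0)"
    by (subst sum.delta') auto
  moreover have "Poly_Mapping.lookup p w = 0" if "length w \<notin> length ` Poly_Mapping.keys p"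
    using that by (auto simp: in_keys_iff)
  ultimately show "Poly_Mapping.lookup (filt (\<lambda>w. P (length w)) p) w =
      Poly_Mapping.lookup (\<Sum>n | n \<in> length ` Poly_Mapping.keys p \<and> P n. homog_part n p) w"
    by (auto simp: lookup_filt lookup_sum lookup_homog_part)
qed

lemma eq_sum_homog_part: "p = (\<Sum>n\<in>length ` Poly_Mapping.keys p. homog_part n p)"
proof -
  have "filt (\<lambda>w. True) p = p" by (rule poly_mapping_eqI) (simp add: lookup_filt)
  then show ?thesis using filt_eq_sum_homog_part[of "\<lambda>_. True" p] by simp
qed

section \<open>Graded automorphisms\<close>

definition emb :: "('i \<Rightarrow>\<^sub>0 'k::field) \<Rightarrow> ('i, 'k) tensor_alg"
  where "emb = lin_ext gen"

lemma lin_emb: "lin emb"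
  unfolding emb_def by (rule lin_lin_ext)

lemma emb_basis [simp]: "emb (basis_vec i) = gen i"
  by (simp add: emb_def)

lemmas emb_simps = lin_add[OF lin_emb] lin_scale[OF lin_emb]

lemma emb_eq_sum: "emb (v :: 'i::finite \<Rightarrow>\<^sub>0 'k::field) = (\<Sum>m\<in>UNIV. scale (Poly_Mapping.lookup v m) (gen m))"
  unfolding emb_def by (rule lin_ext_superset) auto

definition act :: "('i \<Rightarrow> ('i \<Rightarrow>\<^sub>0 'k::field)) \<Rightarrow> ('i, 'k) tensor_alg \<Rightarrow> ('i, 'k) tensor_alg"
  where "act H = lin_ext (\<lambda>w. prod_list (map (\<lambda>j. emb (H j)) w))"

lemma lin_act: "lin (act H)"
  unfolding act_def by (rule lin_lin_ext)

lemmas act_simps = lin_add[OF lin_act] lin_scale[OF lin_act] lin_0[OF lin_act]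
  lin_diff[OF lin_act] lin_minus[OF lin_act]

lemma act_1 [simp]: "act H 1 = 1"
  by (simp add: act_def one_tensor_alg)

lemma act_gen_mult: "act H (gen i * p) = emb (H i) * act H p"
  by (induction p rule: basis_induct)
     (simp_all add: distrib_left scale_mult basis_vec_mult act_def
       lin_add[OF lin_lin_ext] lin_scale[OF lin_lin_ext])

lemma act_gen [simp]: "act H (gen i) = emb (H i)"
  using act_gen_mult[of H i 1] by simp

lemma act_emb: "act H (emb v) = emb (lin_ext H v)"
  by (induction v rule: basis_induct)
     (simp_all add: act_simps emb_simps lin_add[OF lin_lin_ext] lin_scale[OF lin_lin_ext])

lemma act_mult: "act H (p * q) = act H p * act H q"
  by (induction p rule: tensor_alg_induct)
     (simp_all add: act_simps distrib_right scale_mult mult.assoc act_gen_mult)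

lemma counit_emb [simp]: "counit (emb v) = 0"
  by (induction v rule: basis_induct) (simp_all add: emb_simps counit_def lookup_add lookup_scale lookup_single)

lemma counit_act [simp]: "counit (act H p) = counit p"
  by (induction p rule: tensor_alg_induct) (simp_all add: act_simps act_gen_mult)

lemma homog_part_emb_mult:
  "homog_part (Suc n) (emb v * p) = emb v * homog_part n p" "homog_part 0 (emb v * p) = 0"
  by (induction v rule: basis_induct)
     (simp_all add: emb_simps distrib_right scale_mult homog_part_simps homog_part_gen_mult)

lemma homog_part_act: "homog_part n (act H p) = act H (homog_part n p)"
proof (induction p arbitrary: n rule: tensor_alg_induct)
  case (gen i p)
  then show ?case
    by (cases n) (simp_all add: act_gen_mult homog_part_emb_mult homog_part_gen_mult act_simps)
qed (simp_all add: homog_part_simps act_simps homog_part_1)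

section \<open>Contractions\<close>

text \<open>The map id \<otimes> f, with f \<otimes> id as its mirror image below. The scalars are
  not a space of finitely supported functions here, so linear forms are described by
  \<open>functional\<close> rather than by \<open>lin\<close>.\<close>

definition rcontract :: "(('d \<Rightarrow>\<^sub>0 'k) \<Rightarrow> 'k::field) \<Rightarrow> ('b \<times> 'd \<Rightarrow>\<^sub>0 'k) \<Rightarrow> ('b \<Rightarrow>\<^sub>0 'k)"
  where "rcontract f = lin_ext (\<lambda>(a, b). scale (f (basis_vec b)) (basis_vec a))"

definition lcontract :: "(('b \<Rightarrow>\<^sub>0 'k) \<Rightarrow> 'k::field) \<Rightarrow> ('b \<times> 'd \<Rightarrow>\<^sub>0 'k) \<Rightarrow> ('d \<Rightarrow>\<^sub>0 'k)"
  where "lcontract f = lin_ext (\<lambda>(a, b). scale (f (basis_vec a)) (basis_vec b))"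

definition functional :: "(('d \<Rightarrow>\<^sub>0 'k) \<Rightarrow> 'k::field) \<Rightarrow> bool"
  where "functional f \<longleftrightarrow> (\<forall>p q. f (p + q) = f p + f q) \<and> (\<forall>r p. f (scale r p) = r * f p)"

lemma lin_rcontract: "lin (rcontract f)" and lin_lcontract: "lin (lcontract f)"
  unfolding rcontract_def lcontract_def by (rule lin_lin_ext)+

lemma rcontract_tens:
  assumes "functional f"
  shows "rcontract f (tens p q) = scale (f q) p"
  by (rule bilin_eqI[of "\<lambda>p q. rcontract f (tens p q)" "\<lambda>p q. scale (f q) p"])
     (use assms in \<open>simp_all add: lin_iff tens_add tens_scale lin_add[OF lin_rcontract] lin_scale[OF lin_rcontract]
        functional_def fsupp.scale_left_distrib fsupp.scale_right_distrib mult.commute\<close>,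
      simp add: rcontract_def tens_basis)

lemma lcontract_tens:
  assumes "functional f"
  shows "lcontract f (tens p q) = scale (f p) q"
  by (rule bilin_eqI[of "\<lambda>p q. lcontract f (tens p q)" "\<lambda>p q. scale (f p) q"])
     (use assms in \<open>simp_all add: lin_iff tens_add tens_scale lin_add[OF lin_lcontract] lin_scale[OF lin_lcontract]
        functional_def fsupp.scale_left_distrib fsupp.scale_right_distrib mult.commute\<close>,
      simp add: lcontract_def tens_basis)

lemma rcontract_tens_map:
  assumes "functional f" "lin g" "lin h" "functional (\<lambda>q. f (h q))"
  shows "rcontract f (tens_map g h X) = g (rcontract (\<lambda>q. f (h q)) X)"
  by (induction X rule: tens_induct)
     (simp_all add: lin_add[OF lin_tens_map] lin_scale[OF lin_tens_map] lin_add[OF lin_rcontract] lin_scale[OF lin_rcontract]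
       lin_add[OF assms(2)] lin_scale[OF assms(2)] tens_map_tens assms rcontract_tens)

lemma lcontract_tens_map:
  assumes "functional f" "lin g" "lin h" "functional (\<lambda>q. f (g q))"
  shows "lcontract f (tens_map g h X) = h (lcontract (\<lambda>q. f (g q)) X)"
  by (induction X rule: tens_induct)
     (simp_all add: lin_add[OF lin_tens_map] lin_scale[OF lin_tens_map] lin_add[OF lin_lcontract] lin_scale[OF lin_lcontract]
       lin_add[OF assms(3)] lin_scale[OF assms(3)] tens_map_tens assms lcontract_tens)

lemma functional_lookup: "functional (\<lambda>q. Poly_Mapping.lookup q w)"
  by (simp add: functional_def lookup_add lookup_scale)

lemma functional_counit: "functional counit"
  by (simp add: functional_def)

lemma lookup_rcontract: "Poly_Mapping.lookup (rcontract (\<lambda>q. Poly_Mapping.lookup q v) X) u = Poly_Mapping.lookup X (u, v)"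
  by (induction X rule: tens_induct)
     (simp_all add: lin_add[OF lin_rcontract] lin_scale[OF lin_rcontract] lookup_add lookup_scale rcontract_tens
       functional_lookup lookup_tens)

lemma lookup_lcontract: "Poly_Mapping.lookup (lcontract (\<lambda>q. Poly_Mapping.lookup q u) X) v = Poly_Mapping.lookup X (u, v)"
  by (induction X rule: tens_induct)
     (simp_all add: lin_add[OF lin_lcontract] lin_scale[OF lin_lcontract] lookup_add lookup_scale lcontract_tens
       functional_lookup lookup_tens)

lemma tens_map_basis: "tens_map f g (basis_vec (b, d)) = tens (f (basis_vec b)) (g (basis_vec d))"
  by (simp add: tens_map_def)

lemma sum_scale_scale:
  "(\<Sum>m\<in>A. scale (r * f m) (g m)) = scale r (\<Sum>m\<in>A. scale (f m) (g m))"
  "(\<Sum>m\<in>A. scale (f m * r) (g m)) = scale r (\<Sum>m\<in>A. scale (f m) (g m))"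
  by (simp_all add: fsupp.scale_sum_right mult.commute)

section \<open>Braidings given by commuting automorphisms\<close>

text \<open>V is a Yetter-Drinfeld module over the abelian group generated by the
  \<open>G i\<close>, with the letter j in degree \<open>G j\<close>. The assumption
  \<open>graded\<close> says that the action preserves degrees; \<open>invertible\<close> asks the
  same of the inverses.\<close>

locale yd_braiding =
  fixes c :: "('i::finite, 'k::field) braiding" and G :: "'i \<Rightarrow> 'i \<Rightarrow> ('i \<Rightarrow>\<^sub>0 'k)"
  assumes braiding: "c i j = tens (G i j) (basis_vec i)"
    and graded: "Poly_Mapping.lookup (G i j) m \<noteq> 0 \<Longrightarrow> G m = G j"
    and commute: "lin_ext (G i) (G j m) = lin_ext (G j) (G i m)"
    and invertible: "\<exists>H. \<forall>j. (\<forall>m. Poly_Mapping.lookup (H j) m \<noteq> 0 \<longrightarrow> G m = G j) \<and>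
      lin_ext (G i) (H j) = basis_vec j \<and> lin_ext H (G i j) = basis_vec j"
begin

text \<open>The endomorphisms of V as a Yetter-Drinfeld module. Working with all of them gives each
  later statement for \<open>G i\<close> and for its inverse at once.\<close>

definition admissible :: "('i \<Rightarrow> ('i \<Rightarrow>\<^sub>0 'k)) \<Rightarrow> bool"
  where "admissible H \<longleftrightarrow> (\<forall>j m. Poly_Mapping.lookup (H j) m \<noteq> 0 \<longrightarrow> G m = G j) \<and>
    (\<forall>i j. lin_ext (G i) (H j) = lin_ext H (G i j))"

lemma admissibleD: "admissible H \<Longrightarrow> Poly_Mapping.lookup (H j) m \<noteq> 0 \<Longrightarrow> G m = G j"
    "admissible H \<Longrightarrow> lin_ext (G i) (H j) = lin_ext H (G i j)"
  unfolding admissible_def by blast+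

lemma admissible_G: "admissible (G i)"
  using graded commute unfolding admissible_def by blast

definition Ginv :: "'i \<Rightarrow> 'i \<Rightarrow> ('i \<Rightarrow>\<^sub>0 'k)" where
  "Ginv i = (SOME H. \<forall>j. (\<forall>m. Poly_Mapping.lookup (H j) m \<noteq> 0 \<longrightarrow> G m = G j) \<and>
      lin_ext (G i) (H j) = basis_vec j \<and> lin_ext H (G i j) = basis_vec j)"

lemma Ginv:
  "Poly_Mapping.lookup (Ginv i j) m \<noteq> 0 \<Longrightarrow> G m = G j"
  "lin_ext (G i) (Ginv i j) = basis_vec j" "lin_ext (Ginv i) (G i j) = basis_vec j"
  using someI_ex[OF invertible[of i], folded Ginv_def] by blast+

lemma lin_ext_Ginv: "lin_ext (Ginv i) (lin_ext (G i) v) = v" "lin_ext (G i) (lin_ext (Ginv i) v) = v"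
  by (induction v rule: basis_induct)
     (simp_all add: lin_add[OF lin_lin_ext] lin_scale[OF lin_lin_ext] Ginv)

lemma lin_ext_commute: "lin_ext (G i) (lin_ext (G j) v) = lin_ext (G j) (lin_ext (G i) v)"
  by (induction v rule: basis_induct)
     (simp_all add: lin_add[OF lin_lin_ext] lin_scale[OF lin_lin_ext] commute)

lemma admissible_Ginv: "admissible (Ginv i)"
proof -
  have "lin_ext (G l) (Ginv i j) = lin_ext (Ginv i) (G l j)" for l j
  proof -
    have "lin_ext (G l) (Ginv i j) = lin_ext (Ginv i) (lin_ext (G l) (lin_ext (G i) (Ginv i j)))"
      by (metis lin_ext_Ginv(1) lin_ext_commute)
    then show ?thesis by (simp add: Ginv)
  qed
  then show ?thesis using Ginv(1) unfolding admissible_def by blast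
qed

lemma act_commute:
  assumes "admissible H"
  shows "act (G i) (act H p) = act H (act (G i) p)"
  by (induction p rule: tensor_alg_induct)
     (simp_all add: act_simps act_gen_mult act_mult act_emb admissibleD(2)[OF assms])

lemma act_Ginv: "act (Ginv i) (act (G i) p) = p" "act (G i) (act (Ginv i) p) = p"
  by (induction p rule: tensor_alg_induct)
     (simp_all add: act_simps act_gen_mult act_mult act_emb Ginv)

section \<open>Skew derivations\<close>

text \<open>The recursion is read off from the comultiplication: in the braided product, 1 \<otimes>
  x_i times w \<otimes> 1 is g_i(w) \<otimes> x_i, which is the only new contribution to the
  component ending in x_i.\<close>

fun dword :: "'i \<Rightarrow> 'i list \<Rightarrow> ('i, 'k) tensor_alg" where
  "dword k [] = 0"
| "dword k (i # w) = gen i * dword k w + (if i = k then act (G k) (basis_vec w) else 0)"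

definition D :: "'i \<Rightarrow> ('i, 'k) tensor_alg \<Rightarrow> ('i, 'k) tensor_alg"
  where "D k = lin_ext (dword k)"

lemma lin_D: "lin (D k)"
  unfolding D_def by (rule lin_lin_ext)

lemmas D_simps = lin_add[OF lin_D] lin_scale[OF lin_D] lin_0[OF lin_D] lin_diff[OF lin_D] lin_minus[OF lin_D]

lemma D_1 [simp]: "D k 1 = 0"
  by (simp add: D_def one_tensor_alg)

lemma D_gen_mult: "D k (gen i * p) = gen i * D k p + (if i = k then act (G k) p else 0)"
  by (induction p rule: basis_induct)
     (simp_all add: D_simps act_simps distrib_left fsupp.scale_right_distrib scale_mult basis_vec_mult,
      simp_all add: D_def)

lemma D_gen: "D k (gen i) = (if i = k then 1 else 0)"
  using D_gen_mult[of k i 1] by simp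

lemma D_mult: "D k (p * q) = p * D k q + D k p * act (G k) q"
  by (induction p rule: tensor_alg_induct)
     (simp_all add: D_simps distrib_left distrib_right fsupp.scale_right_distrib scale_mult mult.assoc
       D_gen_mult act_mult)

lemma D_emb: "D k (emb v) = scale (Poly_Mapping.lookup v k) 1"
  by (induction v rule: basis_induct)
     (auto simp: D_simps emb_simps fsupp.scale_left_distrib lookup_add lookup_scale D_gen lookup_single when_def)

text \<open>A chain rule. In the Leibniz rule the twist by \<open>G k\<close> must be traded for
  that by \<open>G j\<close>; this is allowed because wherever the coefficient of \<open>H j\<close>
  at \<open>k\<close> is nonzero, the letters \<open>j\<close> and \<open>k\<close> have the same
  degree.\<close>

lemma D_act:
  assumes "admissible H"
  shows "D k (act H p) = act H (\<Sum>m\<in>UNIV. scale (Poly_Mapping.lookup (H m) k) (D m p))"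
proof (induction p rule: tensor_alg_induct)
  case (gen j p)
  have "scale (Poly_Mapping.lookup (H j) k) (act (G k) (act H p))
      = act H (scale (Poly_Mapping.lookup (H j) k) (act (G j) p))"
    using admissibleD(1)[OF assms, of j k]
    by (cases "Poly_Mapping.lookup (H j) k = 0") (simp_all add: act_simps act_commute[OF assms])
  moreover have "(\<Sum>m\<in>UNIV. scale (Poly_Mapping.lookup (H m) k) (D m (gen j * p))) =
      gen j * (\<Sum>m\<in>UNIV. scale (Poly_Mapping.lookup (H m) k) (D m p)) +
      scale (Poly_Mapping.lookup (H j) k) (act (G j) p)"
    by (simp add: D_gen_mult fsupp.scale_right_distrib sum.distrib sum_distrib_left scale_mult if_distrib[of "scale _"]
      cong: if_cong)
  ultimately show ?case using gen
    by (simp add: act_gen_mult D_mult D_emb scale_mult act_simps)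
next
  case (scale r p)
  then show ?case by (simp add: act_simps D_simps sum_scale_scale)
qed (simp_all add: act_simps D_simps fsupp.scale_right_distrib sum.distrib)

lemma D_homog_part: "D k (homog_part (Suc n) p) = homog_part n (D k p)" "D k (homog_part 0 p) = 0"
proof (induction p arbitrary: n rule: tensor_alg_induct)
  case (gen i p)
  { case 1
    show ?case using gen
      by (cases n) (simp_all add: homog_part_gen_mult D_gen_mult homog_part_simps homog_part_act)
  next
    case 2
    show ?case by (simp add: homog_part_gen_mult D_simps)
  }
qed (simp_all add: homog_part_simps D_simps homog_part_1)

text \<open>These scalars are the matrix entries of the quantum symmetrizers. The last letter of
  \<open>w\<close> is differentiated first, hence the reverse inductions on words.\<close>

definition phi :: "'i list \<Rightarrow> ('i, 'k) tensor_alg \<Rightarrow> 'k"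
  where "phi w p = counit (foldr D w p)"

lemma phi_Nil: "phi [] p = counit p" and phi_snoc: "phi (w @ [k]) p = phi w (D k p)"
  by (simp_all add: phi_def)

lemma phi_add: "phi w (p + q) = phi w p + phi w q" and phi_scale: "phi w (scale r p) = r * phi w p"
  by (induction w arbitrary: p q rule: rev_induct) (simp_all add: phi_Nil phi_snoc D_simps)

lemma phi_0: "phi w 0 = 0"
  using phi_scale[of w 0 0] by simp

lemma phi_homog_part: "phi w (homog_part n p) = (if length w = n then phi w p else 0)"
proof (induction w arbitrary: n p rule: rev_induct)
  case Nil
  show ?case by (simp add: phi_Nil counit_def lookup_homog_part)
next
  case (snoc k w)
  then show ?case by (cases n) (simp_all add: phi_snoc D_homog_part phi_0)
qed

definition J :: "('i, 'k) tensor_alg set"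
  where "J = {p. \<forall>w. phi w p = 0}"

lemma J_subspace: "fsupp.subspace J"
  by (simp add: J_def fsupp.subspace_def phi_add phi_scale phi_0)

lemmas J_0 = fsupp.subspace_0[OF J_subspace]
lemmas J_add = fsupp.subspace_add[OF J_subspace]
lemmas J_diff = fsupp.subspace_diff[OF J_subspace]
lemmas J_minus = fsupp.subspace_neg[OF J_subspace]
lemmas J_scale = fsupp.subspace_scale[OF J_subspace]
lemmas J_sum = fsupp.subspace_sum[OF J_subspace]

lemma J_iff: "p \<in> J \<longleftrightarrow> counit p = 0 \<and> (\<forall>k. D k p \<in> J)"
proof
  assume "p \<in> J"
  then have *: "phi w p = 0" for w by (simp add: J_def)
  show "counit p = 0 \<and> (\<forall>k. D k p \<in> J)"
    using *[of "[]"] *[of "_ @ [_]"] by (simp add: J_def phi_Nil phi_snoc)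
next
  assume *: "counit p = 0 \<and> (\<forall>k. D k p \<in> J)"
  have "phi w p = 0" for w
    using * by (cases w rule: rev_cases) (auto simp: J_def phi_Nil phi_snoc)
  then show "p \<in> J" by (simp add: J_def)
qed

lemma J_counit: "p \<in> J \<Longrightarrow> counit p = 0" and J_D: "p \<in> J \<Longrightarrow> D k p \<in> J"
  using J_iff by blast+

lemma J_I: "counit p = 0 \<Longrightarrow> (\<And>k. D k p \<in> J) \<Longrightarrow> p \<in> J"
  using J_iff by blast

lemma J_act:
  assumes "admissible H" "p \<in> J"
  shows "act H p \<in> J"
proof -
  have "phi w (act H p) = 0" for w
    using assms(2)
  proof (induction w arbitrary: p rule: rev_induct)
    case (snoc k w)
    have "(\<Sum>m\<in>UNIV. scale (Poly_Mapping.lookup (H m) k) (D m p)) \<in> J"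
      by (intro J_sum J_scale J_D snoc.prems)
    then show ?case by (simp add: phi_snoc D_act[OF assms(1)] snoc.IH)
  qed (simp add: phi_Nil J_counit)
  then show ?thesis by (simp add: J_def)
qed

text \<open>The Leibniz rule leaves \<open>q * D k p\<close> and \<open>D k q * act (G k) p\<close>.
  Both factors change, so the induction on the word runs over all \<open>p\<close> in
  \<open>J\<close> and all \<open>q\<close>.\<close>

lemma J_mult_left: assumes "p \<in> J" shows "q * p \<in> J"
proof -
  have "phi w (q * p) = 0" for w
    using assms
  proof (induction w arbitrary: p q rule: rev_induct)
    case (snoc k w)
    then show ?case by (simp add: phi_snoc D_mult phi_add J_D J_act admissible_G)
  qed (simp add: phi_Nil J_counit)
  then show ?thesis by (simp add: J_def)
qed

lemma J_mult_right: assumes "p \<in> J" shows "p * q \<in> J"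
proof -
  have "phi w (p * q) = 0" for w
    using assms
  proof (induction w arbitrary: p q rule: rev_induct)
    case (snoc k w)
    then show ?case by (simp add: phi_snoc D_mult phi_add J_D)
  qed (simp add: phi_Nil J_counit)
  then show ?thesis by (simp add: J_def)
qed

lemma J_homog_part: "p \<in> J \<Longrightarrow> homog_part n p \<in> J"
  by (simp add: J_def phi_homog_part)

section \<open>The comultiplication\<close>

lemma braid_letter: "braid_letter c i v = tens (act (G i) (basis_vec v)) (basis_vec i)"
proof (induction v)
  case Nil
  show ?case by (simp add: tens_basis one_tensor_alg[symmetric]) (simp add: one_tensor_alg tens_basis)
next
  case (Cons j v)
  have G_gen: "act (G i) (basis_vec (j # v)) = emb (G i j) * act (G i) (basis_vec v)"
    using act_gen_mult[of "G i" j "basis_vec v"] by (simp add: basis_vec_mult)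
  have pre: "lin_ext (\<lambda>u. basis_vec (k # u, i)) p = tens (gen k * p) (basis_vec i)" for k and p :: "('i, 'k) tensor_alg"
    by (induction p rule: basis_induct)
       (simp_all add: lin_add[OF lin_lin_ext] lin_scale[OF lin_lin_ext] distrib_left scale_mult tens_add tens_scale basis_vec_mult tens_basis)
  have "lin_ext (\<lambda>k. tens (gen k * p) (basis_vec i)) v' = tens (emb v' * p) (basis_vec i)" for v' and p :: "('i, 'k) tensor_alg"
    by (induction v' rule: basis_induct)
       (simp_all add: lin_add[OF lin_lin_ext] lin_scale[OF lin_lin_ext] distrib_right scale_mult tens_add tens_scale emb_simps)
  then show ?case by (simp add: braiding[of i j] lin_ext_tens1 Cons pre G_gen)
qed

fun actw :: "'i list \<Rightarrow> ('i, 'k) tensor_alg \<Rightarrow> ('i, 'k) tensor_alg" where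
  "actw [] p = p"
| "actw (i # u) p = act (G i) (actw u p)"

lemma braid_word: "braid_word c u v = tens (actw u (basis_vec v)) (basis_vec u)"
proof (induction u)
  case (Cons i u)
  have "lin_ext (\<lambda>b. tens (act (G i) (basis_vec b)) (basis_vec (i # u))) p = tens (act (G i) p) (basis_vec (i # u))" for p
    by (induction p rule: basis_induct)
       (simp_all add: lin_add[OF lin_lin_ext] lin_scale[OF lin_lin_ext] act_simps tens_add tens_scale)
  moreover have "lin_ext (\<lambda>b. basis_vec (b, i # u)) p = tens p (basis_vec (i # u))" for p :: "('i, 'k) tensor_alg"
    by (induction p rule: basis_induct)
       (simp_all add: lin_add[OF lin_lin_ext] lin_scale[OF lin_lin_ext] tens_add tens_scale tens_basis)
  ultimately show ?case by (simp add: Cons lin_ext_tens1 braid_letter)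
qed (simp add: tens_basis)

lemma braided_mult_gen:
  "braided_mult c (basis_vec ([i], []) + basis_vec ([], [i])) X =
    tens_map (\<lambda>q. gen i * q) (\<lambda>q. q) X + tens_map (act (G i)) (\<lambda>q. gen i * q) X"
proof -
  have bw: "lin_ext (\<lambda>b. basis_vec (b, i # v)) p = tens p (basis_vec (i # v))" for v and p :: "('i, 'k) tensor_alg"
    by (induction p rule: basis_induct)
       (simp_all add: lin_add[OF lin_lin_ext] lin_scale[OF lin_lin_ext] tens_add tens_scale tens_basis)
  have "braided_mult c (basis_vec ([i], [])) X = tens_map (\<lambda>q. gen i * q) (\<lambda>q. q) X"
    by (induction X rule: basis_induct)
       (auto simp: braided_mult_def lin_add[OF lin_lin_ext] lin_scale[OF lin_lin_ext] lin_add[OF lin_tens_map] lin_scale[OF lin_tens_map]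
         tens_map_basis basis_vec_mult tens_basis)
  moreover have "braided_mult c (basis_vec ([], [i])) X = tens_map (act (G i)) (\<lambda>q. gen i * q) X"
    by (induction X rule: basis_induct)
       (auto simp: braided_mult_def lin_add[OF lin_lin_ext] lin_scale[OF lin_lin_ext] lin_add[OF lin_tens_map] lin_scale[OF lin_tens_map]
         tens_map_basis basis_vec_mult braid_letter lin_ext_tens1 bw)
  ultimately show ?thesis
    by (simp add: braided_mult_def lin_add[OF lin_lin_ext])
qed

lemma lin_comult: "lin (comult c)"
  unfolding comult_def by (rule lin_lin_ext)

lemmas comult_simps = lin_add[OF lin_comult] lin_scale[OF lin_comult]

lemma comult_1: "comult c 1 = tens 1 1"
  by (simp add: comult_def one_tensor_alg tens_basis)

lemma comult_gen_mult:
  "comult c (gen i * p) =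
    tens_map (\<lambda>q. gen i * q) (\<lambda>q. q) (comult c p) + tens_map (act (G i)) (\<lambda>q. gen i * q) (comult c p)"
proof (induction p rule: basis_induct)
  case (basis w)
  show ?case by (simp add: basis_vec_mult) (simp add: comult_def braided_mult_gen)
qed (simp_all add: distrib_left scale_mult comult_simps lin_add[OF lin_tens_map] lin_scale[OF lin_tens_map] fsupp.scale_right_distrib)

text \<open>The rule for a single letter extends to linear combinations of letters of one common
  degree. \<open>comult_act\<close> needs this, since \<open>H\<close> replaces a letter by such a
  combination.\<close>

lemma comult_emb_mult:
  assumes "\<And>m. Poly_Mapping.lookup v m \<noteq> 0 \<Longrightarrow> G m = G j"
  shows "comult c (emb v * p) =
    tens_map (\<lambda>q. emb v * q) (\<lambda>q. q) (comult c p) + tens_map (act (G j)) (\<lambda>q. emb v * q) (comult c p)"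
proof -
  have emb_mult: "emb v * q = (\<Sum>m\<in>UNIV. scale (Poly_Mapping.lookup v m) (gen m * q))" for q
    by (simp add: emb_eq_sum[of v] sum_distrib_right scale_mult)
  have 1: "(\<Sum>m\<in>UNIV. scale (Poly_Mapping.lookup v m) (tens_map (\<lambda>q. gen m * q) (\<lambda>q. q) X)) = tens_map (\<lambda>q. emb v * q) (\<lambda>q. q) X" for X
  proof (induction X rule: tens_induct)
    case (tens b d)
    show ?case by (simp add: tens_map_tens lin_mult2 lin_id emb_mult[of "basis_vec b"] lin_sum[OF lin_tens1] tens_scale)
  qed (simp_all add: lin_add[OF lin_tens_map] lin_scale[OF lin_tens_map] fsupp.scale_right_distrib sum.distrib sum_scale_scale)
  have 2: "(\<Sum>m\<in>UNIV. scale (Poly_Mapping.lookup v m) (tens_map (act (G m)) (\<lambda>q. gen m * q) X)) = tens_map (act (G j)) (\<lambda>q. emb v * q) X" for X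
  proof (induction X rule: tens_induct)
    case (tens b d)
    have "scale (Poly_Mapping.lookup v m) (tens (act (G m) (basis_vec b)) (gen m * basis_vec d)) =
       scale (Poly_Mapping.lookup v m) (tens (act (G j) (basis_vec b)) (gen m * basis_vec d))" for m
      using assms[of m] by (cases "Poly_Mapping.lookup v m = 0") simp_all
    from sum.cong[OF refl this] show ?case
      by (simp add: tens_map_tens lin_mult2 lin_act emb_mult[of "basis_vec d"] lin_sum[OF lin_tens2] tens_scale)
  qed (simp_all add: lin_add[OF lin_tens_map] lin_scale[OF lin_tens_map] fsupp.scale_right_distrib sum.distrib sum_scale_scale)
  show ?thesis
    by (simp add: emb_mult[of p] lin_sum[OF lin_comult] comult_simps comult_gen_mult fsupp.scale_right_distrib sum.distrib 1 2)
qed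

lemma comult_act:
  assumes "admissible H"
  shows "comult c (act H p) = tens_map (act H) (act H) (comult c p)"
proof (induction p rule: tensor_alg_induct)
  case (gen j p)
  have 1: "tens_map (\<lambda>q. emb (H j) * q) (\<lambda>q. q) (tens_map (act H) (act H) X) =
      tens_map (act H) (act H) (tens_map (\<lambda>q. gen j * q) (\<lambda>q. q) X)" for X
    by (simp add: tens_map_comp lin_mult2 lin_id lin_act act_gen_mult)
  have 2: "tens_map (act (G j)) (\<lambda>q. emb (H j) * q) (tens_map (act H) (act H) X) =
      tens_map (act H) (act H) (tens_map (act (G j)) (\<lambda>q. gen j * q) X)" for X
    by (simp add: tens_map_comp lin_mult2 lin_id lin_act act_gen_mult act_commute[OF assms])
  show ?case
    by (simp add: act_gen_mult comult_emb_mult[OF admissibleD(1)[OF assms]] gen 1 2 comult_gen_mult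
        lin_add[OF lin_tens_map])
qed (simp_all add: act_simps comult_simps lin_add[OF lin_tens_map] lin_scale[OF lin_tens_map]
      comult_1 tens_map_tens lin_act)

text \<open>Coassociativity in disguise, because \<open>D k\<close> is \<open>comult\<close>
  followed by reading off the coefficient of the letter \<open>k\<close> in the right factor
  (\<open>rcontract_gen_comult\<close>).\<close>

lemma comult_D: "comult c (D k p) = tens_map (\<lambda>q. q) (D k) (comult c p)"
proof (induction p rule: tensor_alg_induct)
  case (gen i p)
  have 1: "tens_map (\<lambda>q. q) (D k) (tens_map (\<lambda>q. gen i * q) (\<lambda>q. q) X) =
     tens_map (\<lambda>q. gen i * q) (\<lambda>q. q) (tens_map (\<lambda>q. q) (D k) X)" for X
    by (simp add: tens_map_comp lin_mult2 lin_id lin_D)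
  have 2: "tens_map (\<lambda>q. q) (D k) (tens_map (act (G i)) (\<lambda>q. gen i * q) X) =
     tens_map (act (G i)) (\<lambda>q. gen i * q) (tens_map (\<lambda>q. q) (D k) X) +
     (if i = k then tens_map (act (G k)) (act (G k)) X else 0)" for X
    by (induction X rule: tens_induct)
       (simp_all add: lin_add[OF lin_tens_map] lin_scale[OF lin_tens_map] tens_map_tens lin_mult2 lin_id lin_D lin_act
         D_gen_mult tens_add tens_0 fsupp.scale_right_distrib)
  have "comult c (D k (gen i * p)) = comult c (gen i * D k p) +
      (if i = k then tens_map (act (G k)) (act (G k)) (comult c p) else 0)"
    by (simp add: D_gen_mult comult_simps comult_act[OF admissible_G] lin_0[OF lin_comult])
  then show ?case
    by (simp add: comult_gen_mult gen lin_add[OF lin_tens_map] 1 2)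
qed (simp_all add: D_simps comult_simps lin_add[OF lin_tens_map] lin_scale[OF lin_tens_map]
      comult_1 tens_map_tens lin_D lin_id tens_0 lin_0[OF lin_comult])

lemma functional_zero: "functional (\<lambda>q. 0)"
  by (simp add: functional_def)

lemma rcontract_zero: "rcontract (\<lambda>q. 0) X = 0" and lcontract_zero: "lcontract (\<lambda>q. 0) X = 0"
  by (induction X rule: tens_induct)
     (simp_all add: lin_add[OF lin_rcontract] lin_scale[OF lin_rcontract] rcontract_tens functional_zero
       lin_add[OF lin_lcontract] lin_scale[OF lin_lcontract] lcontract_tens)

lemma rcontract_counit_comult: "rcontract counit (comult c p) = p"
proof (induction p rule: tensor_alg_induct)
  case (gen i p)
  then show ?case
    by (simp add: comult_gen_mult lin_add[OF lin_rcontract] rcontract_tens_map lin_mult2 lin_act lin_id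
        functional_counit counit_gen_mult functional_zero rcontract_zero act_simps del: counit_mult)
qed (simp_all add: comult_simps lin_add[OF lin_rcontract] lin_scale[OF lin_rcontract] comult_1
      rcontract_tens functional_counit)

lemma lcontract_counit_comult: "lcontract counit (comult c p) = p"
proof (induction p rule: tensor_alg_induct)
  case (gen i p)
  then show ?case
    by (simp add: comult_gen_mult lin_add[OF lin_lcontract] lcontract_tens_map lin_mult2 lin_act lin_id
        functional_counit counit_gen_mult functional_zero lcontract_zero act_simps del: counit_mult)
qed (simp_all add: comult_simps lin_add[OF lin_lcontract] lin_scale[OF lin_lcontract] comult_1
      lcontract_tens functional_counit)

lemma rcontract_gen_comult: "rcontract (\<lambda>q. Poly_Mapping.lookup q [k]) (comult c p) = D k p"
proof (induction p rule: tensor_alg_induct)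
  case (gen i p)
  \<comment> \<open>Reading off a letter after multiplying by a letter leaves only the constant
    term, so the new summand of the comultiplication is evaluated by the counit axiom.\<close>
  have "(\<lambda>q :: ('i, 'k) tensor_alg. Poly_Mapping.lookup (gen i * q) [k]) = (if i = k then counit else (\<lambda>_. 0))"
    by (auto simp: fun_eq_iff lookup_gen_mult counit_def)
  then show ?case using gen
    by (simp add: comult_gen_mult lin_add[OF lin_rcontract] rcontract_tens_map lin_mult2 lin_act lin_id
        functional_lookup functional_counit functional_zero rcontract_zero act_simps
        rcontract_counit_comult D_gen_mult)
qed (simp_all add: comult_simps lin_add[OF lin_rcontract] lin_scale[OF lin_rcontract] comult_1
      rcontract_tens functional_lookup D_simps, simp add: one_tensor_alg lookup_single)

lemma lookup_comult_Nil_right: "Poly_Mapping.lookup (comult c p) (u, []) = Poly_Mapping.lookup p u"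
  using lookup_rcontract[of "[]" "comult c p" u] rcontract_counit_comult[of p]
  by (simp add: counit_def[abs_def])

lemma lookup_comult_Nil_left: "Poly_Mapping.lookup (comult c p) ([], v) = Poly_Mapping.lookup p v"
  using lookup_lcontract[of "[]" "comult c p" v] lcontract_counit_comult[of p]
  by (simp add: counit_def[abs_def])

definition bideg :: "nat \<Rightarrow> ('i, 'k) tensor_alg2 \<Rightarrow> ('i, 'k) tensor_alg2"
  where "bideg n = filt (\<lambda>(u, v). length u + length v = n)"

lemma lin_bideg: "lin (bideg n)"
  unfolding bideg_def by (rule lin_filt)

lemma lookup_bideg:
  "Poly_Mapping.lookup (bideg n X) (u, v) = (if length u + length v = n then Poly_Mapping.lookup X (u, v) else 0)"
  by (simp add: bideg_def lookup_filt)

lemma bideg_tens: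
  assumes "homog_part a p = p" "homog_part b q = q"
  shows "bideg n (tens p q) = (if a + b = n then tens p q else 0)"
proof (rule poly_mapping_eqI)
  fix k :: "'i list \<times> 'i list"
  obtain u v where k: "k = (u, v)" by fastforce
  have "length u = a" if "Poly_Mapping.lookup p u \<noteq> 0"
    using that assms(1) lookup_homog_part[of a p u] by (auto split: if_splits)
  moreover have "length v = b" if "Poly_Mapping.lookup q v \<noteq> 0"
    using that assms(2) lookup_homog_part[of b q v] by (auto split: if_splits)
  ultimately show "Poly_Mapping.lookup (bideg n (tens p q)) k =
      Poly_Mapping.lookup (if a + b = n then tens p q else 0) k"
    by (auto simp: k lookup_bideg lookup_tens)
qed

lemma homog_part_basis: "homog_part (length w) (basis_vec w) = basis_vec w"
  by (rule poly_mapping_eqI) (auto simp: lookup_homog_part lookup_single when_def)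

lemma bideg_comult: "bideg n (comult c p) = comult c (homog_part n p)"
proof (induction p arbitrary: n rule: tensor_alg_induct)
  case (gen i p)
  have h: "homog_part (Suc (length w)) (gen i * basis_vec w) = gen i * basis_vec w" for w
    by (simp add: homog_part_gen_mult homog_part_basis)
  have a: "homog_part (length w) (act (G i) (basis_vec w)) = act (G i) (basis_vec w)" for w
    by (simp add: homog_part_act homog_part_basis)
  have 1: "bideg (Suc n) (tens_map (\<lambda>q. gen i * q) (\<lambda>q. q) X) = tens_map (\<lambda>q. gen i * q) (\<lambda>q. q) (bideg n X)"
      "bideg 0 (tens_map (\<lambda>q. gen i * q) (\<lambda>q. q) X) = 0"
      "bideg (Suc n) (tens_map (act (G i)) (\<lambda>q. gen i * q) X) = tens_map (act (G i)) (\<lambda>q. gen i * q) (bideg n X)"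
      "bideg 0 (tens_map (act (G i)) (\<lambda>q. gen i * q) X) = 0" for X n
    by (induction X rule: tens_induct)
       (simp_all add: lin_add[OF lin_tens_map] lin_scale[OF lin_tens_map] lin_0[OF lin_tens_map] lin_add[OF lin_bideg] lin_scale[OF lin_bideg]
         tens_map_tens lin_mult2 lin_id lin_act bideg_tens[OF h homog_part_basis] bideg_tens[OF a h] bideg_tens[OF homog_part_basis homog_part_basis])
  show ?case
    by (cases n) (simp_all add: comult_gen_mult lin_add[OF lin_bideg] 1 gen homog_part_gen_mult lin_0[OF lin_comult])
next
  case one
  have "homog_part 0 1 = (1 :: ('i, 'k) tensor_alg)" by (simp add: homog_part_1)
  from bideg_tens[OF this this, of n] show ?case
    by (simp add: comult_1 homog_part_1 lin_0[OF lin_comult])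
qed (simp_all add: comult_simps homog_part_simps lin_add[OF lin_bideg] lin_scale[OF lin_bideg])

lemma lookup_comult_nonzero:
  assumes "homog_part n p = p" "Poly_Mapping.lookup (comult c p) (u, v) \<noteq> 0"
  shows "length u + length v = n"
  using assms lookup_bideg[of n "comult c p" u v] by (auto simp: bideg_comult split: if_splits)

section \<open>The antipode\<close>

text \<open>A braided antipode reverses products along the braiding, S m = m (S \<otimes> S) c. As
  c(x_i \<otimes> w) = g_i(w) \<otimes> x_i and S(x_i) = - x_i, this is the recursion.\<close>

fun sword :: "'i list \<Rightarrow> ('i, 'k) tensor_alg" where
  "sword [] = 1"
| "sword (i # w) = - (act (G i) (sword w) * gen i)"

definition S :: "('i, 'k) tensor_alg \<Rightarrow> ('i, 'k) tensor_alg"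
  where "S = lin_ext sword"

lemma lin_S: "lin S"
  unfolding S_def by (rule lin_lin_ext)

lemmas S_simps = lin_add[OF lin_S] lin_scale[OF lin_S] lin_0[OF lin_S] lin_minus[OF lin_S]

lemma S_1 [simp]: "S 1 = 1"
  by (simp add: S_def one_tensor_alg)

lemma S_gen_mult: "S (gen i * p) = - (act (G i) (S p) * gen i)"
proof (induction p rule: basis_induct)
  case (basis w)
  show ?case by (simp add: basis_vec_mult) (simp add: S_def)
qed (simp_all add: S_simps act_simps distrib_left distrib_right scale_mult)

lemma S_emb_mult:
  assumes "\<And>m. Poly_Mapping.lookup v m \<noteq> 0 \<Longrightarrow> G m = G j"
  shows "S (emb v * p) = - (act (G j) (S p) * emb v)"
proof -
  have "scale (Poly_Mapping.lookup v m) (act (G m) (S p) * gen m) = scale (Poly_Mapping.lookup v m) (act (G j) (S p) * gen m)" for m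
    using assms[of m] by (cases "Poly_Mapping.lookup v m = 0") simp_all
  from sum.cong[OF refl this] show ?thesis
    by (simp add: emb_eq_sum[of v] sum_distrib_right sum_distrib_left scale_mult lin_sum[OF lin_S] S_simps S_gen_mult
        sum_negf)
qed

lemma S_act:
  assumes "admissible H"
  shows "S (act H p) = act H (S p)"
  by (induction p rule: tensor_alg_induct)
     (simp_all add: act_simps S_simps act_gen_mult S_emb_mult[OF admissibleD(1)[OF assms]] S_gen_mult act_mult
       act_commute[OF assms])

text \<open>The two summands of the comultiplication of x_i p cancel: applying S to x_i times a left
  factor gives minus g_i(S(...)) x_i, and \<open>S_act\<close> identifies g_i S with S g_i.\<close>

lemma antipode_left: "mult (tens_map S (\<lambda>q. q) (comult c p)) = scale (counit p) 1"
proof (induction p rule: tensor_alg_induct)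
  case (gen i p)
  have "mult (tens_map S (\<lambda>q. q) (tens_map (\<lambda>q. gen i * q) (\<lambda>q. q) X)) =
      - mult (tens_map S (\<lambda>q. q) (tens_map (act (G i)) (\<lambda>q. gen i * q) X))" for X
    by (induction X rule: tens_induct)
       (simp_all add: lin_add[OF lin_tens_map] lin_scale[OF lin_tens_map] lin_add[OF lin_mult] lin_scale[OF lin_mult]
         tens_map_tens lin_mult2 lin_id lin_act lin_S mult_tens S_gen_mult S_act[OF admissible_G] mult.assoc)
  then show ?case by (simp add: comult_gen_mult lin_add[OF lin_tens_map] lin_add[OF lin_mult])
qed (simp_all add: comult_simps lin_add[OF lin_tens_map] lin_scale[OF lin_tens_map] lin_add[OF lin_mult] lin_scale[OF lin_mult]
      fsupp.scale_left_distrib comult_1 tens_map_tens lin_S lin_id mult_tens)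

text \<open>Here the two summands become x_i t and - g_i(t) x_i, where t is the value for p. By
  induction t is a scalar, so they cancel.\<close>

lemma antipode_right: "mult (tens_map (\<lambda>q. q) S (comult c p)) = scale (counit p) 1"
proof (induction p rule: tensor_alg_induct)
  case (gen i p)
  have "mult (tens_map (\<lambda>q. q) S (tens_map (\<lambda>q. gen i * q) (\<lambda>q. q) X)) =
      gen i * mult (tens_map (\<lambda>q. q) S X)"
    "mult (tens_map (\<lambda>q. q) S (tens_map (act (G i)) (\<lambda>q. gen i * q) X)) =
      - (act (G i) (mult (tens_map (\<lambda>q. q) S X)) * gen i)" for X
    by (induction X rule: tens_induct)
       (simp_all add: lin_add[OF lin_tens_map] lin_scale[OF lin_tens_map] lin_add[OF lin_mult] lin_scale[OF lin_mult]
         tens_map_tens lin_mult2 lin_id lin_act lin_S mult_tens S_gen_mult mult.assoc act_simps act_mult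
         scale_mult distrib_left distrib_right)
  then show ?case by (simp add: comult_gen_mult gen act_simps scale_mult lin_add[OF lin_tens_map] lin_add[OF lin_mult])
qed (simp_all add: comult_simps lin_add[OF lin_tens_map] lin_scale[OF lin_tens_map] lin_add[OF lin_mult] lin_scale[OF lin_mult]
      fsupp.scale_left_distrib comult_1 tens_map_tens lin_S lin_id mult_tens)

section \<open>The Nichols ideal\<close>

text \<open>
  The direct sum of the quantum symmetrizers. It turns the comultiplication into deconcatenation of words,
  which is the content of \<open>lookup_QQ_comult\<close>.
\<close>

definition Q :: "('i, 'k) tensor_alg \<Rightarrow> ('i, 'k) tensor_alg" where
  "Q = lin_ext (\<lambda>u. \<Sum>w | length w = length u. scale (phi w (basis_vec u)) (basis_vec w))"

lemma lin_Q: "lin Q"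
  unfolding Q_def by (rule lin_lin_ext)

lemma lookup_Q: "Poly_Mapping.lookup (Q p) w = phi w p"
proof (rule lin_lookup_eqI[OF lin_Q])
  fix u :: "'i list"
  have "finite {w :: 'i list. length w = length u}"
    using finite_lists_length_eq[of "UNIV :: 'i set" "length u"] by simp
  then have "(\<Sum>w' | length w' = length u. phi w' (basis_vec u) * (if w' = w then 1 else 0)) =
      (if length w = length u then phi w (basis_vec u) else 0)"
    by (simp add: if_distrib[of "(*) _"] cong: if_cong)
  also have "\<dots> = phi w (basis_vec u)"
    using phi_homog_part[of w "length u" "basis_vec u"] by (auto simp: homog_part_basis)
  finally show "Poly_Mapping.lookup (Q (basis_vec u)) w = phi w (basis_vec u)"
    by (simp add: Q_def lookup_sum lookup_scale lookup_single when_def)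
qed (simp_all add: phi_add phi_scale)

lemma J_eq_ker_Q: "J = {p. Q p = 0}"
  by (auto simp: J_def lookup_Q[symmetric] intro: poly_mapping_eqI)

abbreviation K2 :: "('i, 'k) tensor_alg2 set"
  where "K2 \<equiv> tens_kernel J"

lemma K2_iff: "X \<in> K2 \<longleftrightarrow> (\<forall>u v. Poly_Mapping.lookup (tens_map Q Q X) (u, v) = 0)"
  unfolding J_eq_ker_Q tens_kernel_ker[OF lin_Q]
  by (metis (mono_tags, lifting) lookup_zero mem_Collect_eq poly_mapping_eqI surj_pair)

lemma lookup_QQ_comult: "Poly_Mapping.lookup (tens_map Q Q (comult c p)) (u, v) = phi (u @ v) p"
proof (induction v arbitrary: p rule: rev_induct)
  case Nil
  have "Poly_Mapping.lookup (tens_map Q Q X) (u, []) = phi u (rcontract counit X)" for X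
    by (induction X rule: tens_induct)
       (simp_all add: lin_add[OF lin_tens_map] lin_scale[OF lin_tens_map] lin_add[OF lin_rcontract] lin_scale[OF lin_rcontract]
         lookup_add lookup_scale phi_add phi_scale tens_map_tens lin_Q lookup_tens lookup_Q rcontract_tens functional_counit phi_Nil
         mult.commute)
  then show ?case by (simp add: rcontract_counit_comult)
next
  case (snoc k v)
  have "Poly_Mapping.lookup (tens_map Q Q X) (u, v @ [k]) =
      Poly_Mapping.lookup (tens_map Q Q (tens_map (\<lambda>q. q) (D k) X)) (u, v)" for X
    by (induction X rule: tens_induct)
       (simp_all add: lin_add[OF lin_tens_map] lin_scale[OF lin_tens_map] lookup_add lookup_scale tens_map_tens lin_Q lookup_tens
         lookup_Q phi_snoc lin_id lin_D)
  then show ?case by (simp add: comult_D[symmetric] snoc phi_snoc append_assoc[symmetric] del: append_assoc)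
qed

lemma comult_J: "p \<in> J \<Longrightarrow> comult c p \<in> K2"
  unfolding K2_iff lookup_QQ_comult by (simp add: J_def)

text \<open>Homogeneity for the group grading of T(V). The degree of a word is represented by the
  operator \<open>actw\<close> by which it acts, since only this operator enters the
  braiding.\<close>

definition typed :: "(('i, 'k) tensor_alg \<Rightarrow> ('i, 'k) tensor_alg) \<Rightarrow> ('i, 'k) tensor_alg \<Rightarrow> bool"
  where "typed A p \<longleftrightarrow> (\<forall>v. Poly_Mapping.lookup p v \<noteq> 0 \<longrightarrow> actw v = A)"

lemma typed_0: "typed A 0"
  and typed_add: "typed A p \<Longrightarrow> typed A q \<Longrightarrow> typed A (p + q)"
  and typed_scale: "typed A p \<Longrightarrow> typed A (scale r p)"
  unfolding typed_def lookup_add lookup_scale by (simp, metis add_0, metis mult_zero_right)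

lemma typed_sum: "(\<And>b. b \<in> B \<Longrightarrow> typed A (f b)) \<Longrightarrow> typed A (sum f B)"
  by (induction B rule: infinite_finite_induct) (simp_all add: typed_0 typed_add)

lemma typed_basis: "typed (actw u) (basis_vec u)"
  by (auto simp: typed_def lookup_single when_def)

lemma typed_lin:
  assumes "lin f" "\<And>w. actw w = A \<Longrightarrow> typed B (f (basis_vec w))" "typed A p"
  shows "typed B (f p)"
proof -
  have "f p = lin_ext (\<lambda>b. f (basis_vec b)) p"
    using lin_compose_ext[OF assms(1), of basis_vec p] by (simp add: lin_ext_basis_vec)
  also have "typed B \<dots>"
    unfolding lin_ext_def using assms(2,3)
    by (intro typed_sum typed_scale) (auto simp: typed_def in_keys_iff)
  finally show ?thesis .
qed

lemma typed_gen_mult: "typed A p \<Longrightarrow> typed (\<lambda>x. act (G i) (A x)) (gen i * p)"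
  by (auto simp: typed_def lookup_gen_mult fun_eq_iff split: list.splits if_splits)

lemma typed_act:
  assumes "admissible H" "typed A p"
  shows "typed A (act H p)"
proof (rule typed_lin[OF lin_act _ assms(2)])
  have "typed (actw w) (act H (basis_vec w))" for w
  proof (induction w)
    case Nil
    have "act H (basis_vec []) = basis_vec []" using act_1[of H] by (simp only: one_tensor_alg)
    then show ?case by (simp only: typed_basis)
  next
    case (Cons i w)
    have "typed (actw (i # w)) (scale (Poly_Mapping.lookup (H i) m) (gen m * act H (basis_vec w)))" for m
    proof (cases "Poly_Mapping.lookup (H i) m = 0")
      case False
      then have "actw (i # w) = (\<lambda>x. act (G m) (actw w x))"
        by (simp add: fun_eq_iff admissibleD(1)[OF assms(1) False])
      then show ?thesis using typed_gen_mult[OF Cons, of m] by (simp add: typed_scale)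
    qed (simp add: typed_0)
    then have "typed (actw (i # w)) (emb (H i) * act H (basis_vec w))"
      by (simp add: emb_eq_sum sum_distrib_right scale_mult typed_sum)
    moreover have "act H (basis_vec (i # w)) = emb (H i) * act H (basis_vec w)"
      using act_gen_mult[of H i "basis_vec w"] by (simp add: basis_vec_mult)
    ultimately show ?case by (simp only:)
  qed
  then show "typed A (act H (basis_vec w))" if "actw w = A" for w
    using that by auto
qed

text \<open>A derivation by the letter \<open>k\<close> removes one factor of degree
  \<open>G k\<close>.\<close>

lemma typed_D:
  assumes "typed A p"
  shows "typed (\<lambda>x. act (Ginv k) (A x)) (D k p)"
proof (rule typed_lin[OF lin_D _ assms])
  have "typed (\<lambda>x. act (Ginv k) (actw w x)) (D k (basis_vec w))" for w
  proof (induction w)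
    case Nil
    show ?case by (simp add: one_tensor_alg[symmetric] typed_0)
  next
    case (Cons i w)
    have "typed (\<lambda>x. act (Ginv k) (actw (i # w) x)) (gen i * D k (basis_vec w))"
      using typed_gen_mult[OF Cons, of i] by (simp add: act_commute admissible_Ginv)
    moreover have "typed (\<lambda>x. act (Ginv k) (actw (i # w) x)) (act (G k) (basis_vec w))" if "i = k"
      using typed_act[OF admissible_G[of k] typed_basis[of w]] that by (simp add: act_Ginv)
    ultimately show ?case
      using D_gen_mult[of k i "basis_vec w"] by (cases "i = k") (simp_all add: basis_vec_mult typed_add)
  qed
  then show "typed (\<lambda>x. act (Ginv k) (A x)) (D k (basis_vec w))" if "actw w = A" for w
    using that by auto
qed

lemma actw_snoc: "actw (w @ [k]) x = act (G k) (actw w x)"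
  by (induction w) (simp_all add: act_commute[OF admissible_G])

text \<open>Follow the degree through the successive derivations: a nonzero constant term at the end
  lies in the trivial degree, so the letters removed account for all of \<open>A\<close>.\<close>

lemma phi_typed:
  assumes "typed A p" "phi w p \<noteq> 0"
  shows "actw w = A"
  using assms
proof (induction w arbitrary: A p rule: rev_induct)
  case Nil
  then show ?case by (simp add: phi_Nil counit_def typed_def)
next
  case (snoc k w)
  have "actw w = (\<lambda>x. act (Ginv k) (A x))"
    using snoc.IH[OF typed_D[OF snoc.prems(1)], of k] snoc.prems(2) by (simp add: phi_snoc)
  then show ?case by (simp add: fun_eq_iff actw_snoc act_Ginv)
qed

lemma lin_actw: "lin (actw u)"
  by (induction u) (simp_all add: lin_iff lin_add[OF lin_act] lin_scale[OF lin_act])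

lemma J_actw: "p \<in> J \<Longrightarrow> actw u p \<in> J"
  by (induction u) (simp_all add: J_act admissible_G)

fun actwinv :: "'i list \<Rightarrow> ('i, 'k) tensor_alg \<Rightarrow> ('i, 'k) tensor_alg" where
  "actwinv [] p = p"
| "actwinv (i # u) p = actwinv u (act (Ginv i) p)"

lemma lin_actwinv: "lin (actwinv u)"
proof (induction u)
  case (Cons i u)
  then show ?case by (simp add: lin_iff act_simps)
qed (simp add: lin_iff)

lemma J_actwinv: "p \<in> J \<Longrightarrow> actwinv u p \<in> J"
  by (induction u arbitrary: p) (simp_all add: J_act admissible_Ginv)

lemma actwinv: "actwinv u (actw u p) = p" "actw u (actwinv u p) = p"
  by (induction u arbitrary: p) (simp_all add: act_Ginv)

lemma actwinv_cong: "actw u = actw a \<Longrightarrow> actwinv u x = actwinv a x"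
  by (metis actwinv)

section \<open>The braiding and the kernel of the tensor square\<close>

lemma lin_braid: "lin (braid c)"
  unfolding braid_def by (rule lin_lin_ext)

lemma braid_tens: "braid c (tens (basis_vec u) p) = tens (actw u p) (basis_vec u)"
  by (induction p rule: basis_induct)
     (simp_all add: tens_add tens_scale lin_add[OF lin_braid] lin_scale[OF lin_braid] lin_add[OF lin_actw] lin_scale[OF lin_actw],
      simp add: tens_basis braid_def braid_word)

definition braid_inv :: "('i, 'k) tensor_alg2 \<Rightarrow> ('i, 'k) tensor_alg2"
  where "braid_inv = lin_ext (\<lambda>(v, u). tens (basis_vec u) (actwinv u (basis_vec v)))"

lemma lin_braid_inv: "lin braid_inv"
  unfolding braid_inv_def by (rule lin_lin_ext)

lemma braid_inv_tens: "braid_inv (tens p (basis_vec u)) = tens (basis_vec u) (actwinv u p)"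
  by (induction p rule: basis_induct)
     (simp_all add: tens_add tens_scale lin_add[OF lin_braid_inv] lin_scale[OF lin_braid_inv] lin_add[OF lin_actwinv] lin_scale[OF lin_actwinv],
      simp add: tens_basis braid_inv_def)

lemma braid_braid_inv: "braid c (braid_inv X) = X"
  by (induction X rule: tens_induct)
     (simp_all add: lin_add[OF lin_braid_inv] lin_scale[OF lin_braid_inv] lin_add[OF lin_braid] lin_scale[OF lin_braid]
       braid_inv_tens braid_tens actwinv)

lemma K2_map:
  assumes "X \<in> K2" "lin f" "lin g" "\<And>p. p \<in> J \<Longrightarrow> f p \<in> J" "\<And>p. p \<in> J \<Longrightarrow> g p \<in> J"
  shows "tens_map f g X \<in> K2"
  by (rule tens_kernel_lin_image[OF lin_tens_map tens_kernel_subspace assms(1)])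
     (simp_all add: tens_map_tens assms tens_kernel_left tens_kernel_right)

text \<open>The braiding sends a \<otimes> b to (\<open>actw a\<close> b) \<otimes> a, with an
  operator depending on the input. At the coordinate (u, v) of \<open>Q\<close> \<otimes>
  \<open>Q\<close> the factor \<open>phi v a\<close> occurs; if it is nonzero,
  \<open>actw a = actw v\<close> by \<open>phi_typed\<close>. The operator therefore depends only on
  the coordinate and preserves \<open>K2\<close>. The inverse braiding is treated alike, which gives
  equality of the two sets.\<close>

lemma braid_K2: "braid c ` K2 = K2"
proof (intro equalityI subsetI)
  fix Y assume "Y \<in> braid c ` K2"
  then obtain X where X: "X \<in> K2" "Y = braid c X" by blast
  have "Poly_Mapping.lookup (tens_map Q Q (braid c Z)) (u, v) =
      Poly_Mapping.lookup (tens_map Q Q (tens_map (\<lambda>q. q) (actw v) Z)) (v, u)" for u v Z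
  proof (induction Z rule: tens_induct)
    case (tens a b)
    have "phi u (actw a (basis_vec b)) * phi v (basis_vec a) = phi u (actw v (basis_vec b)) * phi v (basis_vec a)"
      using phi_typed[OF typed_basis[of a], of v] by (cases "phi v (basis_vec a) = 0") simp_all
    then show ?case
      by (simp add: braid_tens tens_map_tens lin_Q lin_id lin_actw lookup_tens lookup_Q mult.commute)
  qed (simp_all add: lin_add[OF lin_tens_map] lin_scale[OF lin_tens_map] lin_add[OF lin_braid] lin_scale[OF lin_braid] lookup_add lookup_scale)
  moreover have "tens_map (\<lambda>q. q) (actw v) X \<in> K2" for v
    by (rule K2_map[OF X(1)]) (simp_all add: lin_id lin_actw J_actw)
  ultimately show "Y \<in> K2" by (simp add: K2_iff X(2))
next
  fix X assume X: "X \<in> K2"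
  have "Poly_Mapping.lookup (tens_map Q Q (braid_inv Z)) (u, v) =
      Poly_Mapping.lookup (tens_map Q Q (tens_map (actwinv u) (\<lambda>q. q) Z)) (v, u)" for u v Z
  proof (induction Z rule: tens_induct)
    case (tens b a)
    have "phi u (basis_vec a) * phi v (actwinv a (basis_vec b)) = phi u (basis_vec a) * phi v (actwinv u (basis_vec b))"
      using actwinv_cong[OF phi_typed[OF typed_basis[of a], of u]] by (cases "phi u (basis_vec a) = 0") simp_all
    then show ?case
      by (simp add: braid_inv_tens tens_map_tens lin_Q lin_id lin_actwinv lookup_tens lookup_Q mult.commute)
  qed (simp_all add: lin_add[OF lin_tens_map] lin_scale[OF lin_tens_map] lin_add[OF lin_braid_inv] lin_scale[OF lin_braid_inv] lookup_add lookup_scale)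
  moreover have "tens_map (actwinv u) (\<lambda>q. q) X \<in> K2" for u
    by (rule K2_map[OF X]) (simp_all add: lin_id lin_actwinv J_actwinv)
  ultimately have "braid_inv X \<in> K2" by (simp add: K2_iff)
  then show "X \<in> braid c ` K2" by (metis braid_braid_inv image_eqI)
qed

section \<open>Degree truncations and stability under the antipode\<close>

lemma filt_mem:
  assumes "fsupp.subspace I" "\<And>n. P n \<Longrightarrow> homog_part n p \<in> I"
  shows "filt (\<lambda>w. P (length w)) p \<in> I"
  unfolding filt_eq_sum_homog_part by (rule fsupp.subspace_sum[OF assms(1)]) (use assms(2) in auto)

lemma mem_if_homog_parts:
  assumes "fsupp.subspace I" "\<And>n. homog_part n p \<in> I"
  shows "p \<in> I"
  using fsupp.subspace_sum[OF assms(1), of "length ` Poly_Mapping.keys p" "\<lambda>n. homog_part n p"] assms(2)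
  by (metis eq_sum_homog_part)

text \<open>All terms have total degree \<open>n\<close>, so the left factor has full degree only
  when the right factor is a scalar; by the counit axiom these terms sum to p \<otimes> 1.\<close>

lemma comult_homog_left:
  assumes "homog_part n p = p"
  shows "tens_map (filt (\<lambda>w. length w < n)) (\<lambda>q. q) (comult c p) = comult c p - tens p 1"
proof (rule poly_mapping_eqI)
  fix k :: "'i list \<times> 'i list"
  obtain u v where k: "k = (u, v)" by fastforce
  have f: "filt (\<lambda>_. True) = (\<lambda>q :: ('i, 'k) tensor_alg. q)"
    by (auto simp: fun_eq_iff lookup_filt intro: poly_mapping_eqI)
  have "length u < n" if "Poly_Mapping.lookup (comult c p) (u, v) \<noteq> 0" "v \<noteq> []"
    using lookup_comult_nonzero[OF assms that(1)] that(2) by (cases v) auto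
  moreover have "length u = n" if "Poly_Mapping.lookup p u \<noteq> 0"
    using that assms lookup_homog_part[of n p u] by (auto split: if_splits)
  ultimately show "Poly_Mapping.lookup (tens_map (filt (\<lambda>w. length w < n)) (\<lambda>q. q) (comult c p)) k
      = Poly_Mapping.lookup (comult c p - tens p 1) k"
    using lookup_tens_map_filt[of "\<lambda>w. length w < n" "\<lambda>_. True" "comult c p" u v]
      lookup_comult_Nil_right[of p u]
    by (cases "v = []"; cases "Poly_Mapping.lookup (comult c p) (u, v) = 0") (auto simp: k f lookup_minus lookup_tens one_tensor_alg lookup_single)
qed

lemma comult_homog_middle:
  assumes "homog_part n p = p" "counit p = 0"
  defines "f \<equiv> filt (\<lambda>w. 0 < length w \<and> length w < n)"
  shows "tens_map f f (comult c p) = comult c p - (tens p 1 + tens 1 p)"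
proof (rule poly_mapping_eqI)
  fix k :: "'i list \<times> 'i list"
  obtain u v where k: "k = (u, v)" by fastforce
  have 1: "length u < n \<and> length v < n"
    if "Poly_Mapping.lookup (comult c p) (u, v) \<noteq> 0" "u \<noteq> []" "v \<noteq> []"
    using lookup_comult_nonzero[OF assms(1) that(1)] that(2,3) by (cases u; cases v) auto
  have 0: "Poly_Mapping.lookup p [] = 0" using assms(2) by (simp add: counit_def)
  show "Poly_Mapping.lookup (tens_map f f (comult c p)) k
      = Poly_Mapping.lookup (comult c p - (tens p 1 + tens 1 p)) k"
    unfolding f_def k lookup_tens_map_filt
    using lookup_comult_Nil_right[of p u] lookup_comult_Nil_left[of p v] 0 1
    by (cases "u = []"; cases "v = []"; cases "Poly_Mapping.lookup (comult c p) (u, v) = 0")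
       (auto simp: lookup_minus lookup_add lookup_tens one_tensor_alg lookup_single)
qed

text \<open>
  By induction on the degree: the antipode identity expresses \<open>S p\<close> by the values of \<open>S\<close> on the left
  tensor factors of smaller degree.
\<close>

lemma J_S: assumes "p \<in> J" shows "S p \<in> J"
proof -
  have homog: "S p \<in> J" if "p \<in> J" "homog_part n p = p" for n p
    using that
  proof (induction n arbitrary: p rule: less_induct)
    case (less n)
    let ?f = "filt (\<lambda>w :: 'i list. length w < n)"
    define F where "F X = mult (tens_map S (\<lambda>q. q) (tens_map ?f (\<lambda>q. q) X))" for X
    have F: "lin F"
      by (simp add: F_def lin_iff lin_add[OF lin_tens_map] lin_scale[OF lin_tens_map] lin_add[OF lin_mult] lin_scale[OF lin_mult])
    have Ft: "F (tens a b) = S (?f a) * b" for a b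
      by (simp add: F_def tens_map_tens lin_S lin_id lin_filt mult_tens)
    have Sf: "S (?f a) \<in> J" if a: "a \<in> J" for a
    proof -
      have "S (homog_part m a) \<in> J" if "m < n" for m
        using less.IH[OF that, of "homog_part m a"] a by (simp add: J_homog_part homog_part_homog_part)
      then show ?thesis
        by (auto simp: filt_eq_sum_homog_part[of "\<lambda>m. m < n"] lin_sum[OF lin_S] intro!: J_sum)
    qed
    have "F (comult c p) \<in> J"
      by (rule tens_kernel_lin_image[OF F J_subspace comult_J[OF less.prems(1)]])
        (simp_all add: Ft Sf J_mult_left J_mult_right)
    moreover have "F (comult c p) = mult (tens_map S (\<lambda>q. q) (comult c p)) - S p"
      by (simp add: F_def comult_homog_left[OF less.prems(2)] lin_diff[OF lin_tens_map] lin_diff[OF lin_mult]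
          tens_map_tens lin_S lin_id mult_tens)
    then have "F (comult c p) = - S p"
      using J_counit[OF less.prems(1)] by (simp add: antipode_left)
    ultimately show ?case using J_minus by fastforce
  qed
  have "S p = (\<Sum>n\<in>length ` Poly_Mapping.keys p. S (homog_part n p))"
    by (subst eq_sum_homog_part) (rule lin_sum[OF lin_S])
  also have "\<dots> \<in> J"
    by (intro J_sum homog[of _ n for n]) (use assms in \<open>auto simp: J_homog_part homog_part_homog_part\<close>)
  finally show ?thesis .
qed

section \<open>Low degrees, primitive elements and uniqueness\<close>

lemma phi_singleton: "phi [k] p = Poly_Mapping.lookup p [k]"
proof -
  have "D k p = rcontract (\<lambda>q. Poly_Mapping.lookup q [k]) (comult c p)"
    by (simp add: rcontract_gen_comult)
  then show ?thesis
    using lookup_rcontract[of "[k]" "comult c p" "[]"] lookup_comult_Nil_left[of p "[k]"]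
      phi_snoc[of "[]" k p] by (simp add: phi_Nil counit_def)
qed

lemma homog_1_J_eq_0: assumes "p \<in> J" "n \<le> 1" shows "homog_part n p = 0"
proof (rule poly_mapping_eqI)
  fix w :: "'i list"
  have *: "phi w p = 0" for w using assms(1) by (simp add: J_def)
  consider "w = []" | k where "w = [k]" | "length w > 1"
    by (cases w; cases "tl w") auto
  then show "Poly_Mapping.lookup (homog_part n p) w = Poly_Mapping.lookup 0 w"
  proof cases
    case 1
    then show ?thesis using *[of "[]"] by (simp add: lookup_homog_part phi_Nil counit_def)
  next
    case 2
    then show ?thesis using *[of w] by (simp add: lookup_homog_part phi_singleton)
  next
    case 3
    then show ?thesis using assms(2) by (simp add: lookup_homog_part)
  qed
qed

lemma graded_ideal_J: "graded_ideal J"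
  by (simp add: graded_ideal_def J_subspace mult_tens J_mult_left J_mult_right J_homog_part)

lemma graded_hopf_ideal_J: "graded_hopf_ideal c J"
proof -
  have "\<exists>S. lin S \<and> S ` J \<subseteq> J \<and>
      (\<forall>p. mult (tens_map S id (comult c p)) - scale (counit p) unit \<in> J \<and>
           mult (tens_map id S (comult c p)) - scale (counit p) unit \<in> J)"
    by (rule exI[of _ S])
       (auto simp: lin_S J_S unit_eq_1 antipode_left[folded id_def] antipode_right[folded id_def] J_0)
  then show ?thesis
    by (auto simp: graded_hopf_ideal_def graded_ideal_J braid_K2 comult_J J_counit)
qed

text \<open>No length lies strictly between 0 and 1, so the middle part in
  \<open>comult_homog_middle\<close> is zero.\<close>

lemma comult_homog_1:
  assumes "homog_part 1 v = v"
  shows "comult c v = tens v 1 + tens 1 v"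
proof -
  have "counit v = 0"
    using assms lookup_homog_part[of 1 v "[]"] by (simp add: counit_def)
  from comult_homog_middle[OF assms this]
  have "comult c v - (tens v 1 + tens 1 v) = tens_map (filt (\<lambda>w. False)) (filt (\<lambda>w. False)) (comult c v)"
    by (simp add: less_Suc_eq cong: rev_conj_cong)
  also have "\<dots> = 0"
    by (rule poly_mapping_eqI) (metis lookup_tens_map_filt lookup_zero surj_pair)
  finally show ?thesis by simp
qed

text \<open>In coordinates, primitivity modulo \<open>J\<close> reads
  \<open>phi (u @ v) p = phi u p * phi v 1 + phi u 1 * phi v p\<close>. Nonempty words annihilate 1,
  so \<open>phi w p\<close> vanishes once \<open>w\<close> has two letters, and empty
  \<open>u\<close>, \<open>v\<close> give counit p = 2 counit p. Only the degree-one part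
  survives.\<close>

lemma primitive_mod_J: "primitive_mod c J = {v + p |v p. homog_part 1 v = v \<and> p \<in> J}"
proof (intro equalityI subsetI)
  fix p assume "p \<in> primitive_mod c J"
  then have "comult c p - (tens p 1 + tens 1 p) \<in> K2"
    by (simp add: primitive_mod_def unit_eq_1)
  then have *: "phi (u @ v) p = phi u p * phi v 1 + phi u 1 * phi v p" for u v
    unfolding K2_iff
    by (simp add: lin_diff[OF lin_tens_map] lin_add[OF lin_tens_map] lookup_minus lookup_add lookup_QQ_comult
        tens_map_tens lin_Q lookup_tens lookup_Q)
  have phi1: "phi (w @ [k]) 1 = 0" for w k by (simp add: phi_snoc phi_0)
  have "phi w (p - homog_part 1 p) = 0" for w
  proof -
    have d: "phi w (p - homog_part 1 p) = phi w p - phi w (homog_part 1 p)"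
      using phi_add[of w p "scale (-1) (homog_part 1 p)"] phi_scale[of w "-1"] by simp
    consider "w = []" | k where "w = [k]" | u k l where "w = (u @ [k]) @ [l]"
      by (metis append_Nil rev_exhaust)
    then show ?thesis
    proof cases
      case 1
      have "counit p = counit p + counit p"
        using *[of "[]" "[]"] by (simp only: append_Nil phi_Nil counit_1 mult_1_right mult_1_left)
      then have "counit p = 0" by (metis add_cancel_right_right)
      then show ?thesis using d 1 by (simp only: phi_Nil phi_homog_part) simp
    next
      case 2
      then show ?thesis using d by (simp add: phi_homog_part)
    next
      case 3
      then show ?thesis using d *[of "u @ [k]" "[l]"] phi1[of u k] phi1[of "[]" l] by (simp add: phi_homog_part)
    qed
  qed
  then have "p - homog_part 1 p \<in> J" by (simp add: J_def)
  then show "p \<in> {v + p |v p. homog_part 1 v = v \<and> p \<in> J}"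
    by (intro CollectI exI[of _ "homog_part 1 p"] exI[of _ "p - homog_part 1 p"])
       (simp add: homog_part_homog_part)
next
  fix x assume "x \<in> {v + p |v p. homog_part 1 v = v \<and> p \<in> J}"
  then obtain v p where x: "x = v + p" "homog_part 1 v = v" "p \<in> J" by blast
  have "comult c x - (tens x 1 + tens 1 x) = comult c p - (tens p 1 + tens 1 p)"
    by (simp add: x(1) comult_simps comult_homog_1[OF x(2)] tens_add)
  also have "\<dots> \<in> K2"
    using x(3) by (intro fsupp.subspace_diff fsupp.subspace_add tens_kernel_subspace comult_J
        tens_kernel_left tens_kernel_right)
  finally show "x \<in> primitive_mod c J"
    by (simp add: primitive_mod_def unit_eq_1)
qed

lemma is_nichols_ideal_J: "is_nichols_ideal c J"
  by (auto simp: is_nichols_ideal_def graded_hopf_ideal_J primitive_mod_J homog_1_J_eq_0)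

text \<open>A Nichols ideal \<open>I\<close> has no degree-one part, so reading off a letter in the
  right factor annihilates the summand T(V) \<otimes> I; hence \<open>I\<close> is stable under all
  \<open>D k\<close> and lies in \<open>J\<close>. Conversely, for homogeneous \<open>p\<close> in
  \<open>J\<close> of degree above 1, induction puts the middle part of its comultiplication into
  \<open>tens_kernel I\<close>. Thus \<open>p\<close> is primitive modulo \<open>I\<close>, hence of
  degree one modulo \<open>I\<close>, hence in \<open>I\<close>.\<close>

lemma is_nichols_ideal_unique:
  assumes I: "is_nichols_ideal c I"
  shows "I = J"
proof
  have hopf: "graded_hopf_ideal c I" and h1: "\<And>p. p \<in> I \<Longrightarrow> homog_part 1 p = 0"
    and pr: "primitive_mod c I = {v + p |v p. homog_part 1 v = v \<and> p \<in> I}"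
    using I by (simp_all add: is_nichols_ideal_def)
  have gr: "graded_ideal I" and cm: "\<And>p. p \<in> I \<Longrightarrow> comult c p \<in> tens_kernel I"
    and cu: "\<And>p. p \<in> I \<Longrightarrow> counit p = 0"
    using hopf unfolding graded_hopf_ideal_def by blast+
  have sub: "fsupp.subspace I" and hp: "\<And>p n. p \<in> I \<Longrightarrow> homog_part n p \<in> I"
    using gr by (simp_all add: graded_ideal_def)
  have DI: "D k p \<in> I" if "p \<in> I" for k p
  proof -
    have "rcontract (\<lambda>q. Poly_Mapping.lookup q [k]) (comult c p) \<in> I"
    proof (rule tens_kernel_lin_image[OF lin_rcontract sub cm[OF that]])
      show "rcontract (\<lambda>q. Poly_Mapping.lookup q [k]) (tens p q) \<in> I" if "p \<in> I" for p q :: "('i, 'k) tensor_alg"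
        using that sub by (simp add: rcontract_tens functional_lookup fsupp.subspace_scale)
      show "rcontract (\<lambda>q. Poly_Mapping.lookup q [k]) (tens p q) \<in> I" if "q \<in> I" for p q :: "('i, 'k) tensor_alg"
        using h1[OF that] lookup_homog_part[of 1 q "[k]"] sub
        by (simp add: rcontract_tens functional_lookup fsupp.subspace_0)
    qed
    then show ?thesis by (simp add: rcontract_gen_comult)
  qed
  have "phi w p = 0" if "p \<in> I" for w p
    using that by (induction w arbitrary: p rule: rev_induct) (simp_all add: phi_Nil phi_snoc cu DI)
  then show "I \<subseteq> J" by (auto simp: J_def)
  have homog: "p \<in> I" if "p \<in> J" "homog_part n p = p" for n p
    using that
  proof (induction n arbitrary: p rule: less_induct)
    case (less n)
    show ?case
    proof (cases "n \<le> 1")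
      case True
      then show ?thesis using homog_1_J_eq_0[OF less.prems(1) True] less.prems(2) sub
        by (simp add: fsupp.subspace_0)
    next
      case False
      let ?f = "filt (\<lambda>w :: 'i list. 0 < length w \<and> length w < n)"
      have "?f a \<in> I" if "a \<in> J" for a
      proof (rule filt_mem[OF sub])
        fix m assume "0 < m \<and> m < n"
        then show "homog_part m a \<in> I"
          using less.IH[of m "homog_part m a"] J_homog_part[OF that] by (simp add: homog_part_homog_part)
      qed
      then have "tens_map ?f ?f (comult c p) \<in> tens_kernel I"
        using tens_kernel_map[OF lin_filt _ comult_J[OF less.prems(1)]] by blast
      then have "p \<in> primitive_mod c I"
        by (simp only: primitive_mod_def unit_eq_1 mem_Collect_eq
            comult_homog_middle[OF less.prems(2) J_counit[OF less.prems(1)]])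
      then obtain v q where vq: "p = v + q" "homog_part 1 v = v" "q \<in> I"
        unfolding pr by blast
      have "homog_part n v = 0"
        using False vq(2) homog_part_homog_part[of n 1 v] by simp
      then have "p = homog_part n q"
        using less.prems(2) vq(1) by (simp add: homog_part_simps)
      then show ?thesis using hp[OF vq(3), of n] by simp
    qed
  qed
  show "J \<subseteq> I"
  proof
    fix p assume p: "p \<in> J"
    show "p \<in> I"
    proof (rule mem_if_homog_parts[OF sub])
      fix n
      have "homog_part n (homog_part n p) = homog_part n p" by (simp add: homog_part_homog_part)
      from homog[OF J_homog_part[OF p] this] show "homog_part n p \<in> I" .
    qed
  qed
qed

theorem nichols_ideal_eq: "nichols_ideal c = J"
  unfolding nichols_ideal_def
  using is_nichols_ideal_J is_nichols_ideal_unique by (rule the_equality)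

end

section \<open>Finite-dimensional subspaces modulo the Nichols ideal\<close>

context yd_braiding
begin

definition fin_mod_J :: "('i, 'k) tensor_alg set \<Rightarrow> bool"
  where "fin_mod_J A \<longleftrightarrow> (\<exists>B. finite B \<and> A \<subseteq> fsupp.span (B \<union> J))"

text \<open>The generated subalgebra together with \<open>J\<close>, so that relations can be used
  as equalities. Having only left multiplication by generators as a rule shortens the inductions;
  closure under products is \<open>Alg_mult\<close>.\<close>

inductive_set Alg :: "('i, 'k) tensor_alg set \<Rightarrow> ('i, 'k) tensor_alg set" for Y where
  one: "1 \<in> Alg Y"
| ideal: "p \<in> J \<Longrightarrow> p \<in> Alg Y"
| add: "p \<in> Alg Y \<Longrightarrow> q \<in> Alg Y \<Longrightarrow> p + q \<in> Alg Y"
| scale: "p \<in> Alg Y \<Longrightarrow> scale r p \<in> Alg Y"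
| mult_left: "y \<in> Y \<Longrightarrow> p \<in> Alg Y \<Longrightarrow> y * p \<in> Alg Y"

lemma Alg_subspace: "fsupp.subspace (Alg Y)"
  by (simp add: fsupp.subspace_def Alg.add Alg.scale Alg.ideal J_0)

lemma Alg_base: "y \<in> Y \<Longrightarrow> y \<in> Alg Y"
  using Alg.mult_left[OF _ Alg.one] by fastforce

lemma Alg_mono: assumes "Y \<subseteq> Alg Z" "p \<in> Alg Y" "\<And>y p. y \<in> Y \<Longrightarrow> p \<in> Alg Z \<Longrightarrow> y * p \<in> Alg Z"
  shows "p \<in> Alg Z"
  using assms(2) by induction (auto intro: Alg.intros assms(3))

lemma Alg_mult: "p \<in> Alg Y \<Longrightarrow> q \<in> Alg Y \<Longrightarrow> p * q \<in> Alg Y"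
  by (induction rule: Alg.induct)
     (auto simp: distrib_right scale_mult mult.assoc intro: Alg.intros J_mult_right)

lemma Alg_subset: "Y \<subseteq> Alg Z \<Longrightarrow> Alg Y \<subseteq> Alg Z"
  using Alg_mono Alg_mult by blast

lemma fin_mod_J_subset: "fin_mod_J A \<Longrightarrow> B \<subseteq> A \<Longrightarrow> fin_mod_J B"
  unfolding fin_mod_J_def by blast

lemma fin_mod_J_Alg_empty: "fin_mod_J (Alg {})"
proof -
  have "p \<in> fsupp.span ({1} \<union> J)" if "p \<in> Alg {}" for p
    using that by induction (auto intro: fsupp.span_base fsupp.span_add fsupp.span_scale)
  then show ?thesis unfolding fin_mod_J_def by blast
qed

text \<open>An Ore-type condition modulo \<open>J\<close>: moving \<open>a\<close> to the right
  across \<open>p\<close> costs only a change of \<open>p\<close> and a remainder free of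
  \<open>a\<close>.\<close>

definition moves_past :: "('i, 'k) tensor_alg \<Rightarrow> ('i, 'k) tensor_alg set \<Rightarrow> ('i, 'k) tensor_alg \<Rightarrow> bool"
  where "moves_past a A p \<longleftrightarrow> (\<exists>p1\<in>A. \<exists>p2\<in>A. a * p - (p1 * a + p2) \<in> J)"

lemma moves_past_I: "p1 \<in> A \<Longrightarrow> p2 \<in> A \<Longrightarrow> a * p - (p1 * a + p2) \<in> J \<Longrightarrow> moves_past a A p"
  unfolding moves_past_def by blast

text \<open>The condition passes to products: \<open>a\<close> moves first past \<open>y\<close> and
  then past \<open>p\<close>, the remainders being y1 p2 and y2 p.\<close>

lemma moves_past_Alg:
  assumes "\<And>y. y \<in> Y \<Longrightarrow> moves_past a (Alg Z) y" "Y \<subseteq> Alg Z" "p \<in> Alg Y"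
  shows "moves_past a (Alg Z) p"
  using assms(3)
proof induction
  case one
  show ?case by (rule moves_past_I[of 1 _ 0]) (simp_all add: Alg.one Alg.ideal J_0)
next
  case (ideal p)
  then show ?case
    by (intro moves_past_I[of 0 _ 0]) (simp_all add: Alg.ideal J_0 J_mult_left)
next
  case (add p q)
  then obtain p1 p2 q1 q2 where *: "p1 \<in> Alg Z" "p2 \<in> Alg Z" "q1 \<in> Alg Z" "q2 \<in> Alg Z"
    "a * p - (p1 * a + p2) \<in> J" "a * q - (q1 * a + q2) \<in> J"
    unfolding moves_past_def by blast
  have eq: "a * (p + q) - ((p1 + q1) * a + (p2 + q2)) = (a * p - (p1 * a + p2)) + (a * q - (q1 * a + q2))"
    by (simp add: algebra_simps)
  show ?case
    by (rule moves_past_I[of "p1 + q1" _ "p2 + q2"]; (unfold eq)?; intro Alg.add J_add *)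
next
  case (scale p r)
  then obtain p1 p2 where *: "p1 \<in> Alg Z" "p2 \<in> Alg Z" "a * p - (p1 * a + p2) \<in> J"
    unfolding moves_past_def by blast
  have eq: "a * scale r p - (scale r p1 * a + scale r p2) = scale r (a * p - (p1 * a + p2))"
    by (simp add: scale_mult fsupp.scale_right_distrib fsupp.scale_right_diff_distrib)
  show ?case
    by (rule moves_past_I[of "scale r p1" _ "scale r p2"]; (unfold eq)?; intro Alg.scale J_scale *)
next
  case (mult_left y p)
  then obtain p1 p2 where p: "p1 \<in> Alg Z" "p2 \<in> Alg Z" "a * p - (p1 * a + p2) \<in> J"
    unfolding moves_past_def by blast
  obtain y1 y2 where y: "y1 \<in> Alg Z" "y2 \<in> Alg Z" "a * y - (y1 * a + y2) \<in> J"
    using assms(1)[OF mult_left(1)] unfolding moves_past_def by blast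
  have pZ: "p \<in> Alg Z" using mult_left(2) Alg_subset[OF assms(2)] by blast
  have eq: "a * (y * p) - (y1 * p1 * a + (y1 * p2 + y2 * p)) =
      (a * y - (y1 * a + y2)) * p + y1 * (a * p - (p1 * a + p2))"
    by (simp add: algebra_simps)
  show ?case
    by (rule moves_past_I[of "y1 * p1" _ "y1 * p2 + y2 * p"]; (unfold eq)?;
        intro Alg.add Alg_mult J_add J_mult_right[OF y(3)] J_mult_left[OF p(3)] p y pZ)
qed

text \<open>The sum of the spaces \<open>Alg Y\<close> times \<open>a ^ i\<close>, for i < N,
  together with \<open>J\<close>, contains 1 and is closed under left multiplication by
  \<open>Y\<close> and by \<open>a\<close>. Hence it contains the enlarged algebra, and it is
  spanned modulo \<open>J\<close> by the products of a finite spanning set with these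
  powers.\<close>

lemma fin_mod_J_Alg_insert:
  assumes fin: "fin_mod_J (Alg Y)" and past: "\<And>y. y \<in> Y \<Longrightarrow> moves_past a (Alg Y) y"
    and pow: "a ^ N \<in> J" "0 < N"
  shows "fin_mod_J (Alg (insert a Y))"
proof -
  obtain B where B: "finite B" "Alg Y \<subseteq> fsupp.span (B \<union> J)"
    using fin unfolding fin_mod_J_def by blast
  define gens where "gens = (\<Union>i<N. (\<lambda>p. p * a ^ i) ` Alg Y) \<union> J"
  define M where "M = fsupp.span gens"
  have M_base: "p * a ^ i \<in> M" if "p \<in> Alg Y" "i < N" for p i
    unfolding M_def gens_def using that by (intro fsupp.span_base) auto
  have M_J: "p \<in> M" if "p \<in> J" for p
    unfolding M_def gens_def using that by (intro fsupp.span_base) auto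
  have closed: "f p \<in> M" if "p \<in> M" "lin f" "\<And>p. p \<in> gens \<Longrightarrow> f p \<in> M" for f :: "('i, 'k) tensor_alg \<Rightarrow> _" and p
    using that(1) unfolding M_def
  proof (induction rule: fsupp.span_induct)
    case base
    show ?case
      by (simp add: fsupp.subspace_def lin_0[OF that(2)] lin_add[OF that(2)] lin_scale[OF that(2)]
          fsupp.span_zero fsupp.span_add fsupp.span_scale)
  next
    case (step p)
    then show ?case using that(3) by (simp add: M_def)
  qed
  have closed_Y: "y * p \<in> M" if "p \<in> M" "y \<in> Y" for y p
  proof (rule closed[OF that(1) lin_mult2])
    fix p assume "p \<in> gens"
    then consider "p \<in> J" | p' i where "p = p' * a ^ i" "i < N" "p' \<in> Alg Y"
      unfolding gens_def by auto
    then show "y * p \<in> M"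
    proof cases
      case 1
      then show ?thesis by (intro M_J J_mult_left)
    next
      case 2
      then show ?thesis using M_base[OF Alg.mult_left[OF that(2) 2(3)] 2(2)] by (simp add: mult.assoc)
    qed
  qed
  have closed_a: "a * p \<in> M" if "p \<in> M" for p
  proof (rule closed[OF that lin_mult2])
    fix p assume "p \<in> gens"
    then consider "p \<in> J" | p' i where "p = p' * a ^ i" "i < N" "p' \<in> Alg Y"
      unfolding gens_def by auto
    then show "a * p \<in> M"
    proof cases
      case 1
      then show ?thesis by (intro M_J J_mult_left)
    next
      case 2
      obtain p1 p2 where *: "p1 \<in> Alg Y" "p2 \<in> Alg Y" "a * p' - (p1 * a + p2) \<in> J"
        using moves_past_Alg[OF past _ 2(3)] Alg_base unfolding moves_past_def by blast
      have eq: "a * p = (a * p' - (p1 * a + p2)) * a ^ i + (p1 * a ^ Suc i + p2 * a ^ i)"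
        by (simp add: 2(1) algebra_simps)
      \<comment> \<open>The only exponent leaving the range is \<open>N\<close> itself, and
        \<open>a ^ N\<close> lies in \<open>J\<close>.\<close>
      have "p1 * a ^ Suc i \<in> M"
      proof (cases "Suc i < N")
        case True
        then show ?thesis by (intro M_base *)
      next
        case False
        then have "Suc i = N" using 2(2) by simp
        then show ?thesis using pow(1) by (intro M_J J_mult_left) simp
      qed
      then show ?thesis
        unfolding eq using M_base[OF *(2) 2(2)] M_J[OF J_mult_right[OF *(3)]]
        by (simp add: M_def fsupp.span_add)
    qed
  qed
  have "p \<in> M" if "p \<in> Alg (insert a Y)" for p
    using that
  proof induction
    case one
    show ?case using M_base[OF Alg.one pow(2)] by simp
  next
    case (mult_left y p)
    then show ?case using closed_a closed_Y by blast
  qed (use M_J in \<open>auto simp: M_def fsupp.span_add fsupp.span_scale\<close>)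
  moreover have "M \<subseteq> fsupp.span ((\<Union>i<N. (\<lambda>b. b * a ^ i) ` B) \<union> J)" (is "_ \<subseteq> ?R")
  proof -
    have "p * a ^ i \<in> ?R" if "p \<in> Alg Y" "i < N" for p i
    proof -
      have "p \<in> fsupp.span (B \<union> J)" using B that by blast
      then show ?thesis
      proof (induction rule: fsupp.span_induct)
        case base
        show ?case
          by (simp add: fsupp.subspace_def distrib_right scale_mult fsupp.span_zero fsupp.span_add fsupp.span_scale)
      next
        case (step b)
        then show ?case using that(2) by (intro fsupp.span_base) (auto intro: J_mult_right)
      qed
    qed
    then have "gens \<subseteq> ?R" unfolding gens_def by (auto intro: fsupp.span_base)
    then show ?thesis unfolding M_def by (simp add: fsupp.span_minimal)
  qed
  ultimately show ?thesis
    unfolding fin_mod_J_def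
    by (intro exI[of _ "\<Union>i<N. (\<lambda>b. b * a ^ i) ` B"]) (use B(1) in auto)
qed

lemma moves_past_mono: "moves_past a A p \<Longrightarrow> A \<subseteq> B \<Longrightarrow> moves_past a B p"
  unfolding moves_past_def by blast

lemma moves_past_qcommute:
  "a * y - scale r (y * a) \<in> J \<Longrightarrow> y \<in> A \<Longrightarrow> fsupp.subspace A \<Longrightarrow> moves_past a A y"
  by (rule moves_past_I[of "scale r y" _ 0])
     (simp_all add: fsupp.subspace_scale fsupp.subspace_0 scale_mult)

lemma fin_mod_J_Alg_union:
  assumes "fin_mod_J (Alg Z)" "finite Y"
    and "\<And>a z. a \<in> Y \<Longrightarrow> z \<in> Z \<Longrightarrow> moves_past a (Alg Z) z"
    and "\<And>a y. a \<in> Y \<Longrightarrow> y \<in> Y \<Longrightarrow> \<exists>r. a * y - scale r (y * a) \<in> J"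
    and "\<And>a. a \<in> Y \<Longrightarrow> a ^ N \<in> J" "0 < N"
  shows "fin_mod_J (Alg (Y \<union> Z))"
  using assms(2-5)
proof (induction rule: finite_induct)
  case (insert a Y)
  have "moves_past a (Alg (Y \<union> Z)) y" if "y \<in> Y \<union> Z" for y
  proof (cases "y \<in> Z")
    case True
    then show ?thesis
      using insert.prems(1)[of a y] by (auto intro: moves_past_mono Alg_subset[THEN subsetD] Alg_base)
  next
    case False
    then have "y \<in> insert a Y" using that by blast
    then obtain r where "a * y - scale r (y * a) \<in> J"
      using insert.prems(2)[of a y] by blast
    then show ?thesis by (rule moves_past_qcommute[OF _ Alg_base[OF that] Alg_subspace])
  qed
  moreover have "fin_mod_J (Alg (Y \<union> Z))" using insert by blast
  ultimately show ?case
    using fin_mod_J_Alg_insert[of "Y \<union> Z" a N] insert.prems(3)[of a] assms(6) by simp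
qed (simp add: assms(1))

text \<open>\<open>N\<close> is chosen above the lengths of all words occurring in a finite spanning
  set; \<open>J\<close> itself is closed under homogeneous parts.\<close>

lemma fin_mod_J_degree_bound:
  assumes "fin_mod_J A"
  shows "\<exists>N. \<forall>p\<in>A. \<forall>n\<ge>N. homog_part n p \<in> J"
proof -
  obtain B where B: "finite B" "A \<subseteq> fsupp.span (B \<union> J)"
    using assms unfolding fin_mod_J_def by blast
  have "finite (length ` (\<Union>b\<in>B. Poly_Mapping.keys b))" using B(1) by simp
  then obtain N where N: "\<forall>n \<in> length ` (\<Union>b\<in>B. Poly_Mapping.keys b). n < N"
    unfolding finite_nat_set_iff_bounded by (rule exE)
  have "homog_part n p \<in> J" if "p \<in> fsupp.span (B \<union> J)" "N \<le> n" for p n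
    using that(1)
  proof (induction rule: fsupp.span_induct)
    case base
    show ?case by (simp add: fsupp.subspace_def homog_part_simps J_0 J_add J_scale)
  next
    case (step b)
    then show ?case
    proof
      assume b: "b \<in> B"
      have "homog_part n b = 0"
      proof (rule poly_mapping_eqI)
        fix w
        have "Poly_Mapping.lookup b w = 0" if "length w = n"
        proof (rule ccontr)
          assume "Poly_Mapping.lookup b w \<noteq> 0"
          then have "length w < N" using b N by (auto simp: in_keys_iff)
          then show False using \<open>N \<le> n\<close> that by simp
        qed
        then show "Poly_Mapping.lookup (homog_part n b) w = Poly_Mapping.lookup 0 w"
          by (simp add: lookup_homog_part)
      qed
      then show ?thesis by (simp add: J_0)
    qed (simp add: J_homog_part)
  qed
  then show ?thesis using B(2) by (intro exI[of _ N]) blast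
qed

lemma finite_dim_nichols_algebraI:
  assumes "fin_mod_J (Alg Y)" "\<And>i. gen i \<in> Alg Y"
  shows "finite_dim_nichols_algebra c"
proof -
  have "p \<in> Alg Y" for p
    by (induction p rule: tensor_alg_induct) (auto intro: Alg.intros Alg_mult assms(2))
  then have "Alg Y = UNIV" by blast
  then show ?thesis
    using assms(1) unfolding finite_dim_nichols_algebra_def finite_dim_quotient_def nichols_ideal_eq fin_mod_J_def
    by auto
qed

end

section \<open>Several blocks and a point\<close>

text \<open>
  \<open>w k\<close> and \<open>h k\<close> are the indices of the block \<open>k\<close>, \<open>th\<close> is the point. The group element attached to a
  letter of block \<open>u\<close> (or to the point, \<open>u = None\<close>) maps \<open>x\<^bsub>h l\<^esub>\<close> to a multiple of \<open>x\<^bsub>h l\<^esub> + B u l x\<^bsub>w l\<^esub>\<close>.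
\<close>

locale blocks_and_point =
  fixes c :: "('i::finite, 'k::field) braiding"
    and w h :: "'t::finite \<Rightarrow> 'i" and th :: 'i and blk :: "'i \<Rightarrow> 't option"
    and q :: "'t option \<Rightarrow> 't option \<Rightarrow> 'k" and B :: "'t option \<Rightarrow> 't \<Rightarrow> 'k"
  assumes char_2: "CHAR('k) = 2"
    and index_cases: "\<And>i. (\<exists>k. i = w k) \<or> (\<exists>k. i = h k) \<or> i = th"
    and blk: "blk (w k) = Some k" "blk (h k) = Some k" "blk th = None"
    and w_neq_h: "w k \<noteq> h l"
    and c_w: "c i (w l) = scale (q (blk i) (Some l)) (basis_vec (w l, i))"
    and c_h: "c i (h l) = scale (q (blk i) (Some l))
      (basis_vec (h l, i) + scale (B (blk i) l) (basis_vec (w l, i)))"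
    and c_th: "c i th = scale (q (blk i) None) (basis_vec (th, i))"
    and q_nonzero: "q u v \<noteq> 0"
    and q_diag: "q (Some k) (Some k) = 1"
    and q_swap: "u \<noteq> v \<Longrightarrow> q u v * q v u = 1"
    and B_off_diag: "k \<noteq> l \<Longrightarrow> B (Some k) l = 0"
begin

lemma distinct_index [simp]:
  "w k = w l \<longleftrightarrow> k = l" "h k = h l \<longleftrightarrow> k = l" "w k \<noteq> h l" "h k \<noteq> w l"
  "w k \<noteq> th" "h k \<noteq> th" "th \<noteq> w k" "th \<noteq> h k"
  using blk w_neq_h by (metis option.inject option.distinct(1))+

definition N :: "('t option \<Rightarrow> 'k) \<Rightarrow> ('t \<Rightarrow> 'k) \<Rightarrow> 'i \<Rightarrow> ('i \<Rightarrow>\<^sub>0 'k)" where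
  "N r b j = scale (r (blk j)) (basis_vec j +
     (if \<exists>l. j = h l then scale (b (the (blk j))) (basis_vec (w (the (blk j)))) else 0))"

lemma N [simp]:
  "N r b (w l) = scale (r (Some l)) (basis_vec (w l))"
  "N r b (h l) = scale (r (Some l)) (basis_vec (h l) + scale (b l) (basis_vec (w l)))"
  "N r b th = scale (r None) (basis_vec th)"
  by (simp_all add: N_def blk)

definition G :: "'i \<Rightarrow> 'i \<Rightarrow> ('i \<Rightarrow>\<^sub>0 'k)"
  where "G i = N (q (blk i)) (B (blk i))"

lemma index_induct: "(\<And>k. P (w k)) \<Longrightarrow> (\<And>k. P (h k)) \<Longrightarrow> P th \<Longrightarrow> P j"
  using index_cases by metis

text \<open>Scalars multiply and the unipotent entries add. Therefore all maps of this form commute,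
  and an inverse is found by inverting \<open>r\<close> and negating \<open>b\<close>.\<close>

lemma N_comp: "lin_ext (N r b) (N r' b' j) = N (\<lambda>u. r u * r' u) (\<lambda>l. b l + b' l) j"
  by (rule index_induct[of _ j])
     (simp_all add: lin_add[OF lin_lin_ext] lin_scale[OF lin_lin_ext] fsupp.scale_right_distrib fsupp.scale_left_distrib
       algebra_simps)

lemma N_1: "N (\<lambda>_. 1) (\<lambda>_. 0) j = basis_vec j"
  by (rule index_induct[of _ j]) simp_all

lemma N_graded: "Poly_Mapping.lookup (N r b j) m \<noteq> 0 \<Longrightarrow> blk m = blk j"
  by (rule index_induct[of "\<lambda>j. Poly_Mapping.lookup (N r b j) m \<noteq> 0 \<longrightarrow> blk m = blk j", THEN mp])
     (use blk in \<open>auto simp: lookup_scale lookup_add lookup_single when_def split: if_splits\<close>)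

end

sublocale blocks_and_point \<subseteq> yd_braiding c G
proof
  show "c i j = tens (G i j) (basis_vec i)" for i j
    by (rule index_induct[of _ j])
       (simp_all add: G_def tens_scale tens_add tens_basis c_w c_h c_th)
  show "G m = G j" if "Poly_Mapping.lookup (G i j) m \<noteq> 0" for i j m
    using N_graded that by (auto simp: G_def)
  show "lin_ext (G i) (G j m) = lin_ext (G j) (G i m)" for i j m
    by (simp add: G_def N_comp mult.commute add.commute)
  show "\<exists>H. \<forall>j. (\<forall>m. Poly_Mapping.lookup (H j) m \<noteq> 0 \<longrightarrow> G m = G j) \<and>
      lin_ext (G i) (H j) = basis_vec j \<and> lin_ext H (G i j) = basis_vec j" for i
    by (rule exI[of _ "N (\<lambda>u. inverse (q (blk i) u)) (\<lambda>l. - B (blk i) l)"])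
       (auto simp: G_def N_comp q_nonzero N_1 dest: N_graded)
qed

context blocks_and_point
begin

definition g :: "'t option \<Rightarrow> ('i, 'k) tensor_alg \<Rightarrow> ('i, 'k) tensor_alg"
  where "g v = act (N (q v) (B v))"

lemma act_G: "act (G i) = g (blk i)"
  by (simp add: g_def G_def)

abbreviation X where "X k \<equiv> (gen (w k) :: ('i, 'k) tensor_alg)"
abbreviation H where "H k \<equiv> (gen (h k) :: ('i, 'k) tensor_alg)"
abbreviation U where "U \<equiv> (gen th :: ('i, 'k) tensor_alg)"
definition Y where "Y k = H k * X k - X k * H k"

lemma two_eq_0: "(1::'k) + 1 = 0"
  using of_nat_CHAR[where 'a='k] char_2 by simp

lemma add_self: "p + p = (0 :: ('i, 'k) tensor_alg)" "r + r = (0 :: 'k)"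
proof -
  have "scale (1 + 1) p = scale 1 p + scale 1 p" by (rule fsupp.scale_left_distrib)
  then show "p + p = 0" unfolding two_eq_0 by simp
  have "r + r = (1 + 1) * r" by (simp only: distrib_right mult_1_left)
  then show "r + r = 0" unfolding two_eq_0 by simp
qed

lemma add_self_left: "p + (p + p') = (p' :: ('i, 'k) tensor_alg)" "r + (r + r') = (r' :: 'k)"
  by (simp_all add: add.assoc[symmetric] add_self)

lemma minus_eq: "- p = (p :: ('i, 'k) tensor_alg)" "- r = (r :: 'k)"
  using add_self by (metis add_eq_0_iff)+

lemma diff_eq: "p - p' = (p + p' :: ('i, 'k) tensor_alg)" "r - r' = (r + r' :: 'k)"
  using minus_eq by (metis add_uminus_conv_diff)+

text \<open>
  In characteristic 2 these rules cancel equal summands, since ordered rewriting makes them adjacent.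
\<close>

lemmas nf = diff_eq minus_eq add_self add_self_left distrib_left distrib_right fsupp.scale_right_distrib fsupp.scale_left_distrib
  scale_mult mult.assoc add.assoc add.commute add.left_commute mult.commute[where 'a='k] mult.left_commute[where 'a='k]

lemma g_mult: "g v (p * p') = g v p * g v p'"
  and g_add: "g v (p + p') = g v p + g v p'"
  and g_diff: "g v (p - p') = g v p - g v p'"
  and g_scale: "g v (scale r p) = scale r (g v p)"
  and g_1: "g v 1 = 1" and g_0: "g v 0 = 0"
  by (simp_all add: g_def act_mult act_simps)

lemma g_gen:
  "g v (X l) = scale (q v (Some l)) (X l)"
  "g v (H l) = scale (q v (Some l)) (H l + scale (B v l) (X l))"
  "g v U = scale (q v None) U"
  by (simp_all add: g_def emb_simps)

lemma g_Y: "g v (Y l) = scale (q v (Some l) * q v (Some l)) (Y l)"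
  by (simp add: Y_def g_diff g_add g_mult g_gen nf)

lemma D_mult': "D i (p * p') = p * D i p' + D i p * g (blk i) p'"
  by (simp add: D_mult act_G)

lemmas g_simps = g_mult g_add g_diff g_scale g_1 g_0 g_gen g_Y
lemmas D_calc = D_simps D_mult' D_gen g_simps blk

text \<open>For k = l the derivative by \<open>w k\<close> is H k - g (H k), in which only the
  unipotent entry of the block remains. The two terms of the derivative by \<open>h k\<close> cancel
  because \<open>q_diag\<close> makes g fix X k.\<close>

lemma D_Y: "D (w k) (Y l) = (if k = l then scale (B (Some k) k) (X k) else 0)"
  "D (h k) (Y l) = 0" "D th (Y l) = 0"
  by (auto simp: Y_def D_calc nf q_diag)

lemma counit_Y [simp]: "counit (Y k) = 0"
  by (simp add: Y_def)

lemma q_swap': "k \<noteq> l \<Longrightarrow> q (Some k) (Some l) * q (Some l) (Some k) = 1" "q None (Some k) * q (Some k) None = 1"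
   "q (Some k) None * q None (Some k) = 1"
  by (simp_all add: q_swap)

lemma J_I': "counit p = 0 \<Longrightarrow> (\<And>k. D (w k) p \<in> J) \<Longrightarrow> (\<And>k. D (h k) p \<in> J) \<Longrightarrow> D th p \<in> J \<Longrightarrow> p \<in> J"
  by (rule J_I) (auto intro: index_induct[of "\<lambda>k. D k p \<in> J"])

section \<open>Relations inside a block and between blocks\<close>

lemma X_X: "X k * X l - scale (q (Some k) (Some l)) (X l * X k) \<in> J"
  by (rule J_I'; cases "k = l") (auto simp: D_calc nf J_0 q_diag q_swap')

lemma X_sq: "X k * X k \<in> J"
  by (rule J_I') (auto simp: D_calc nf J_0 q_diag)

lemma H_X: "k \<noteq> l \<Longrightarrow> H k * X l - scale (q (Some k) (Some l)) (X l * H k) \<in> J"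
  by (rule J_I') (auto simp: D_calc nf J_0 q_diag q_swap' B_off_diag)

lemma H_H: "k \<noteq> l \<Longrightarrow> H k * H l - scale (q (Some k) (Some l)) (H l * H k) \<in> J"
  by (rule J_I') (auto simp: D_calc nf J_0 q_diag q_swap' B_off_diag)

lemma X_Y_same: "X k * Y k - Y k * X k \<in> J"
  by (rule J_I') (auto simp: D_calc nf J_0 q_diag D_Y Y_def)

lemma H_Y_same: "H k * Y k - (Y k * H k + scale (B (Some k) k) (X k * Y k)) \<in> J"
  by (rule J_I') (auto simp: D_calc nf J_0 J_scale J_add X_sq q_diag D_Y Y_def)

lemma X_H: "k \<noteq> l \<Longrightarrow> X k * H l - scale (q (Some k) (Some l)) (H l * X k) \<in> J"
  by (rule J_I') (auto simp: D_calc nf J_0 q_diag q_swap' B_off_diag)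

text \<open>The only nonzero derivative is a multiple of Y X + X Y, which in characteristic 2 is the
  commutator of \<open>X_Y_same\<close>.\<close>

lemma Y_sq: "Y k * Y k \<in> J"
proof (rule J_I')
  show "D (w l) (Y k * Y k) \<in> J" for l
    using J_scale[OF X_Y_same[of k], of "B (Some k) k"]
    by (cases "l = k") (simp_all add: D_calc nf J_0 q_diag D_Y)
qed (simp_all add: D_calc D_Y J_0)

text \<open>With g h = h + B x, the derivative of h^4 is h^3 + h^2 (g h) + h (g h)^2 + (g h)^3. In
  characteristic 2 it becomes B(h^2 x + x h^2) + B^2(x h x + x^2 h) + B^3 x^3, which is exactly the
  combination of \<open>H_Y_same\<close> and x^3 written below.\<close>

lemma H_power: "H k ^ 4 \<in> J"
proof -
  have "scale (B (Some k) k) (H k * Y k - (Y k * H k + scale (B (Some k) k) (X k * Y k))) +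
      scale (B (Some k) k * (B (Some k) k * B (Some k) k)) (X k * (X k * X k)) \<in> J"
    by (intro J_add J_scale H_Y_same J_mult_left X_sq)
  then have "D (h k) (H k * (H k * (H k * H k))) \<in> J"
    by (simp add: D_calc nf q_diag Y_def)
  then have "D (h l) (H k * (H k * (H k * H k))) \<in> J" for l
    by (cases "l = k") (simp_all add: D_calc J_0)
  then have "H k * (H k * (H k * H k)) \<in> J"
    by (rule J_I'[rotated 2]) (simp_all add: D_calc J_0)
  then show ?thesis by (simp add: eval_nat_numeral mult.assoc)
qed

definition qcomm :: "'k \<Rightarrow> ('i, 'k) tensor_alg \<Rightarrow> ('i, 'k) tensor_alg \<Rightarrow> bool"
  where "qcomm r p p' \<longleftrightarrow> p * p' - scale r (p' * p) \<in> J"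

lemma qcomm_mult_right:
  assumes "qcomm r a p" "qcomm r' a p'"
  shows "qcomm (r * r') a (p * p')"
proof -
  have "a * (p * p') - scale (r * r') (p * p' * a) =
      (a * p - scale r (p * a)) * p' + scale r (p * (a * p' - scale r' (p' * a)))"
    by (simp add: nf)
  then show ?thesis using assms unfolding qcomm_def by (simp only: J_add J_scale J_mult_left J_mult_right)
qed

lemma qcomm_mult_left:
  assumes "qcomm r p a" "qcomm r' p' a"
  shows "qcomm (r * r') (p * p') a"
proof -
  have "p * p' * a - scale (r * r') (a * (p * p')) =
      p * (p' * a - scale r' (a * p')) + scale r' ((p * a - scale r (a * p)) * p')"
    by (simp add: nf)
  then show ?thesis using assms unfolding qcomm_def by (simp only: J_add J_scale J_mult_left J_mult_right)
qed

lemma qcomm_diff_right: "qcomm r a p \<Longrightarrow> qcomm r a p' \<Longrightarrow> qcomm r a (p - p')"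
  and qcomm_diff_left: "qcomm r p a \<Longrightarrow> qcomm r p' a \<Longrightarrow> qcomm r (p - p') a"
  unfolding qcomm_def
  by (drule (1) J_add, simp add: nf)+

lemma qcomm_X_X: "qcomm (q (Some k) (Some l)) (X k) (X l)"
  by (simp add: qcomm_def X_X)

lemma qcomm_X_Y: "qcomm (q (Some k) (Some l) * q (Some k) (Some l)) (X k) (Y l)"
proof (cases "k = l")
  case True
  then show ?thesis using X_Y_same by (simp add: qcomm_def q_diag)
next
  case False
  then have "qcomm (q (Some k) (Some l)) (X k) (H l)" by (simp add: qcomm_def X_H)
  then show ?thesis
    unfolding Y_def by (intro qcomm_diff_right qcomm_mult_right qcomm_X_X)
qed

lemma qcomm_H_Y:
  assumes "k \<noteq> l"
  shows "qcomm (q (Some k) (Some l) * q (Some k) (Some l)) (H k) (Y l)"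
proof -
  have "qcomm (q (Some k) (Some l)) (H k) (H l)" "qcomm (q (Some k) (Some l)) (H k) (X l)"
    using assms by (simp_all add: qcomm_def H_H H_X)
  then show ?thesis
    unfolding Y_def by (intro qcomm_diff_right qcomm_mult_right)
qed

lemma qcomm_Y_X: "\<exists>r. qcomm r (Y k) (X l)"
proof (cases "k = l")
  case True
  then show ?thesis using X_Y_same[of k] by (intro exI[of _ 1]) (simp add: qcomm_def nf)
next
  case False
  then have "qcomm (q (Some k) (Some l)) (H k) (X l)" by (simp add: qcomm_def H_X)
  then have "qcomm (q (Some k) (Some l) * q (Some k) (Some l)) (Y k) (X l)"
    unfolding Y_def by (intro qcomm_diff_left qcomm_mult_left qcomm_X_X)
  then show ?thesis ..
qed

lemma qcomm_Y_Y: "\<exists>r. qcomm r (Y k) (Y l)"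
proof (cases "k = l")
  case True
  then show ?thesis by (intro exI[of _ 1]) (simp add: qcomm_def J_0)
next
  case False
  note qcomm_mult_left[OF qcomm_H_Y[OF False] qcomm_X_Y] qcomm_mult_left[OF qcomm_X_Y qcomm_H_Y[OF False]]
  from qcomm_diff_left[OF this] show ?thesis by (auto simp: Y_def)
qed

lemma H_X_E: "H k * X l - scale (q (Some k) (Some l)) (X l * H k) - (if k = l then Y k else 0) \<in> J"
  using H_X[of k l] by (cases "k = l") (simp_all add: Y_def q_diag J_0)

lemma H_Y_E: "H k * Y l - scale (q (Some k) (Some l) * q (Some k) (Some l)) (Y l * H k) -
    (if k = l then scale (B (Some k) k) (X k * Y k) else 0) \<in> J"
  using qcomm_H_Y[of k l] H_Y_same[of k] by (cases "k = l") (simp_all add: qcomm_def q_diag diff_diff_eq)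

definition q_prod :: "'t option \<Rightarrow> 't multiset \<Rightarrow> 'k"
  where "q_prod v M = (\<Prod>l\<in>#M. q v (Some l))"

lemma q_prod_simps [simp]: "q_prod v {#} = 1" "q_prod v (add_mset k M) = q v (Some k) * q_prod v M"
  by (simp_all add: q_prod_def)

lemma q_prod_nonzero: "q_prod v M \<noteq> 0"
  by (induction M) (simp_all add: q_nonzero)

text \<open>
  Homogeneous elements, modulo \<open>J\<close>, of the algebra generated by the \<open>X k\<close> and \<open>Y k\<close>. The degree is a
  multiset of blocks, \<open>X k\<close> having degree \<open>{k}\<close> and \<open>Y k\<close> degree \<open>{k, k}\<close>.
\<close>

inductive xy_homog :: "'t multiset \<Rightarrow> ('i, 'k) tensor_alg \<Rightarrow> bool" where
  ideal: "p \<in> J \<Longrightarrow> xy_homog M p"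
| one: "xy_homog {#} 1"
| add: "xy_homog M p \<Longrightarrow> xy_homog M p' \<Longrightarrow> xy_homog M (p + p')"
| scale: "xy_homog M p \<Longrightarrow> xy_homog M (scale r p)"
| X: "xy_homog M p \<Longrightarrow> xy_homog (add_mset k M) (X k * p)"
| Y: "xy_homog M p \<Longrightarrow> xy_homog (add_mset k (add_mset k M)) (Y k * p)"

lemma xy_homog_diff: "xy_homog M p \<Longrightarrow> xy_homog M p' \<Longrightarrow> xy_homog M (p - p')"
  using xy_homog.add[of M p p'] by (simp add: diff_eq)

lemma xy_homog_Alg: "xy_homog M p \<Longrightarrow> p \<in> Alg (range X \<union> range Y)"
  by (induction rule: xy_homog.induct) (auto intro: Alg.intros)

lemma qcomm_J: "p \<in> J \<Longrightarrow> qcomm r a p" "p \<in> J \<Longrightarrow> qcomm r p a"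
  by (simp_all add: qcomm_def J_diff J_scale J_mult_left J_mult_right)

lemma qcomm_add_right: "qcomm r a p \<Longrightarrow> qcomm r a p' \<Longrightarrow> qcomm r a (p + p')"
  and qcomm_add_left: "qcomm r p a \<Longrightarrow> qcomm r p' a \<Longrightarrow> qcomm r (p + p') a"
  using qcomm_diff_right qcomm_diff_left by (simp_all add: diff_eq)

lemma qcomm_scale_right: "qcomm r a p \<Longrightarrow> qcomm r a (scale r' p)"
  and qcomm_scale_left: "qcomm r p a \<Longrightarrow> qcomm r (scale r' p) a"
  unfolding qcomm_def by (drule J_scale[of _ r'], simp add: nf)+

lemma qcomm_1: "qcomm 1 a 1" "qcomm 1 1 a"
  by (simp_all add: qcomm_def J_0)

lemma xy_homog_X_commute: "xy_homog M p \<Longrightarrow> qcomm (q_prod (Some k) M) (X k) p"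
proof (induction rule: xy_homog.induct)
  case (X M p l)
  from qcomm_mult_right[OF qcomm_X_X X.IH] show ?case by simp
next
  case (Y M p l)
  from qcomm_mult_right[OF qcomm_X_Y Y.IH, of l] show ?case by (simp add: mult.assoc)
qed (auto intro: qcomm_J qcomm_add_right qcomm_scale_right qcomm_1)

lemma xy_homog_mult_X:
  assumes "xy_homog M p"
  shows "xy_homog (add_mset k M) (p * X k)"
proof -
  let ?r = "q_prod (Some k) M"
  have "p * X k = scale (inverse ?r) (X k * p - (X k * p - scale ?r (p * X k)))"
    by (simp add: q_prod_nonzero)
  moreover have "xy_homog (add_mset k M) \<dots>"
    using xy_homog_X_commute[OF assms, of k]
    by (intro xy_homog.scale xy_homog_diff xy_homog.X assms xy_homog.ideal) (simp add: qcomm_def)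
  ultimately show ?thesis by simp
qed

text \<open>The skew commutator with \<open>H k\<close> is a skew derivation; modulo
  \<open>J\<close> it sends \<open>X k\<close> to \<open>Y k\<close>, \<open>Y k\<close> to a
  multiple of \<open>X k * Y k\<close>, and the generators of other blocks to 0. Each of these
  raises the degree by \<open>k\<close>.\<close>

lemma xy_homog_H_commutator: "xy_homog M p \<Longrightarrow> xy_homog (add_mset k M) (H k * p - scale (q_prod (Some k) M) (p * H k))"
proof (induction rule: xy_homog.induct)
  case (ideal p M)
  then show ?case by (intro xy_homog.ideal J_diff J_scale J_mult_left J_mult_right)
next
  case one
  show ?case by (simp add: xy_homog.ideal J_0)
next
  case (add M p p')
  from xy_homog.add[OF add.IH] show ?case by (simp add: nf)
next
  case (scale M p r)
  from xy_homog.scale[OF scale.IH, of r] show ?case by (simp add: nf)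
next
  case (X M p l)
  let ?E = "H k * X l - scale (q (Some k) (Some l)) (X l * H k) - (if k = l then Y k else 0)"
  let ?p' = "H k * p - scale (q_prod (Some k) M) (p * H k)"
  have "H k * (X l * p) - scale (q_prod (Some k) (add_mset l M)) (X l * p * H k) =
      ?E * p + ((if k = l then Y k * p else 0) + scale (q (Some k) (Some l)) (X l * ?p'))"
    by (simp add: nf)
  moreover have "xy_homog (add_mset k (add_mset l M)) (if k = l then Y k * p else 0)"
    by (simp add: xy_homog.Y X.hyps xy_homog.ideal J_0)
  moreover have "xy_homog (add_mset k (add_mset l M)) (X l * ?p')"
    using xy_homog.X[OF X.IH, of l] by (simp only: add_mset_commute)
  ultimately show ?case
    by (simp only: xy_homog.add xy_homog.scale xy_homog.ideal J_mult_right H_X_E)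
next
  case (Y M p l)
  let ?r = "q (Some k) (Some l) * q (Some k) (Some l)"
  let ?E = "H k * Y l - scale ?r (Y l * H k) - (if k = l then scale (B (Some k) k) (X k * Y k) else 0)"
  let ?p' = "H k * p - scale (q_prod (Some k) M) (p * H k)"
  have "H k * (Y l * p) - scale (q_prod (Some k) (add_mset l (add_mset l M))) (Y l * p * H k) =
      ?E * p + ((if k = l then scale (B (Some k) k) (X k * (Y k * p)) else 0) + scale ?r (Y l * ?p'))"
    by (simp add: nf)
  moreover have "xy_homog (add_mset k (add_mset l (add_mset l M))) (if k = l then scale (B (Some k) k) (X k * (Y k * p)) else 0)"
    by (simp add: xy_homog.X xy_homog.Y xy_homog.scale Y.hyps xy_homog.ideal J_0)
  moreover have "xy_homog (add_mset k (add_mset l (add_mset l M))) (Y l * ?p')"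
    using xy_homog.Y[OF Y.IH, of l] by (simp only: add_mset_commute)
  ultimately show ?case
    by (simp only: xy_homog.add xy_homog.scale xy_homog.ideal J_mult_right H_Y_E)
qed

lemma xy_homog_commute:
  assumes "\<And>k. qcomm (r k) (X k) z" "\<And>k. qcomm (r k * r k) (Y k) z" "xy_homog M p"
  shows "qcomm (\<Prod>k\<in>#M. r k) p z"
  using assms(3)
proof (induction rule: xy_homog.induct)
  case (X M p l)
  from qcomm_mult_left[OF assms(1) X.IH] show ?case by simp
next
  case (Y M p l)
  from qcomm_mult_left[OF assms(2) Y.IH, of l] show ?case by (simp add: mult.assoc)
qed (auto intro: qcomm_J qcomm_add_left qcomm_scale_left qcomm_1)

section \<open>Root vectors: images of the point under the blocks\<close>

definition wt :: "'t option \<Rightarrow> 't multiset \<Rightarrow> 'k"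
  where "wt v M = q v None * q_prod v M"

lemma wt_simps [simp]: "wt v {#} = q v None" "wt v (add_mset k M) = q v (Some k) * wt v M"
  by (simp_all add: wt_def)

text \<open>The point contributes q(k, \<theta>) q(\<theta>, k) = 1, so after differentiating by the
  point exactly the scalar for the xy-algebra is left.\<close>

lemma wt_q: "wt (Some k) M * q None (Some k) = q_prod (Some k) M"
  using q_swap'(2)[of k] by (simp add: wt_def mult_ac)

text \<open>
  \<open>z\<close> behaves like an element of degree \<open>M\<close> of the space \<open>ad B(V\<^sub>1 \<oplus> \<dots> \<oplus> V\<^sub>t)(x\<^sub>\<theta>)\<close>, where \<open>V\<^sub>k\<close> are the blocks.
\<close>

definition root_vector :: "'t multiset \<Rightarrow> ('i, 'k) tensor_alg \<Rightarrow> bool" where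
  "root_vector M z \<longleftrightarrow> counit z = 0 \<and> (\<forall>k. D (w k) z \<in> J) \<and> (\<forall>k. D (h k) z \<in> J) \<and>
     (\<forall>v. g v z - scale (wt v M) z \<in> J) \<and> xy_homog M (D th z)"

lemma root_vectorD:
  assumes "root_vector M z"
  shows "counit z = 0" "D (w k) z \<in> J" "D (h k) z \<in> J" "g v z - scale (wt v M) z \<in> J" "xy_homog M (D th z)"
  using assms unfolding root_vector_def by blast+

lemma root_vector_U: "root_vector {#} U"
  by (simp add: root_vector_def D_calc J_0 xy_homog.one)

lemmas JI = J_0 J_add J_scale J_mult_left J_mult_right

lemma root_vector_g:
  assumes "root_vector M z"
  obtains A where "A \<in> J" "g v z = A + scale (wt v M) z"
  using root_vectorD(4)[OF assms, of v] by (metis diff_add_cancel)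

text \<open>The letters x act trivially on root vectors under the adjoint action, so only the
  letters h create new ones. The derivative by the point reduces to the q-commutation of
  \<open>X k\<close> with the xy-homogeneous element \<open>D th z\<close>.\<close>

lemma root_vector_X:
  assumes z: "root_vector M z"
  shows "qcomm (wt (Some k) M) (X k) z"
  unfolding qcomm_def
proof (rule J_I')
  show "counit (X k * z - scale (wt (Some k) M) (z * X k)) = 0" by simp
  show "D (w l) (X k * z - scale (wt (Some k) M) (z * X k)) \<in> J" for l
  proof -
    obtain A where "A \<in> J" "g (Some l) z = A + scale (wt (Some l) M) z" using root_vector_g[OF z] .
    then show ?thesis using root_vectorD(2)[OF z, of l]
      by (cases "k = l") (simp_all add: D_calc nf JI)
  qed
  show "D (h l) (X k * z - scale (wt (Some k) M) (z * X k)) \<in> J" for l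
    using root_vectorD(3)[OF z, of l] by (simp add: D_calc nf JI)
  have "D th (X k * z - scale (wt (Some k) M) (z * X k)) =
      X k * D th z - scale (wt (Some k) M * q None (Some k)) (D th z * X k)"
    by (simp add: D_calc nf)
  then show "D th (X k * z - scale (wt (Some k) M) (z * X k)) \<in> J"
    using xy_homog_X_commute[OF root_vectorD(5)[OF z], of k] by (simp add: wt_q qcomm_def)
qed

text \<open>The derivative by the point is the skew commutator of \<open>H k\<close> with
  \<open>D th z\<close>, plus a multiple of \<open>D th z * X k\<close> coming from the unipotent
  action of the point on \<open>H k\<close>. Both have degree \<open>add_mset k M\<close>.\<close>

lemma root_vector_step:
  assumes z: "root_vector M z"
  shows "root_vector (add_mset k M) (H k * z - scale (wt (Some k) M) (z * H k))"
proof -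
  let ?z = "H k * z - scale (wt (Some k) M) (z * H k)"
  have "D (w l) ?z \<in> J" for l
    using root_vectorD(2)[OF z, of l] by (simp add: D_calc nf JI)
  moreover have "D (h l) ?z \<in> J" for l
  proof -
    obtain A where "A \<in> J" "g (Some l) z = A + scale (wt (Some l) M) z" using root_vector_g[OF z] .
    then show ?thesis using root_vectorD(3)[OF z, of l]
      by (cases "k = l") (simp_all add: D_calc nf JI)
  qed
  moreover have "g v ?z - scale (wt v (add_mset k M)) ?z \<in> J" for v
  proof -
    obtain A where A: "A \<in> J" "g v z = A + scale (wt v M) z" using root_vector_g[OF z] .
    obtain E where E: "E \<in> J" "X k * z = E + scale (wt (Some k) M) (z * X k)"
      using root_vector_X[OF z, of k] unfolding qcomm_def by (metis diff_add_cancel)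
    show ?thesis by (simp add: g_simps A(2) E(2) nf JI A(1) E(1))
  qed
  moreover have "xy_homog (add_mset k M) (D th ?z)"
  proof -
    have "D th ?z = (H k * D th z - scale (wt (Some k) M * q None (Some k)) (D th z * H k)) +
        scale (wt (Some k) M * (q None (Some k) * B None k)) (D th z * X k)"
      by (simp add: D_calc nf)
    then show ?thesis
      unfolding wt_q using root_vectorD(5)[OF z]
      by (simp add: xy_homog.add xy_homog.scale xy_homog_mult_X xy_homog_H_commutator)
  qed
  ultimately show ?thesis by (simp add: root_vector_def)
qed

text \<open>\<open>Y k\<close> is the commutator of \<open>H k\<close> and \<open>X k\<close>, and
  \<open>X k\<close> q-commutes both with \<open>z\<close> and with the new root vector obtained
  from \<open>H k\<close>.\<close>

lemma root_vector_Y: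
  assumes z: "root_vector M z"
  shows "qcomm (wt (Some k) M * wt (Some k) M) (Y k) z"
proof -
  let ?r = "wt (Some k) M"
  let ?z = "H k * z - scale ?r (z * H k)"
  have 1: "X k * z - scale ?r (z * X k) \<in> J" using root_vector_X[OF z] by (simp add: qcomm_def)
  have 2: "X k * ?z - scale ?r (?z * X k) \<in> J"
    using root_vector_X[OF root_vector_step[OF z], of k k] by (simp add: qcomm_def q_diag)
  have "Y k * z - scale (?r * ?r) (z * Y k) =
      H k * (X k * z - scale ?r (z * X k)) - scale ?r ((X k * z - scale ?r (z * X k)) * H k) -
      (X k * ?z - scale ?r (?z * X k))"
    by (simp add: nf Y_def)
  then show ?thesis
    unfolding qcomm_def by (simp only: J_diff J_scale J_mult_left J_mult_right 1 2)
qed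

lemma root_vector_xy_homog_commute:
  assumes z: "root_vector M z" and p: "xy_homog M' p"
  shows "qcomm (\<Prod>k\<in>#M'. wt (Some k) M) p z"
  by (rule xy_homog_commute[OF _ _ p]) (rule root_vector_X[OF z] root_vector_Y[OF z])+

lemma root_vector_in_J: "root_vector M z \<Longrightarrow> D th z \<in> J \<Longrightarrow> z \<in> J"
  by (rule J_I') (simp_all add: root_vectorD)

lemma root_vector_mult:
  assumes z: "root_vector M z" and z': "root_vector M' z'"
  shows "counit (z * z') = 0" "D (w k) (z * z') \<in> J" "D (h k) (z * z') \<in> J"
  using root_vectorD[OF z] root_vectorD[OF z'] by (simp_all add: D_mult' JI)

text \<open>In the Leibniz rule, \<open>D th z\<close> stands to the left of \<open>z'\<close>;
  moving it to the right yields the second factor of the scalar.\<close>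

lemma D_th_root_vector_mult:
  assumes z: "root_vector M z" and z': "root_vector M' z'"
  shows "D th (z * z') - (z * D th z' + scale (wt None M' * (\<Prod>k\<in>#M. wt (Some k) M')) (z' * D th z)) \<in> J"
proof -
  obtain A where A: "A \<in> J" "g None z' = A + scale (wt None M') z'" using root_vector_g[OF z'] .
  obtain E where E: "E \<in> J" "D th z * z' = E + scale (\<Prod>k\<in>#M. wt (Some k) M') (z' * D th z)"
    using root_vector_xy_homog_commute[OF z' root_vectorD(5)[OF z]] unfolding qcomm_def by (metis diff_add_cancel)
  show ?thesis by (simp add: D_mult' blk A(2) nf E(2) JI A(1) E(1))
qed

fun iter_ad :: "'t list \<Rightarrow> ('i, 'k) tensor_alg" where
  "iter_ad [] = U"
| "iter_ad (k # ks) = H k * iter_ad ks - scale (wt (Some k) (mset ks)) (iter_ad ks * H k)"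

lemma root_vector_iter_ad: "root_vector (mset ks) (iter_ad ks)"
  by (induction ks) (simp_all add: root_vector_U root_vector_step)

lemma homog_part_basis_vec: "homog_part n (basis_vec u) = (if length u = n then basis_vec u else 0)"
  by (rule poly_mapping_eqI) (auto simp: lookup_homog_part lookup_single when_def)

lemma homog_part_mult_gen: "homog_part (Suc n) (p * gen i) = homog_part n p * gen i"
  by (induction p rule: basis_induct)
     (simp_all add: distrib_right scale_mult homog_part_simps basis_vec_mult homog_part_basis_vec)

lemma homog_part_iter_ad: "homog_part (Suc (length ks)) (iter_ad ks) = iter_ad ks"
  by (induction ks) (simp_all add: homog_part_basis_vec homog_part_simps homog_part_gen_mult homog_part_mult_gen)

lemma fin_mod_J_Alg_XY: "fin_mod_J (Alg (range X \<union> range Y))"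
proof -
  have "\<exists>r. a * y - scale r (y * a) \<in> J" if "a \<in> range X \<union> range Y" "y \<in> range X \<union> range Y" for a y
    using that qcomm_X_X qcomm_X_Y qcomm_Y_X qcomm_Y_Y unfolding qcomm_def by blast
  moreover have "a ^ 2 \<in> J" if "a \<in> range X \<union> range Y" for a
    using that X_sq Y_sq by (auto simp: power2_eq_square)
  ultimately have "fin_mod_J (Alg ((range X \<union> range Y) \<union> {}))"
    by (intro fin_mod_J_Alg_union[OF fin_mod_J_Alg_empty, of _ 2]) auto
  then show ?thesis by simp
qed

lemma iter_ad_long:
  "\<exists>n. \<forall>ks. n \<le> length ks \<longrightarrow> iter_ad ks \<in> J"
proof -
  obtain n where n: "\<forall>p \<in> Alg (range X \<union> range Y). \<forall>m\<ge>n. homog_part m p \<in> J"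
    using fin_mod_J_degree_bound[OF fin_mod_J_Alg_XY] ..
  have "iter_ad ks \<in> J" if "n \<le> length ks" for ks
  proof -
    \<comment> \<open>\<open>iter_ad ks\<close> has degree \<open>length ks + 1\<close>, counting
      the point, and the derivation lowers it by one.\<close>
    have "D th (iter_ad ks) = homog_part (length ks) (D th (iter_ad ks))"
      using D_homog_part(1)[of th "length ks" "iter_ad ks"] by (simp add: homog_part_iter_ad)
    also have "\<dots> \<in> J"
      using n xy_homog_Alg[OF root_vectorD(5)[OF root_vector_iter_ad]] that by blast
    finally show ?thesis by (rule root_vector_in_J[OF root_vector_iter_ad])
  qed
  then show ?thesis by blast
qed

lemma root_vector_moves_past:
  assumes z: "root_vector M z" "z \<in> A" and A: "fsupp.subspace A"
  shows "moves_past (X k) A z" "moves_past (Y k) A z"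
    "H k * z - scale (wt (Some k) M) (z * H k) \<in> A \<Longrightarrow> moves_past (H k) A z"
proof -
  show "moves_past (X k) A z" "moves_past (Y k) A z"
    using root_vector_X[OF z(1), of k] root_vector_Y[OF z(1), of k] z(2) A
    by (auto simp: qcomm_def intro: moves_past_qcommute)
  show "moves_past (H k) A z" if "H k * z - scale (wt (Some k) M) (z * H k) \<in> A"
    by (rule moves_past_I[of "scale (wt (Some k) M) z" _ "H k * z - scale (wt (Some k) M) (z * H k)"])
       (use that z(2) A in \<open>auto simp: fsupp.subspace_scale scale_mult J_0\<close>)
qed

text \<open>Three layers are adjoined: the point part \<open>Z\<close>, then all \<open>X\<close>
  and \<open>Y\<close> (of square zero), then all \<open>H\<close> (of fourth power zero). Moving
  \<open>H\<close> past \<open>Z\<close> leaves the skew commutator, hence the closure condition on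
  \<open>Z\<close>.\<close>

lemma finite_dim_if_fin_point_part:
  assumes fin: "fin_mod_J (Alg Z)" and Z: "\<And>z. z \<in> Z \<Longrightarrow> \<exists>M. root_vector M z \<and>
     (\<forall>k. H k * z - scale (wt (Some k) M) (z * H k) \<in> Alg Z)" and U: "U \<in> Z"
  shows "finite_dim_nichols_algebra c"
proof -
  let ?XY = "range X \<union> range Y"
  have "moves_past a (Alg Z) z" if "a \<in> ?XY" "z \<in> Z" for a z
    using Z[OF that(2)] that root_vector_moves_past(1,2)[OF _ Alg_base[OF that(2)] Alg_subspace] by blast
  moreover have "\<exists>r. a * y - scale r (y * a) \<in> J" if "a \<in> ?XY" "y \<in> ?XY" for a y
    using that qcomm_X_X qcomm_X_Y qcomm_Y_X qcomm_Y_Y unfolding qcomm_def by blast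
  moreover have "a ^ 2 \<in> J" if "a \<in> ?XY" for a
    using that X_sq Y_sq by (auto simp: power2_eq_square)
  ultimately have fin2: "fin_mod_J (Alg (?XY \<union> Z))"
    by (intro fin_mod_J_Alg_union[OF fin, of _ 2]) auto
  let ?W = "?XY \<union> Z"
  have base: "X k \<in> Alg ?W" "Y k \<in> Alg ?W" for k
    by (auto intro: Alg_base)
  have "moves_past a (Alg ?W) z" if a: "a \<in> range H" and z: "z \<in> ?W" for a z
  proof -
    obtain k where k: "a = H k" using a by blast
    consider l where "z = X l" | l where "z = Y l" | "z \<in> Z" using z by blast
    then show ?thesis
    proof cases
      case 1
      let ?p = "if k = l then Y k else 0"
      have "H k * X l - (scale (q (Some k) (Some l)) (X l) * H k + ?p) \<in> J"
        using H_X_E[of k l] by (simp only: scale_mult diff_diff_eq)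
      then show ?thesis unfolding k 1
        by (rule moves_past_I[rotated 2]) (simp_all add: base Alg.scale Alg.ideal J_0)
    next
      case 2
      let ?p = "if k = l then scale (B (Some k) k) (X k * Y k) else 0"
      have "H k * Y l - (scale (q (Some k) (Some l) * q (Some k) (Some l)) (Y l) * H k + ?p) \<in> J"
        using H_Y_E[of k l] by (simp only: scale_mult diff_diff_eq)
      then show ?thesis unfolding k 2
        by (rule moves_past_I[rotated 2]) (simp_all add: base Alg.scale Alg.ideal J_0 Alg_mult)
    next
      case 3
      have "Alg Z \<subseteq> Alg ?W" by (rule Alg_subset) (auto intro: Alg_base)
      then show ?thesis unfolding k
        using Z[OF 3] root_vector_moves_past(3)[OF _ Alg_base[OF z] Alg_subspace] by blast
    qed
  qed
  moreover have "\<exists>r. a * y - scale r (y * a) \<in> J" if ay: "a \<in> range H" "y \<in> range H" for a y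
  proof -
    obtain k l where kl: "a = H k" "y = H l" using ay by blast
    show ?thesis
    proof (cases "k = l")
      case True
      then show ?thesis unfolding kl by (intro exI[of _ 1]) (simp add: J_0)
    next
      case False
      then show ?thesis unfolding kl using H_H by blast
    qed
  qed
  moreover have "a ^ 4 \<in> J" if "a \<in> range H" for a
    using that H_power by blast
  ultimately have "fin_mod_J (Alg (range H \<union> ?W))"
    by (intro fin_mod_J_Alg_union[OF fin2, of _ 4]) auto
  moreover have "gen i \<in> Alg (range H \<union> ?W)" for i
    by (rule Alg_base, rule index_induct[of _ i]) (use U in auto)
  ultimately show ?thesis by (rule finite_dim_nichols_algebraI)
qed

subsection \<open>The case of a point with trivial self-braiding\<close>

lemma q_prod_swap: "(\<Prod>k\<in>#M. q (Some k) None) * q_prod None M = 1"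
proof (induction M)
  case (add k M)
  have "(\<Prod>k\<in>#add_mset k M. q (Some k) None) * q_prod None (add_mset k M) =
      (q (Some k) None * q None (Some k)) * ((\<Prod>k\<in>#M. q (Some k) None) * q_prod None M)"
    by (simp add: mult_ac)
  then show ?case by (simp only: add.IH q_swap') simp
qed simp

lemma q_prod_q_prod_swap: "(\<Prod>k\<in>#M. q_prod (Some k) M') * (\<Prod>l\<in>#M'. q_prod (Some l) M) = 1"
proof (induction M)
  case empty
  show ?case by simp
next
  case (add k M)
  have "q_prod (Some k) M' * (\<Prod>l\<in>#M'. q (Some l) (Some k)) = 1"
  proof (induction M')
    case (add l M')
    have "q (Some k) (Some l) * q (Some l) (Some k) = 1"
      using q_swap'(1)[of k l] by (cases "k = l") (simp_all add: q_diag)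
    moreover have "q_prod (Some k) (add_mset l M') * (\<Prod>l\<in>#add_mset l M'. q (Some l) (Some k)) =
       (q (Some k) (Some l) * q (Some l) (Some k)) * (q_prod (Some k) M' * (\<Prod>l\<in>#M'. q (Some l) (Some k)))"
      by (simp add: mult_ac)
    ultimately show ?case by (simp only: add.IH) simp
  qed simp
  moreover have "(\<Prod>k\<in>#add_mset k M. q_prod (Some k) M') * (\<Prod>l\<in>#M'. q_prod (Some l) (add_mset k M)) =
      (q_prod (Some k) M' * (\<Prod>l\<in>#M'. q (Some l) (Some k))) * ((\<Prod>k\<in>#M. q_prod (Some k) M') * (\<Prod>l\<in>#M'. q_prod (Some l) M))"
    by (simp add: prod_mset.distrib mult_ac)
  ultimately show ?case by (simp only: add.IH) simp
qed

text \<open>Two root vectors braid with inverse scalars in the two orders: all mixed entries of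
  \<open>q\<close> pair off to 1, and the point contributes only its own entry, which is 1.\<close>

lemma wt_swap:
  assumes "q None None = 1"
  shows "(wt None M' * (\<Prod>k\<in>#M. wt (Some k) M')) * (wt None M * (\<Prod>k\<in>#M'. wt (Some k) M)) = 1"
proof -
  have "(wt None M' * (\<Prod>k\<in>#M. wt (Some k) M')) * (wt None M * (\<Prod>k\<in>#M'. wt (Some k) M)) =
      ((\<Prod>k\<in>#M. q (Some k) None) * q_prod None M) * ((\<Prod>k\<in>#M'. q (Some k) None) * q_prod None M') *
      ((\<Prod>k\<in>#M. q_prod (Some k) M') * (\<Prod>l\<in>#M'. q_prod (Some l) M))"
    using assms by (simp add: wt_def prod_mset.distrib mult_ac)
  then show ?thesis by (simp only: q_prod_swap q_prod_q_prod_swap) simp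
qed

text \<open>Differentiating by the point gives z (D z') and z' (D z), each twice; the coefficients
  cancel since the two braiding scalars are inverse to each other.\<close>

lemma root_vector_commute:
  assumes "q None None = 1" and z: "root_vector M z" and z': "root_vector M' z'"
  shows "\<exists>r. z * z' - scale r (z' * z) \<in> J"
proof (rule exI)
  let ?r = "wt None M' * (\<Prod>k\<in>#M. wt (Some k) M')"
  let ?r' = "wt None M * (\<Prod>k\<in>#M'. wt (Some k) M)"
  have 1: "?r * ?r' = 1" by (rule wt_swap[OF assms(1)])
  show "z * z' - scale ?r (z' * z) \<in> J"
  proof (rule J_I')
    have "D th (z * z' - scale ?r (z' * z)) =
        (D th (z * z') - (z * D th z' + scale ?r (z' * D th z))) -
        scale ?r (D th (z' * z) - (z' * D th z + scale ?r' (z * D th z'))) +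
        (z * D th z' - scale (?r * ?r') (z * D th z'))"
      unfolding D_simps by (simp only: fsupp.scale_right_distrib fsupp.scale_right_diff_distrib fsupp.scale_scale) (simp only: algebra_simps)
    also have "\<dots> \<in> J"
      unfolding 1 using D_th_root_vector_mult[OF z z'] D_th_root_vector_mult[OF z' z] by (simp only: J_add J_diff J_scale fsupp.scale_one diff_self J_0)
    finally show "D th (z * z' - scale ?r (z' * z)) \<in> J" .
  qed (use root_vector_mult[OF z z'] root_vector_mult[OF z' z] in \<open>simp_all only: D_simps J_diff J_scale counit_simps\<close>, simp)
qed

text \<open>Here the braiding scalar \<open>?r\<close> squares to 1, so it equals 1 in
  characteristic 2, and the derivative of z z is 2 z (D z) = 0 modulo \<open>J\<close>.\<close>

lemma root_vector_square:
  assumes "q None None = 1" and z: "root_vector M z"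
  shows "z * z \<in> J"
proof (rule J_I')
  let ?r = "wt None M * (\<Prod>k\<in>#M. wt (Some k) M)"
  have "?r * ?r = 1" by (rule wt_swap[OF assms(1)])
  then have "?r = 1"
    using square_eq_1_iff[of ?r] minus_eq(2)[of 1] by auto
  then show "D th (z * z) \<in> J"
    using D_th_root_vector_mult[OF z z] by (simp add: add_self)
qed (use root_vector_mult[OF z z] in auto)

theorem finite_dim_trivial_point:
  assumes "q None None = 1"
  shows "finite_dim_nichols_algebra c"
proof -
  obtain n where n: "\<forall>ks. n \<le> length ks \<longrightarrow> iter_ad ks \<in> J" using iter_ad_long ..
  let ?Z = "iter_ad ` {ks. length ks \<le> n}"
  have fin: "finite {ks :: 't list. length ks \<le> n}"
    using finite_lists_length_le[of "UNIV :: 't set" n] by simp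
  have "fin_mod_J (Alg (?Z \<union> {}))"
  proof (rule fin_mod_J_Alg_union[OF fin_mod_J_Alg_empty, of _ 2])
    show "\<exists>r. a * y - scale r (y * a) \<in> J" if "a \<in> ?Z" "y \<in> ?Z" for a y
      using that root_vector_commute[OF assms root_vector_iter_ad root_vector_iter_ad] by blast
    show "a ^ 2 \<in> J" if "a \<in> ?Z" for a
      using that root_vector_square[OF assms root_vector_iter_ad] by (auto simp: power2_eq_square)
  qed (use fin in auto)
  then show ?thesis
  proof (intro finite_dim_if_fin_point_part[of ?Z])
    fix z assume "z \<in> ?Z"
    then obtain ks where ks: "z = iter_ad ks" "length ks \<le> n" by blast
    have "iter_ad (k # ks) \<in> Alg ?Z" for k
    \<comment> \<open>At the maximal length the next iterate already lies in \<open>J\<close>, so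
      the finite set is closed under the skew commutators with \<open>H\<close>.\<close>
    proof (cases "length ks < n")
      case True
      then show ?thesis by (intro Alg_base imageI) simp
    next
      case False
      then have "iter_ad (k # ks) \<in> J" using n by (simp del: iter_ad.simps)
      then show ?thesis by (rule Alg.ideal)
    qed
    then show "\<exists>M. root_vector M z \<and> (\<forall>k. H k * z - scale (wt (Some k) M) (z * H k) \<in> Alg ?Z)"
      using root_vector_iter_ad[of ks] by (intro exI[of _ "mset ks"]) (simp add: ks(1))
  next
    have "iter_ad [] \<in> ?Z" by (rule imageI) simp
    then show "U \<in> ?Z" by simp
  qed simp
qed

subsection \<open>The case of one block with trivial braiding and a point labelled by a cubic root of unity\<close>

lemma qcomm_sym:
  assumes "qcomm r a p" "r \<noteq> 0"
  shows "qcomm (inverse r) p a"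
proof -
  have "p * a - scale (inverse r) (a * p) = scale (- inverse r) (a * p - scale r (p * a))"
    using assms(2) by (simp add: fsupp.scale_right_diff_distrib)
  then show ?thesis using assms(1) unfolding qcomm_def by (simp only: J_scale)
qed

text \<open>Unlike root vectors, these elements are closed under products, and membership of any of
  them in \<open>J\<close> is still decided by \<open>D th\<close> alone.\<close>

definition point_part :: "('i, 'k) tensor_alg set" where
  "point_part = {p. counit p = 0 \<and> (\<forall>k. D (w k) p \<in> J) \<and> (\<forall>k. D (h k) p \<in> J)}"

lemma point_part_closed:
  "p \<in> point_part \<Longrightarrow> p' \<in> point_part \<Longrightarrow> p * p' \<in> point_part" "p \<in> point_part \<Longrightarrow> p' \<in> point_part \<Longrightarrow> p - p' \<in> point_part" "p \<in> point_part \<Longrightarrow> scale r p \<in> point_part"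
  by (simp_all add: point_part_def D_mult' D_simps JI J_diff)

lemma point_part_root_vector: "root_vector M z \<Longrightarrow> z \<in> point_part"
  by (simp add: point_part_def root_vectorD)

lemma point_part_J: "p \<in> point_part \<Longrightarrow> D th p \<in> J \<Longrightarrow> p \<in> J"
  by (rule J_I') (simp_all add: point_part_def)

text \<open>The hypothesis \<open>e * e = e + 1\<close> is the cyclotomic equation 1 + e + e^2 = 0
  in characteristic 2.\<close>

theorem finite_dim_cubic_point:
  fixes e :: 'k
  assumes single: "\<And>l. l = k" and B0: "B (Some k) k = 0"
    and e: "q None None = e" "e * e = e + 1"
  shows "finite_dim_nichols_algebra c"
proof -
  define a1 where "a1 = q None (Some k)"
  define a2 where "a2 = q (Some k) None"
  define b where "b = B None k"
  have a12: "a1 * a2 = 1" "a1 * (a2 * x) = x" for x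
    using q_swap'(2)[of k] by (simp_all add: a1_def a2_def mult.assoc[symmetric])
  have ee: "e * (e * x) = e * x + x" for x
    by (simp add: mult.assoc[symmetric] e(2) distrib_right)
  define u where "u = U"
  define z where "z = iter_ad [k]"
  define y where "y = X k"
  \<comment> \<open>\<open>u\<close> and \<open>z\<close> play the simple roots of type A_2: both
    have self-braiding \<open>e\<close>, and the two mixed scalars \<open>a1 * e\<close> and
    \<open>a2 * e\<close> multiply to e^2, the inverse of \<open>e\<close>. The element
    \<open>v\<close> is their braided commutator.\<close>
  define v where "v = z * u - scale (a2 * e) (u * z)"
  have "B (Some l) l = 0" for l
    using B0 single[of l] by simp
  then have Y: "Y k \<in> J"
    by (intro J_I'[of "Y k"]) (simp_all add: D_Y J_0)
  have u: "root_vector {#} u" and z: "root_vector {#k#} z"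
    using root_vector_iter_ad[of "[]"] root_vector_iter_ad[of "[k]"] by (simp_all add: u_def z_def)
  have gu: "g None u = scale e u" and Du: "D th u = 1"
    by (simp_all add: u_def D_calc e)
  have Dz: "D th z = scale b y"
    using q_swap'(2,3)[of k] by (simp add: z_def D_calc nf b_def y_def)
  obtain Az where Az: "Az \<in> J" "g None z = Az + scale (a1 * e) z"
    using root_vector_g[OF z, of None] by (auto simp: a1_def e)
  obtain E1 where E1: "E1 \<in> J" "y * u = E1 + scale a2 (u * y)"
    using root_vector_X[OF u, of k] unfolding qcomm_def y_def a2_def by (metis diff_add_cancel wt_simps(1))
  obtain E2 where E2: "E2 \<in> J" "y * z = E2 + scale a2 (z * y)"
  proof -
    have "y * z - scale a2 (z * y) \<in> J"
      using root_vector_X[OF z, of k] by (simp add: qcomm_def y_def a2_def q_diag)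
    from that[OF this] show ?thesis by simp
  qed
  have E1': "y * (u * x) = E1 * x + scale a2 (u * (y * x))" and
      E2': "y * (z * x) = E2 * x + scale a2 (z * (y * x))" for x
    unfolding mult.assoc[symmetric] E1(2) E2(2) by (simp_all add: distrib_right scale_mult mult.assoc)
  have zu: "z * u = v + scale (a2 * e) (u * z)" and zu': "z * (u * x) = v * x + scale (a2 * e) (u * (z * x))" for x
    by (simp_all add: v_def left_diff_distrib scale_mult mult.assoc)
  obtain Av where Av: "Av \<in> J" "g None v = Av + scale (a1 * (e * e)) v"
  proof -
    have "g None v - scale (a1 * (e * e)) v = scale e (Az * u) - scale (a2 * (e * e)) (u * Az)"
      by (simp add: v_def g_simps Az(2) gu nf)
    then have "g None v - scale (a1 * (e * e)) v \<in> J"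
      using Az(1) by (simp add: JI J_diff)
    from that[OF this] show ?thesis by simp
  qed
  obtain Ev where Ev: "Ev \<in> J" "y * v = Ev + scale (a2 * a2) (v * y)"
  proof -
    have "qcomm (a2 * a2) y v"
      unfolding v_def using E1 E2
      by (intro qcomm_diff_right qcomm_scale_right qcomm_mult_right) (simp_all add: qcomm_def)
    then have "y * v - scale (a2 * a2) (v * y) \<in> J" by (simp add: qcomm_def)
    from that[OF this] show ?thesis by simp
  qed
  obtain F where F: "F \<in> J" "D th v = F + scale e z"
  proof -
    have "D th v - scale e z = scale (b * e) E1 - scale (a2 * e) Az"
      by (simp add: v_def D_mult' D_simps blk Du Dz Az(2) gu E1(2) nf a12 ee e(2))
    then have "D th v - scale e z \<in> J"
      using Az(1) E1(1) by (simp add: JI J_diff)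
    from that[OF this] show ?thesis by simp
  qed
  have point_part: "u \<in> point_part" "z \<in> point_part" "v \<in> point_part"
    using point_part_root_vector[OF u] point_part_root_vector[OF z] by (simp_all add: v_def point_part_closed)
  \<comment> \<open>The derivative of u^3 is (1 + e + e^2) u^2 = 0. For z^3 and v^3 the same factor
    appears modulo \<open>J\<close>, using 1 + e^4 + e^8 = 1 + e + e^2 for the latter.\<close>
  have u3: "u ^ 3 \<in> J"
  proof (rule point_part_J)
    show "u ^ 3 \<in> point_part" by (simp add: eval_nat_numeral point_part point_part_closed)
    show "D th (u ^ 3) \<in> J"
      by (simp add: eval_nat_numeral D_mult' g_simps blk Du gu nf e(2) J_0)
  qed
  have z3: "z ^ 3 \<in> J"
  proof (rule point_part_J)
    show "z ^ 3 \<in> point_part" by (simp add: eval_nat_numeral point_part point_part_closed)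
    show "D th (z ^ 3) \<in> J"
      using Az(1) E2(1)
      by (simp add: eval_nat_numeral D_mult' g_simps blk Dz Az(2) E2(2) E2' nf a12 ee e(2) JI)
  qed
  have zv: "z * v - scale (a2 * (e * e)) (v * z) \<in> J"
  proof (rule point_part_J)
    show "z * v - scale (a2 * (e * e)) (v * z) \<in> point_part" by (simp add: point_part point_part_closed)
    show "D th (z * v - scale (a2 * (e * e)) (v * z)) \<in> J"
      using Az(1) Av(1) Ev(1) F(1)
      by (simp add: D_mult' D_simps blk Dz F(2) Az(2) Av(2) Ev(2) nf a12 ee e(2) JI)
  qed
  \<comment> \<open>This is the vanishing of the braided commutator of \<open>v\<close> with
    \<open>u\<close>, v u = a2 e^2 u v, solved for u v; the inverse of a2 e^2 is a1 e.\<close>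
  have uv: "u * v - scale (a1 * e) (v * u) \<in> J"
  proof (rule point_part_J)
    show "u * v - scale (a1 * e) (v * u) \<in> point_part" by (simp add: point_part point_part_closed)
    show "D th (u * v - scale (a1 * e) (v * u)) \<in> J"
      using Av(1) F(1)
      by (simp add: D_mult' D_simps blk Du F(2) gu Av(2) zu zu' nf a12 ee e(2) JI)
  qed
  obtain E3 where E3: "E3 \<in> J" "z * v = E3 + scale (a2 * (e * e)) (v * z)"
    using that[OF zv] by simp
  have E3': "z * (v * x) = E3 * x + scale (a2 * (e * e)) (v * (z * x))" for x
    unfolding mult.assoc[symmetric] E3(2) by (simp add: distrib_right scale_mult mult.assoc)
  have v3: "v ^ 3 \<in> J"
  proof (rule point_part_J)
    show "v ^ 3 \<in> point_part" by (simp add: eval_nat_numeral point_part point_part_closed)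
    show "D th (v ^ 3) \<in> J"
      using Av(1) F(1) E3(1)
      by (simp add: eval_nat_numeral D_mult' g_simps blk F(2) Av(2) E3(2) E3' nf a12 ee e(2) JI)
  qed
  have nz: "a1 * e \<noteq> 0"
    using q_nonzero e(1) by (metis a1_def mult_eq_0_iff)
  \<comment> \<open>The order u, v, z is a convex one: \<open>v\<close> q-commutes with
    \<open>u\<close>, and \<open>z\<close> moves past \<open>u\<close> with remainder
    \<open>v\<close>, which is then already present.\<close>
  have "fin_mod_J (Alg {u})"
    by (rule fin_mod_J_Alg_insert[OF fin_mod_J_Alg_empty _ u3]) simp_all
  moreover have "moves_past v (Alg {u}) u"
    using qcomm_sym[of "a1 * e" u v] uv nz
    by (auto simp: qcomm_def intro!: moves_past_qcommute[OF _ Alg_base Alg_subspace])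
  ultimately have "fin_mod_J (Alg {v, u})"
    by (intro fin_mod_J_Alg_insert[OF _ _ v3]) auto
  moreover have "moves_past z (Alg {v, u}) u"
    by (rule moves_past_I[of "scale (a2 * e) u" _ v]) (auto simp: zu scale_mult J_0 intro: Alg.scale Alg_base)
  moreover have "moves_past z (Alg {v, u}) v"
    by (rule moves_past_qcommute[OF zv Alg_base Alg_subspace]) simp
  ultimately have "fin_mod_J (Alg {z, v, u})"
    by (intro fin_mod_J_Alg_insert[OF _ _ z3]) auto
  \<comment> \<open>\<open>v\<close> is quadratic in the point and serves only the finiteness bound;
    the closure condition is checked on the root vectors \<open>u\<close> and
    \<open>z\<close>.\<close>
  moreover have "Alg {u, z} \<subseteq> Alg {z, v, u}"
    by (rule Alg_subset) (auto intro: Alg_base)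
  ultimately have "fin_mod_J (Alg {u, z})"
    by (rule fin_mod_J_subset)
  then show ?thesis
  proof (rule finite_dim_if_fin_point_part)
    show "U \<in> {u, z}" by (simp add: u_def)
    fix x assume x: "x \<in> {u, z}"
    \<comment> \<open>A second application of \<open>H k\<close> gives nothing new: its derivative
      by the point is b Y + b^2 X^2, and \<open>Y k\<close> lies in \<open>J\<close> for a trivial
      block.\<close>
    have zz2: "H k * z - scale (wt (Some k) {#k#}) (z * H k) \<in> J"
    proof (rule root_vector_in_J[OF root_vector_step[OF z]])
      have "scale b (Y k) + scale (b * b) (y * y) \<in> J"
        using Y X_sq[of k] by (simp add: y_def JI)
      then show "D th (H k * z - scale (wt (Some k) {#k#}) (z * H k)) \<in> J"
        by (simp add: D_calc Dz nf Y_def y_def q_diag a1_def[symmetric] a2_def[symmetric] b_def[symmetric] a12)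
    qed
    show "\<exists>M. root_vector M x \<and> (\<forall>l. H l * x - scale (wt (Some l) M) (x * H l) \<in> Alg {u, z})"
    proof (cases "x = u")
      case True
      have "H l * u - scale (wt (Some l) {#}) (u * H l) = z" for l
        using single[of l] by (simp add: z_def u_def)
      then show ?thesis unfolding True using u by (intro exI[of _ "{#}"]) (simp add: Alg_base)
    next
      case False
      then show ?thesis using x zz2 z single by (metis Alg.ideal insertE singletonD)
    qed
  qed
qed

end

section \<open>The braided vector spaces of the theorem\<close>

instance index3 :: finite
proof
  have *: "UNIV = {X1, X2, X3}" using index3.exhaust by auto
  show "finite (UNIV :: index3 set)" unfolding * by simp
qed

instance indexP :: (finite) finite
proof
  have *: "i \<in> range Whole \<union> range Half \<union> {Theta}" for i :: "'a indexP"
    by (cases i) auto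
  show "finite (UNIV :: 'a indexP set)"
    by (rule finite_subset[of _ "range Whole \<union> range Half \<union> {Theta}"]) (use * in auto)
qed

fun blk3 :: "index3 \<Rightarrow> unit option" where
  "blk3 X3 = None"
| "blk3 _ = Some ()"

fun q3 :: "'k::field \<Rightarrow> 'k \<Rightarrow> unit option \<Rightarrow> unit option \<Rightarrow> 'k" where
  "q3 p s None None = s"
| "q3 p s None (Some _) = inverse p"
| "q3 p s (Some _) None = p"
| "q3 p s (Some _) (Some _) = 1"

text \<open>\<open>b\<close> is the entry of the block acting on itself (1 for a Jordan block, 0 for
  a trivial one), \<open>a\<close> that of the point acting on the block.\<close>

definition B3 :: "'k \<Rightarrow> 'k \<Rightarrow> unit option \<Rightarrow> unit \<Rightarrow> 'k::field" where
  "B3 b a u _ = (case u of None \<Rightarrow> a | Some _ \<Rightarrow> b)"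

lemma blocks_and_point_rank3:
  assumes "CHAR('k::field) = 2" "p \<noteq> 0" "s \<noteq> 0"
    and "\<And>i. c i X1 = scale (q3 p s (blk3 i) (Some ())) (basis_vec (X1, i))"
    and "\<And>i. c i X2 = scale (q3 p s (blk3 i) (Some ()))
      (basis_vec (X2, i) + scale (B3 b a (blk3 i) ()) (basis_vec (X1, i)))"
    and "\<And>i. c i X3 = scale (q3 p s (blk3 i) None) (basis_vec (X3, i))"
  shows "blocks_and_point c (\<lambda>_. X1) (\<lambda>_. X2) X3 blk3 (q3 p s) (B3 b (a :: 'k))"
proof
  show "(\<exists>k::unit. i = X1) \<or> (\<exists>k::unit. i = X2) \<or> i = X3" for i
    by (cases i) simp_all
  show "q3 p s u v \<noteq> 0" for u v
    using assms(2,3) by (cases u; cases v) simp_all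
  show "q3 p s u v * q3 p s v u = 1" if "u \<noteq> v" for u v
    using assms(2) that by (cases u; cases v) simp_all
qed (simp_all add: assms)

lemma blocks_and_point_L:
  assumes "CHAR('k::field) = 2" "p \<noteq> 0"
  shows "blocks_and_point (braiding_L p 1 a) (\<lambda>_. X1) (\<lambda>_. X2) X3 blk3 (q3 p 1) (B3 1 (a :: 'k))"
proof (rule blocks_and_point_rank3[OF assms])
  fix i
  show "braiding_L p 1 a i X1 = scale (q3 p 1 (blk3 i) (Some ())) (basis_vec (X1, i))"
    by (cases i) simp_all
  show "braiding_L p 1 a i X2 = scale (q3 p 1 (blk3 i) (Some ()))
      (basis_vec (X2, i) + scale (B3 1 a (blk3 i) ()) (basis_vec (X1, i)))"
    by (cases i) (simp_all add: B3_def)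
  show "braiding_L p 1 a i X3 = scale (q3 p 1 (blk3 i) None) (basis_vec (X3, i))"
    by (cases i) simp_all
qed simp

lemma blocks_and_point_E:
  assumes "CHAR('k::field) = 2" "p \<noteq> 0" "s \<noteq> 0"
  shows "blocks_and_point (braiding_E p s) (\<lambda>_. X1) (\<lambda>_. X2) X3 blk3 (q3 p s) (B3 0 (1 :: 'k))"
proof (rule blocks_and_point_rank3[OF assms])
  fix i
  show "braiding_E p s i X1 = scale (q3 p s (blk3 i) (Some ())) (basis_vec (X1, i))"
    by (cases i) simp_all
  show "braiding_E p s i X2 = scale (q3 p s (blk3 i) (Some ()))
      (basis_vec (X2, i) + scale (B3 0 1 (blk3 i) ()) (basis_vec (X1, i)))"
    by (cases i) (simp_all add: B3_def)
  show "braiding_E p s i X3 = scale (q3 p s (blk3 i) None) (basis_vec (X3, i))"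
    by (cases i) simp_all
qed

definition BP :: "('t \<Rightarrow> 'k) \<Rightarrow> 't option \<Rightarrow> 't \<Rightarrow> 'k::field" where
  "BP a u l = (case u of None \<Rightarrow> a l | Some k \<Rightarrow> if k = l then 1 else 0)"

lemma blocks_and_point_P:
  fixes q :: "'t::finite option \<Rightarrow> 't option \<Rightarrow> 'k::field"
  assumes "CHAR('k) = 2" "\<And>i j. q i j \<noteq> 0" "\<And>i. q i i = 1" "\<And>i j. i \<noteq> j \<Longrightarrow> q i j * q j i = 1"
  shows "blocks_and_point (braiding_P q a) Whole Half Theta integral_part q (BP a)"
proof
  show "(\<exists>k. i = Whole k) \<or> (\<exists>k. i = Half k) \<or> i = Theta" for i :: "'t indexP"
    by (cases i) simp_all
  show "braiding_P q a i (Whole l) = scale (q (integral_part i) (Some l)) (basis_vec (Whole l, i))" for i l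
    by (cases i) (simp_all add: assms(3))
  show "braiding_P q a i (Half l) = scale (q (integral_part i) (Some l))
      (basis_vec (Half l, i) + scale (BP a (integral_part i) l) (basis_vec (Whole l, i)))" for i l
    by (cases i) (simp_all add: assms(3) BP_def)
  show "braiding_P q a i Theta = scale (q (integral_part i) None) (basis_vec (Theta, i))" for i
    by (cases i) (simp_all add: assms(3))
qed (simp_all add: assms BP_def)

text \<open>Cancel e - 1 in the factorization of e^3 - 1 and drop the signs.\<close>

lemma primitive_cube_root_char_2:
  assumes "CHAR('k::field) = 2" "primitive_root_of_unity 3 (e :: 'k)"
  shows "e * e = e + 1"
proof -
  have e: "e ^ 3 = 1" "e \<noteq> 1"
    using assms(2) by (auto simp: primitive_root_of_unity_def dest: spec[of _ 1])
  have "(2::'k) = 0"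
    using of_nat_CHAR[where 'a='k] assms(1) by simp
  then have "1 + 1 = (0::'k)" by simp
  then have m: "- x = x" for x :: 'k
    by (metis add_eq_0_iff distrib_right mult_1 mult_zero_left)
  have "(e - 1) * (e * e + e + 1) = e ^ 3 - 1"
    by (simp add: algebra_simps power3_eq_cube)
  then have "e * e + e + 1 = 0" using e by simp
  then have "e * e = - (e + 1)" by (simp only: eq_neg_iff_add_eq_0 add.assoc)
  then show ?thesis by (simp only: m)
qed

theorem mainTheorem1:
  assumes char_2: "CHAR('k::alg_closed_field) = 2"
  shows
    "(\<forall>p::'k. p \<noteq> 0 \<longrightarrow> finite_dim_nichols_algebra (braiding_L p 1 1)) \<and>
     (\<forall>p a::'k. p \<noteq> 0 \<and> a \<noteq> 1 \<longrightarrow> finite_dim_nichols_algebra (braiding_L p 1 a)) \<and>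
     (\<forall>(q :: 't::finite option \<Rightarrow> 't option \<Rightarrow> 'k) (a :: 't \<Rightarrow> 'k).
        CARD('t) \<ge> 2 \<and> (\<forall>k. a k \<noteq> 0) \<and> (\<forall>i j. q i j \<noteq> 0) \<and>
        (\<forall>i. q i i = 1) \<and> (\<forall>i j. i \<noteq> j \<longrightarrow> q i j * q j i = 1) \<longrightarrow>
        finite_dim_nichols_algebra (braiding_P q a)) \<and>
     (\<forall>p::'k. p \<noteq> 0 \<longrightarrow> finite_dim_nichols_algebra (braiding_E p 1)) \<and>
     (\<forall>p \<omega>::'k. p \<noteq> 0 \<and> primitive_root_of_unity 3 \<omega> \<longrightarrow>
        finite_dim_nichols_algebra (braiding_E p \<omega>))"
proof (intro conjI allI impI)
  show L: "finite_dim_nichols_algebra (braiding_L p 1 a)" if "p \<noteq> 0 \<and> a \<noteq> 1" for p a :: 'k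
    using blocks_and_point.finite_dim_trivial_point[OF blocks_and_point_L[OF char_2]] that by simp
  show "finite_dim_nichols_algebra (braiding_L p 1 1)" if "p \<noteq> 0" for p :: 'k
    using blocks_and_point.finite_dim_trivial_point[OF blocks_and_point_L[OF char_2 that]] by simp
  show "finite_dim_nichols_algebra (braiding_P q a)"
    if "CARD('t) \<ge> 2 \<and> (\<forall>k. a k \<noteq> 0) \<and> (\<forall>i j. q i j \<noteq> 0) \<and>
        (\<forall>i. q i i = 1) \<and> (\<forall>i j. i \<noteq> j \<longrightarrow> q i j * q j i = 1)"
    for q :: "'t option \<Rightarrow> 't option \<Rightarrow> 'k" and a :: "'t \<Rightarrow> 'k"
    by (rule blocks_and_point.finite_dim_trivial_point[OF blocks_and_point_P[OF char_2]])
       (use that in auto)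
  \<comment> \<open>\<open>finite_dim_trivial_point\<close> makes no assumption on the entries
    \<open>B (Some k) k\<close>, so it also covers the trivial block.\<close>
  show "finite_dim_nichols_algebra (braiding_E p 1)" if "p \<noteq> 0" for p :: 'k
    using blocks_and_point.finite_dim_trivial_point[OF blocks_and_point_E[OF char_2 that]] by simp
  show "finite_dim_nichols_algebra (braiding_E p \<omega>)"
    if "p \<noteq> 0 \<and> primitive_root_of_unity 3 \<omega>" for p \<omega> :: 'k
  proof -
    have "\<omega> \<noteq> 0" using that by (auto simp: primitive_root_of_unity_def)
    then show ?thesis
      using that primitive_cube_root_char_2[OF char_2]
        blocks_and_point.finite_dim_cubic_point[OF blocks_and_point_E[OF char_2, of p \<omega>], of "()" \<omega>]
      by (simp add: B3_def)
  qed
qed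

end
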